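(* Let $d\ge1$, $\omega>0$, $\nu\ge0$, $\gamma>0$, $\beta=T^{-1}>0$ and $0<\underline m\le\overline m<\infty$. For every $N$ let $\{m_x\}_{x\in\mathbb T_N^d}$ be masses with $\underline m\le m_x\le\overline m$ for all $x$, and consider the noisy disordered harmonic dynamics on the discrete torus $\mathbb T_N^d=(\mathbb Z/N\mathbb Z)^d$ with generator $L=A+\gamma S$ started from the canonical Gibbs measure $\mu^N_\beta$ (defined in the context), with expectation denoted $\mathbb E_\beta$. Let $$\mathfrak J_{e_1}=\omega\sum_{z\in\mathbb T_N^d}\frac1{\sqrt{m_z}}\,\pi_z\cdot(q_{z+e_1}-q_{z-e_1})$$ be the total current in direction $e_1$ and $\mathfrak J_{e_1}(t)$ its value at time $t$. Then there exists a constant $C>0$, independent of $\lambda$ and $N$, such that $$C^{-1}\le\liminf_{\lambda\to0^+}\liminf_{N\to\infty}\int_0^\infty e^{-\lambda t}N^{-d}\,\mathbb E_\beta\left[\mathfrak J_{e_1}(t)\,\mathfrak J_{e_1}(0)\right]dt$$ $$\le\limsup_{\lambda\to0^+}\limsup_{N\to\infty}\int_0^\infty e^{-\lambda t}N^{-d}\,\mathbb E_\beta\left[\mathfrak J_{e_1}(t)\,\mathfrak J_{e_1}(0)\right]dt\le C.$$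
   Context: Configurations are $(\pi,q)=((\pi_x)_{x\in\mathbb T_N^d},(q_x)_{x\in\mathbb T_N^d})$ with $\pi_x,q_x\in\mathbb R^d$; $q_x$ is the displacement of atom $x$ and $\pi_x=\sqrt{m_x}\,v_x$ where $v_x$ is its velocity. $(e_1,\dots,e_d)$ is the canonical basis of $\mathbb R^d$ and $(\Delta F)(x)=\sum_{j=1}^d\{F(x+e_j)+F(x-e_j)-2F(x)\}$. The Hamiltonian is $H=\sum_{x\in\mathbb T_N^d}\left\{\frac{|\pi_x|^2}2+\frac12\,q_x\cdot(\nu I-\omega\Delta)q_x\right\}$. The generator is $L=A+\gamma S$, where $$A=\sum_{x\in\mathbb T_N^d}\frac1{\sqrt{m_x}}\left\{\pi_x\cdot\partial_{q_x}+[\omega\Delta q_x-\nu q_x]\cdot\partial_{\pi_x}\right\},\qquad S=\frac1{2d^2}\sum_{i,j,k=1}^d\sum_{x\in\mathbb T_N^d}\left[Y^{i,j}_{x,x+e_k}\right]^2,$$ $$Y^{i,j}_{x,x+e_k}=\pi^j_{x+e_k}\partial_{\pi^i_x}-\pi^i_x\partial_{\pi^j_{x+e_k}}.$$ The canonical Gibbs measure is $\mu^N_\beta(d\pi,dq)=Z_{N,\beta}^{-1}e^{-\beta H}d\pi\,dq$; it is stationary for the dynamics. When $\nu=0$, $q$ is considered modulo a common translation of all the $q_x$ (i.e. through the differences $q_x-q_y$), so that $\mu_\beta^N$ is a probability measure; the dynamics and $\mathfrak J_{e_1}$ are well defined on this quotient. *)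

theory Defs
  imports "HOL-Probability.Probability"
begin

text \<open>
  The dimension \<open>d\<close> is \<open>CARD('d)\<close>. The side length \<open>N\<close> varies, so the torus \<open>(Z/NZ)^d\<close> is a carrier set
  in \<open>int^'d\<close>: the vectors of residues in \<open>{0..<N}\<close>, with addition reduced modulo \<open>N\<close>.
\<close>

type_synonym 'd site = "int ^ 'd"
type_synonym 'd field = "'d site \<Rightarrow> real ^ 'd"
type_synonym 'd conf = "'d field \<times> 'd field"

definition torus :: "nat \<Rightarrow> ('d::finite) site set" where
  "torus N = {x. \<forall>i. 0 \<le> x $ i \<and> x $ i < int N}"

definition tadd :: "nat \<Rightarrow> ('d::finite) site \<Rightarrow> 'd site \<Rightarrow> 'd site" where
  "tadd N x v = (\<chi> i. (x $ i + v $ i) mod int N)"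

definition evec :: "'d::finite \<Rightarrow> 'd site" where
  "evec k = axis k 1"

definition laplace :: "nat \<Rightarrow> ('d::finite) field \<Rightarrow> 'd field" where
  "laplace N F x = (\<Sum>j\<in>UNIV. F (tadd N x (evec j)) + F (tadd N x (- evec j)) - 2 *\<^sub>R F x)"

text \<open>Configurations are pairs \<open>(p, q)\<close> of momenta and displacements.\<close>

definition phase :: "nat \<Rightarrow> ('d::finite) conf measure" where
  "phase N = (\<Pi>\<^sub>M x\<in>torus N. borel) \<Otimes>\<^sub>M (\<Pi>\<^sub>M x\<in>torus N. borel)"

definition hamiltonian :: "nat \<Rightarrow> real \<Rightarrow> real \<Rightarrow> ('d::finite) conf \<Rightarrow> real" where
  "hamiltonian N \<omega> \<nu> = (\<lambda>(p, q). \<Sum>x\<in>torus N.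
     (norm (p x))\<^sup>2 / 2 + (q x \<bullet> (\<nu> *\<^sub>R q x - \<omega> *\<^sub>R laplace N q x)) / 2)"

definition current :: "nat \<Rightarrow> (('d::finite) site \<Rightarrow> real) \<Rightarrow> real \<Rightarrow> 'd \<Rightarrow> 'd conf \<Rightarrow> real" where
  "current N m \<omega> k = (\<lambda>(p, q). \<omega> * (\<Sum>z\<in>torus N.
     (p z \<bullet> (q (tadd N z (evec k)) - q (tadd N z (- evec k)))) / sqrt (m z)))"


subsection \<open>Pinning and the Gibbs measure\<close>

text \<open>
  For \<open>\<nu> = 0\<close> displacements only matter up to a common translation. A class is identified with its
  representative having \<open>q 0 = 0\<close>. The translation-invariant measure on the quotient is then Lebesgue
  measure in the remaining displacements; choosing another site instead of \<open>0\<close> gives the same measure.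
\<close>

definition pin :: "nat \<Rightarrow> real \<Rightarrow> ('d::finite) conf \<Rightarrow> 'd conf" where
  "pin N \<nu> = (\<lambda>(p, q). (p, if \<nu> = 0 then (\<lambda>x\<in>torus N. q x - q 0) else q))"

definition ref_measure :: "nat \<Rightarrow> real \<Rightarrow> ('d::finite) conf measure" where
  "ref_measure N \<nu> =
     (\<Pi>\<^sub>M x\<in>torus N. lborel) \<Otimes>\<^sub>M
     (\<Pi>\<^sub>M x\<in>torus N. if \<nu> = 0 \<and> x = 0 then return borel 0 else lborel)"

definition gibbs :: "nat \<Rightarrow> real \<Rightarrow> real \<Rightarrow> real \<Rightarrow> ('d::finite) conf measure" where
  "gibbs N \<omega> \<nu> \<beta> = density (ref_measure N \<nu>)
     (\<lambda>z. ennreal (exp (- \<beta> * hamiltonian N \<omega> \<nu> z) /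
        (\<integral>z'. exp (- \<beta> * hamiltonian N \<omega> \<nu> z') \<partial>(ref_measure N \<nu> :: 'd conf measure))))"


subsection \<open>The generator\<close>

datatype 'd coord = Mom "'d site" 'd | Pos "'d site" 'd

definition coords :: "nat \<Rightarrow> ('d::finite) coord set" where
  "coords N = {Mom x i | x i. x \<in> torus N} \<union> {Pos x i | x i. x \<in> torus N}"

fun nudge :: "('d::finite) coord \<Rightarrow> real \<Rightarrow> 'd conf \<Rightarrow> 'd conf" where
  "nudge (Mom x i) t (p, q) = (p(x := p x + t *\<^sub>R axis i 1), q)"
| "nudge (Pos x i) t (p, q) = (p, q(x := q x + t *\<^sub>R axis i 1))"

definition pd :: "('d::finite) coord \<Rightarrow> ('d conf \<Rightarrow> real) \<Rightarrow> 'd conf \<Rightarrow> real" where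
  "pd c f z = deriv (\<lambda>t. f (nudge c t z)) 0"

definition gen_A :: "nat \<Rightarrow> (('d::finite) site \<Rightarrow> real) \<Rightarrow> real \<Rightarrow> real \<Rightarrow>
    ('d conf \<Rightarrow> real) \<Rightarrow> 'd conf \<Rightarrow> real" where
  "gen_A N m \<omega> \<nu> f z = (\<Sum>x\<in>torus N. 1 / sqrt (m x) * (\<Sum>i\<in>UNIV.
     fst z x $ i * pd (Pos x i) f z
     + (\<omega> *\<^sub>R laplace N (snd z) x - \<nu> *\<^sub>R snd z x) $ i * pd (Mom x i) f z))"

definition rot :: "'d::finite \<Rightarrow> 'd \<Rightarrow> 'd site \<Rightarrow> 'd site \<Rightarrow>
    ('d conf \<Rightarrow> real) \<Rightarrow> 'd conf \<Rightarrow> real" where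
  "rot i j x y f z = fst z y $ j * pd (Mom x i) f z - fst z x $ i * pd (Mom y j) f z"

definition gen_S :: "nat \<Rightarrow> (('d::finite) conf \<Rightarrow> real) \<Rightarrow> 'd conf \<Rightarrow> real" where
  "gen_S N f z = 1 / (2 * (real CARD('d))\<^sup>2) *
     (\<Sum>i\<in>UNIV. \<Sum>j\<in>UNIV. \<Sum>k\<in>UNIV. \<Sum>x\<in>torus N.
        rot i j x (tadd N x (evec k)) (rot i j x (tadd N x (evec k)) f) z)"

definition gen_L :: "nat \<Rightarrow> (('d::finite) site \<Rightarrow> real) \<Rightarrow> real \<Rightarrow> real \<Rightarrow> real \<Rightarrow>
    ('d conf \<Rightarrow> real) \<Rightarrow> 'd conf \<Rightarrow> real" where
  "gen_L N m \<omega> \<nu> \<gamma> f z = gen_A N m \<omega> \<nu> f z + \<gamma> * gen_S N f z"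


subsection \<open>The process with generator \<open>L\<close> started from the Gibbs measure\<close>

definition C1_conf :: "nat \<Rightarrow> (('d::finite) conf \<Rightarrow> real) \<Rightarrow> bool" where
  "C1_conf N f \<longleftrightarrow> continuous_on (space (phase N)) f \<and>
     (\<forall>c\<in>coords N. (\<forall>z\<in>space (phase N). (\<lambda>t. f (nudge c t z)) differentiable (at 0)) \<and>
        continuous_on (space (phase N)) (pd c f))"

definition C2_conf :: "nat \<Rightarrow> (('d::finite) conf \<Rightarrow> real) \<Rightarrow> bool" where
  "C2_conf N f \<longleftrightarrow> C1_conf N f \<and> (\<forall>c\<in>coords N. C1_conf N (pd c f))"

text \<open>
  Twice continuously differentiable functions of compact support. For \<open>\<nu> = 0\<close> these are functions on
  the quotient: invariant under common translations of the displacements, with support bounded in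
  the momenta and in the differences of displacements.
\<close>

definition test_fun :: "nat \<Rightarrow> real \<Rightarrow> (('d::finite) conf \<Rightarrow> real) \<Rightarrow> bool" where
  "test_fun N \<nu> f \<longleftrightarrow> C2_conf N f \<and>
     (\<nu> = 0 \<longrightarrow> (\<forall>(p, q)\<in>space (phase N). \<forall>a. f (p, \<lambda>x\<in>torus N. q x + a) = f (p, q))) \<and>
     (\<exists>R. \<forall>(p, q)\<in>space (phase N). f (p, q) \<noteq> 0 \<longrightarrow>
        (\<forall>x\<in>torus N. norm (p x) \<le> R) \<and>
        (if \<nu> = 0 then \<forall>x\<in>torus N. \<forall>y\<in>torus N. norm (q x - q y) \<le> R
         else \<forall>x\<in>torus N. norm (q x) \<le> R))"

definition natural_filtration ::
    "'w measure \<Rightarrow> 'a measure \<Rightarrow> (real \<Rightarrow> 'w \<Rightarrow> 'a) \<Rightarrow> real \<Rightarrow> 'w measure" where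
  "natural_filtration M E X s =
     sigma (space M) {X u -` B \<inter> space M | u B. 0 \<le> u \<and> u \<le> s \<and> B \<in> sets E}"

definition is_martingale ::
    "'w measure \<Rightarrow> (real \<Rightarrow> 'w measure) \<Rightarrow> (real \<Rightarrow> 'w \<Rightarrow> real) \<Rightarrow> bool" where
  "is_martingale M F Z \<longleftrightarrow>
     (\<forall>t\<ge>0. integrable M (Z t) \<and> Z t \<in> borel_measurable (F t)) \<and>
     (\<forall>s t. 0 \<le> s \<and> s \<le> t \<longrightarrow> (AE w in M. real_cond_exp M (F s) (Z t) w = Z s w))"

text \<open>
  \<open>X\<close> is a continuous process with initial law \<open>gibbs\<close> solving the martingale problem for
  \<open>L = A + \<gamma> S\<close>. For \<open>\<nu> = 0\<close>, \<open>X t w\<close> is a representative of the state, which is its class modulo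
  translations: initial law, test functions and current depend on the class only.
\<close>

definition stationary_dynamics :: "nat \<Rightarrow> (('d::finite) site \<Rightarrow> real) \<Rightarrow> real \<Rightarrow> real \<Rightarrow> real \<Rightarrow> real \<Rightarrow>
    'w measure \<Rightarrow> (real \<Rightarrow> 'w \<Rightarrow> 'd conf) \<Rightarrow> bool" where
  "stationary_dynamics N m \<omega> \<nu> \<gamma> \<beta> M X \<longleftrightarrow>
     prob_space M \<and>
     (\<forall>t\<ge>0. X t \<in> M \<rightarrow>\<^sub>M phase N) \<and>
     (\<forall>w\<in>space M. continuous_on {0..} (\<lambda>t. X t w)) \<and>
     distr M (phase N) (\<lambda>w. pin N \<nu> (X 0 w)) = gibbs N \<omega> \<nu> \<beta> \<and>
     (\<forall>f. test_fun N \<nu> f \<longrightarrow>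
        is_martingale M (natural_filtration M (phase N) X)
          (\<lambda>t w. f (X t w) - f (X 0 w)
             - (LBINT s:{0..t}. gen_L N m \<omega> \<nu> \<gamma> f (X s w))))"

definition current_correlation :: "nat \<Rightarrow> (('d::finite) site \<Rightarrow> real) \<Rightarrow> real \<Rightarrow> 'd \<Rightarrow>
    'w measure \<Rightarrow> (real \<Rightarrow> 'w \<Rightarrow> 'd conf) \<Rightarrow> real \<Rightarrow> real" where
  "current_correlation N m \<omega> k M X t =
     (\<integral>w. current N m \<omega> k (X t w) * current N m \<omega> k (X 0 w) \<partial>M)"

definition green_kubo :: "nat \<Rightarrow> (('d::finite) site \<Rightarrow> real) \<Rightarrow> real \<Rightarrow> 'd \<Rightarrow>
    'w measure \<Rightarrow> (real \<Rightarrow> 'w \<Rightarrow> 'd conf) \<Rightarrow> real \<Rightarrow> real" where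
  "green_kubo N m \<omega> k M X l =
     (LBINT t:{0..}. exp (- l * t) * (current_correlation N m \<omega> k M X t / real N ^ CARD('d)))"

end

theory Submission
  imports Defs "HOL-Real_Asymp.Real_Asymp"
begin

text \<open>
  Write \<open>T = 1/\<beta>\<close>, \<open>K = \<nu> - \<omega>\<Delta>\<close>, and \<open>r(x) = q(x)\<close> (or \<open>q(x) - q(0)\<close> if \<open>\<nu> = 0\<close>), and let \<open>a(x,y)\<close>, \<open>b(x,y)\<close>, \<open>g(x,y)\<close>
  be the Laplace transforms of the correlations of \<open>\<pi>(x)\<bullet>\<pi>(y)\<close>, \<open>\<pi>(x)\<bullet>r(y)\<close>, \<open>r(x)\<bullet>r(y)\<close> at time \<open>t\<close> with the
  current at time \<open>0\<close>. Since \<open>L\<close> preserves quadratic forms, Dynkin's formula turns into a closed linear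
  system for \<open>(a, b, g)\<close>. Pairing its equations with \<open>a/2\<close>, \<open>b K\<close> and \<open>K g K/2\<close> cancels all terms coming from \<open>A\<close>,
  and Gaussian integration by parts identifies the source term with \<open>T\<^sup>2 d\<close> times the transform \<open>G\<close> of the
  current autocorrelation. Hence \<open>T\<^sup>2 d G\<close> dominates \<open>\<gamma>\<close> times the squared norms of \<open>b(x,x+e) - b(x,x-e)\<close>
  and of the nearest-neighbour part of \<open>a\<close>. As \<open>G\<close> is linear in the former, Cauchy-Schwarz gives the upper
  bound. For the lower bound one tests the equation for \<open>b\<close> with the square roots of the masses: the terms in
  \<open>g\<close> cancel by symmetry, and the source is of the order of the volume because the variance of
  \<open>r(x+e) - r(x-e)\<close> is bounded below.
\<close>


section \<open>The discrete torus\<close>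

text \<open>The martingale problem speaks about compactly supported functions only, while the
  moments are unbounded. The bridge is that \<open>A\<close> and every rotation in \<open>S\<close>
  annihilate the Hamiltonian: a cutoff depending on the energy alone commutes with \<open>L\<close>,
  and functions of the energy alone are seen to be almost surely conserved. Polynomials of the state
  at time \<open>t\<close> are then dominated by polynomials of the energy at time 0, so that only
  the law at time 0 is ever integrated against. The noise is the sole source of dissipation: it
  damps \<open>b\<close> and the off-diagonal part of \<open>a\<close>, but does not act on
  \<open>g\<close>. The lower bound must therefore avoid \<open>g\<close>. The weights
  \<open>sqrt (m x)\<close> do this because they strip the mass factor from the force term, which
  becomes a sum invariant under translation and exchange of sites. What the disorder leaves behind
  is an antisymmetric combination of nearest-neighbour entries of \<open>a\<close>, exactly the
  entries that the noise controls. Every estimate holds with constants that do not depend on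
  \<open>N \<ge> 3\<close> and \<open>0 < l \<le> 1\<close>; limits enter only at the very
  end.\<close>

lemma zero_in_torus: "N \<ge> 1 \<Longrightarrow> 0 \<in> torus N"
  by (auto simp: torus_def)

lemma tadd_in_torus: "N \<ge> 1 \<Longrightarrow> tadd N x v \<in> torus N"
  by (auto simp: torus_def tadd_def)

lemma bij_betw_torus_PiE:
  "bij_betw vec_nth (torus N :: 'd::finite site set) (UNIV \<rightarrow>\<^sub>E {0..<int N})"
  by (rule bij_betw_byWitness[where f' = vec_lambda]) (auto simp: torus_def fun_eq_iff)

lemma finite_torus [simp]: "finite (torus N :: 'd::finite site set)"
  using bij_betw_finite[OF bij_betw_torus_PiE] by (simp add: finite_PiE)

lemma card_torus: "card (torus N :: 'd::finite site set) = N ^ CARD('d)"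
  using bij_betw_same_card[OF bij_betw_torus_PiE] by (simp add: card_PiE)

lemma tadd_tadd: "tadd N (tadd N x u) v = tadd N x (u + v)"
  by (simp add: tadd_def vec_eq_iff mod_add_left_eq add.assoc)

lemma tadd_0: "x \<in> torus N \<Longrightarrow> tadd N x 0 = x"
  by (simp add: tadd_def torus_def vec_eq_iff)

lemma tadd_inverse:
  "x \<in> torus N \<Longrightarrow> tadd N (tadd N x v) (- v) = x"
  "x \<in> torus N \<Longrightarrow> tadd N (tadd N x (- v)) v = x"
  by (simp_all add: tadd_tadd tadd_0)

lemma tadd_commute: "tadd N (tadd N x u) v = tadd N (tadd N x v) u"
  by (simp add: tadd_tadd add.commute)

lemma bij_betw_tadd: "N \<ge> 1 \<Longrightarrow> bij_betw (\<lambda>x. tadd N x v) (torus N) (torus N)"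
  by (rule bij_betw_byWitness[where f' = "\<lambda>x. tadd N x (- v)"])
     (auto simp: tadd_inverse tadd_in_torus)

lemma sum_tadd: "N \<ge> 1 \<Longrightarrow> (\<Sum>x\<in>torus N. f (tadd N x v)) = (\<Sum>x\<in>torus N. f x)"
  using sum.reindex_bij_betw[OF bij_betw_tadd] by blast

lemma tadd_evec_neq:
  assumes "N \<ge> 2" "x \<in> torus N"
  shows "tadd N x (evec k) \<noteq> x" "tadd N x (- evec k) \<noteq> x"
proof -
  have 1: "tadd N x (evec k) \<noteq> x" if x: "x \<in> torus N" for x
  proof
    assume "tadd N x (evec k) = x"
    hence "(x $ k + 1) mod int N = x $ k mod int N"
      using x by (auto simp: vec_eq_iff tadd_def evec_def torus_def dest: spec[of _ k])
    hence "int N dvd 1"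
      by (metis add_diff_cancel_left' mod_eq_dvd_iff)
    thus False using assms(1) by auto
  qed
  show "tadd N x (evec k) \<noteq> x" using 1 assms(2) .
  show "tadd N x (- evec k) \<noteq> x"
  proof
    assume a: "tadd N x (- evec k) = x"
    hence "tadd N x (evec k) = x"
      by (metis assms(2) tadd_inverse(2))
    thus False using 1 assms by blast
  qed
qed

text \<open>For \<open>N = 2\<close> the two neighbours coincide and the current is identically
  zero. This is the origin of the restriction \<open>N \<ge> 3\<close>, which is harmless for the
  limit.\<close>

lemma tadd_evec_neq_minus:
  assumes "N \<ge> 3"
  shows "tadd N x (evec k) \<noteq> tadd N x (- evec k)"
proof
  assume "tadd N x (evec k) = tadd N x (- evec k)"
  hence "(x $ k + 1) mod int N = (x $ k - 1) mod int N"
    by (auto simp: vec_eq_iff tadd_def evec_def dest: spec[of _ k])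
  hence "int N dvd (x $ k + 1) - (x $ k - 1)"
    by (simp only: mod_eq_dvd_iff)
  hence "int N dvd 2" by simp
  thus False using assms zdvd_imp_le by fastforce
qed

text \<open>Lowering a nonzero coordinate by one never wraps around, so every site is reached from
  \<open>0\<close> by unit steps inside the box. This carries bounds from the pinned site to all
  others.\<close>

lemma torus_induct [consumes 2, case_names zero step]:
  assumes "x \<in> torus N" and N: "N \<ge> 1"
    and "P 0" and step: "\<And>x k. x \<in> torus N \<Longrightarrow> P x \<Longrightarrow> P (tadd N x (evec k))"
  shows "P x"
  using assms(1)
proof (induction "nat (\<Sum>i\<in>UNIV. x $ i)" arbitrary: x rule: less_induct)
  case (less x)
  have x: "0 \<le> x $ i" "x $ i < int N" for i
    using less.prems by (auto simp: torus_def)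
  show ?case
  proof (cases "x = 0")
    case False
    then obtain k where k: "x $ k \<noteq> 0" by (auto simp: vec_eq_iff)
    define y where "y = x - evec k"
    have yk: "y $ i = (if i = k then x $ i - 1 else x $ i)" for i
      by (simp add: y_def evec_def axis_def)
    have y: "y \<in> torus N"
      using x k by (auto simp: torus_def yk) (smt (verit, best))+
    have "(\<Sum>i\<in>UNIV. y $ i) = (\<Sum>i\<in>UNIV. x $ i) - (\<Sum>i\<in>UNIV. if i = k then 1 else 0)"
      unfolding sum_subtractf[symmetric] by (intro sum.cong) (auto simp: yk)
    hence s: "(\<Sum>i\<in>UNIV. y $ i) = (\<Sum>i\<in>UNIV. x $ i) - 1" by simp
    have "(\<Sum>i\<in>UNIV. y $ i) \<ge> 0" using y by (auto intro: sum_nonneg simp: torus_def)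
    hence "P y" using s y by (intro less.hyps) auto
    moreover have "tadd N y (evec k) = x"
      using x by (auto simp: tadd_def vec_eq_iff y_def)
    ultimately show ?thesis using step[OF y] by metis
  qed (use assms in auto)
qed

section \<open>The operator \<open>\<nu> - \<omega>\<Delta>\<close> on scalar fields\<close>

definition kop :: "nat \<Rightarrow> real \<Rightarrow> real \<Rightarrow> (('d::finite) site \<Rightarrow> real) \<Rightarrow> 'd site \<Rightarrow> real" where
  "kop N \<omega> \<nu> u x =
     \<nu> * u x - \<omega> * (\<Sum>j\<in>UNIV. u (tadd N x (evec j)) + u (tadd N x (- evec j)) - 2 * u x)"

lemma kop_add: "kop N \<omega> \<nu> (\<lambda>x. u x + v x) x = kop N \<omega> \<nu> u x + kop N \<omega> \<nu> v x"
  by (simp add: kop_def algebra_simps sum.distrib sum_subtractf)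

lemma kop_diff: "kop N \<omega> \<nu> (\<lambda>x. u x - v x) x = kop N \<omega> \<nu> u x - kop N \<omega> \<nu> v x"
  by (simp add: kop_def algebra_simps sum.distrib sum_subtractf)

lemma kop_cmult: "kop N \<omega> \<nu> (\<lambda>x. a * u x) x = a * kop N \<omega> \<nu> u x"
proof -
  have "(\<Sum>j\<in>UNIV. a * u (tadd N x (evec j)) + a * u (tadd N x (- evec j)) - 2 * (a * u x)) =
    a * (\<Sum>j\<in>UNIV. u (tadd N x (evec j)) + u (tadd N x (- evec j)) - 2 * u x)"
    unfolding sum_distrib_left by (intro sum.cong) (auto simp: algebra_simps)
  thus ?thesis by (simp add: kop_def algebra_simps)
qed

lemma kop_sum: "finite I \<Longrightarrow> kop N \<omega> \<nu> (\<lambda>x. \<Sum>i\<in>I. u i x) x = (\<Sum>i\<in>I. kop N \<omega> \<nu> (u i) x)"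
proof (induction rule: finite_induct)
  case empty thus ?case by (simp add: kop_def)
qed (simp add: kop_add)

lemma kop_const: "kop N \<omega> \<nu> (\<lambda>_. a) x = \<nu> * a"
  by (simp add: kop_def)

lemma kop_cong:
  assumes "N \<ge> 1" "x \<in> torus N" "\<And>y. y \<in> torus N \<Longrightarrow> u y = v y"
  shows "kop N \<omega> \<nu> u x = kop N \<omega> \<nu> v x"
  using assms by (simp add: kop_def tadd_in_torus)

text \<open>Summation by parts in polarised form; symmetry and positivity of the operator are both
  read off from the right-hand side.\<close>

lemma kop_dirichlet:
  assumes "N \<ge> 1"
  shows "(\<Sum>x\<in>torus N. u x * kop N \<omega> \<nu> v x) = \<nu> * (\<Sum>x\<in>torus N. u x * v x) +
    \<omega> * (\<Sum>x\<in>torus N. \<Sum>j\<in>UNIV. (u (tadd N x (evec j)) - u x) * (v (tadd N x (evec j)) - v x))"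
proof -
  have *: "(\<Sum>x\<in>torus N. u x * (v (tadd N x (evec j)) + v (tadd N x (- evec j)) - 2 * v x)) =
     - (\<Sum>x\<in>torus N. (u (tadd N x (evec j)) - u x) * (v (tadd N x (evec j)) - v x))" for j
  proof -
    have 1: "(\<Sum>x\<in>torus N. u (tadd N x (evec j)) * v (tadd N x (evec j))) = (\<Sum>x\<in>torus N. u x * v x)"
      using sum_tadd[OF assms, of "\<lambda>x. u x * v x"] .
    have "(\<Sum>x\<in>torus N. u x * v (tadd N x (- evec j))) =
        (\<Sum>x\<in>torus N. u (tadd N x (evec j)) * v (tadd N (tadd N x (evec j)) (- evec j)))"
      using sum_tadd[OF assms, of "\<lambda>x. u x * v (tadd N x (- evec j))"] by metis
    also have "\<dots> = (\<Sum>x\<in>torus N. u (tadd N x (evec j)) * v x)"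
      by (intro sum.cong) (auto simp: tadd_inverse)
    finally have 2: "(\<Sum>x\<in>torus N. u x * v (tadd N x (- evec j))) = (\<Sum>x\<in>torus N. u (tadd N x (evec j)) * v x)" .
    have "(\<Sum>x\<in>torus N. u x * (v (tadd N x (evec j)) + v (tadd N x (- evec j)) - 2 * v x)) =
      (\<Sum>x\<in>torus N. u x * v (tadd N x (evec j))) + (\<Sum>x\<in>torus N. u x * v (tadd N x (- evec j))) -
      (\<Sum>x\<in>torus N. u x * v x) - (\<Sum>x\<in>torus N. u x * v x)"
      unfolding sum.distrib[symmetric] sum_subtractf[symmetric] by (intro sum.cong refl) algebra
    also have "\<dots> = - (\<Sum>x\<in>torus N. u (tadd N x (evec j)) * v (tadd N x (evec j)) + u x * v x -
        u x * v (tadd N x (evec j)) - u (tadd N x (evec j)) * v x)"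
      by (simp add: sum.distrib sum_subtractf 1 2)
    also have "\<dots> = - (\<Sum>x\<in>torus N. (u (tadd N x (evec j)) - u x) * (v (tadd N x (evec j)) - v x))"
      by (intro arg_cong[of _ _ uminus] sum.cong refl) algebra
    finally show ?thesis .
  qed
  have "(\<Sum>x\<in>torus N. u x * kop N \<omega> \<nu> v x) = \<nu> * (\<Sum>x\<in>torus N. u x * v x) -
    \<omega> * (\<Sum>x\<in>torus N. \<Sum>j\<in>UNIV. u x * (v (tadd N x (evec j)) + v (tadd N x (- evec j)) - 2 * v x))"
    unfolding kop_def sum_distrib_left sum_subtractf[symmetric]
    by (intro sum.cong refl) (simp add: algebra_simps sum_distrib_left)
  also have "(\<Sum>x\<in>torus N. \<Sum>j\<in>UNIV. u x * (v (tadd N x (evec j)) + v (tadd N x (- evec j)) - 2 * v x)) =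
     - (\<Sum>x\<in>torus N. \<Sum>j\<in>UNIV. (u (tadd N x (evec j)) - u x) * (v (tadd N x (evec j)) - v x))"
    by (subst (1 2) sum.swap) (simp add: * sum_negf)
  finally show ?thesis by simp
qed

lemma kop_symmetric:
  assumes "N \<ge> 1"
  shows "(\<Sum>x\<in>torus N. u x * kop N \<omega> \<nu> v x) = (\<Sum>x\<in>torus N. kop N \<omega> \<nu> u x * v x)"
proof -
  have "(\<Sum>x\<in>torus N. kop N \<omega> \<nu> u x * v x) = (\<Sum>x\<in>torus N. v x * kop N \<omega> \<nu> u x)"
    by (simp add: mult.commute)
  also have "\<dots> = (\<Sum>x\<in>torus N. u x * kop N \<omega> \<nu> v x)"
    unfolding kop_dirichlet[OF assms] by (simp add: mult.commute)
  finally show ?thesis by simp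
qed

lemma kop_nonneg:
  assumes "N \<ge> 1" "\<omega> \<ge> 0" "\<nu> \<ge> 0"
  shows "(\<Sum>x\<in>torus N. u x * kop N \<omega> \<nu> u x) \<ge> 0"
  unfolding kop_dirichlet[OF assms(1)] using assms(2,3) by (intro add_nonneg_nonneg mult_nonneg_nonneg[OF assms(2)] mult_nonneg_nonneg[OF assms(3)] sum_nonneg) auto

text \<open>Symmetry tested against the constant field, on which the operator is multiplication by
  \<open>\<nu>\<close>. For \<open>\<nu> = 0\<close> it says that the total force vanishes.\<close>

lemma sum_kop:
  assumes "N \<ge> 1"
  shows "(\<Sum>x\<in>torus N. kop N \<omega> \<nu> u x) = \<nu> * (\<Sum>x\<in>torus N. u x)"
  using kop_symmetric[OF assms, of "\<lambda>_. 1" \<omega> \<nu> u] by (simp add: kop_const sum_distrib_left)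

text \<open>The inner operator is a finite linear combination of shifts in \<open>x\<close>, and the
  outer one, acting in \<open>y\<close>, passes through it by linearity.\<close>

lemma kop_commute:
  "kop N \<omega> \<nu> (\<lambda>y. kop N \<omega> \<nu> (\<lambda>x. F x y) x) y = kop N \<omega> \<nu> (\<lambda>x. kop N \<omega> \<nu> (\<lambda>y. F x y) y) x"
proof -
  have "kop N \<omega> \<nu> (\<lambda>y. kop N \<omega> \<nu> (\<lambda>x. F x y) x) y = kop N \<omega> \<nu> (\<lambda>y. \<nu> * F x y - \<omega> * (\<Sum>j\<in>UNIV. F (tadd N x (evec j)) y + F (tadd N x (- evec j)) y - 2 * F x y)) y"
    by (simp add: kop_def[of N \<omega> \<nu> "\<lambda>x. F x _"])
  also have "\<dots> = \<nu> * kop N \<omega> \<nu> (\<lambda>y. F x y) y - \<omega> * (\<Sum>j\<in>UNIV. kop N \<omega> \<nu> (\<lambda>y. F (tadd N x (evec j)) y) y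
      + kop N \<omega> \<nu> (\<lambda>y. F (tadd N x (- evec j)) y) y - 2 * kop N \<omega> \<nu> (\<lambda>y. F x y) y)"
    by (simp only: kop_diff kop_cmult kop_sum[OF finite] kop_add)
  also have "\<dots> = kop N \<omega> \<nu> (\<lambda>x. kop N \<omega> \<nu> (\<lambda>y. F x y) y) x"
    by (subst (4) kop_def) (rule refl)
  finally show ?thesis .
qed

text \<open>Positivity of a tensor square without spectral theory: the Dirichlet form in
  \<open>x\<close> reduces it to positivity in \<open>y\<close>, applied to \<open>F\<close> and to
  the increments of \<open>F\<close> in \<open>x\<close>.\<close>

lemma kop_kop_nonneg:
  assumes N: "N \<ge> 1" and "\<omega> \<ge> 0" "\<nu> \<ge> 0"
  shows "(\<Sum>x\<in>torus N. \<Sum>y\<in>torus N. F x y * kop N \<omega> \<nu> (\<lambda>y. kop N \<omega> \<nu> (\<lambda>x. F x y) x) y) \<ge> 0"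
proof -
  let ?d = "\<lambda>x j y. F (tadd N x (evec j)) y - F x y"
  have "(\<Sum>x\<in>torus N. \<Sum>y\<in>torus N. F x y * kop N \<omega> \<nu> (\<lambda>y. kop N \<omega> \<nu> (\<lambda>x. F x y) x) y)
    = (\<Sum>y\<in>torus N. \<Sum>x\<in>torus N. F x y * kop N \<omega> \<nu> (\<lambda>x. kop N \<omega> \<nu> (\<lambda>y. F x y) y) x)"
    by (subst sum.swap) (intro sum.cong refl arg_cong2[of _ _ _ _ "(*)"] kop_commute)
  also have "\<dots> = (\<Sum>y\<in>torus N. \<nu> * (\<Sum>x\<in>torus N. F x y * kop N \<omega> \<nu> (F x) y) +
     \<omega> * (\<Sum>x\<in>torus N. \<Sum>j\<in>UNIV. ?d x j y * kop N \<omega> \<nu> (?d x j) y))"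
    unfolding kop_dirichlet[OF N] kop_diff ..
  also have "\<dots> = \<nu> * (\<Sum>y\<in>torus N. (\<Sum>x\<in>torus N. F x y * kop N \<omega> \<nu> (F x) y)) +
     \<omega> * (\<Sum>y\<in>torus N. \<Sum>x\<in>torus N. \<Sum>j\<in>UNIV. ?d x j y * kop N \<omega> \<nu> (?d x j) y)"
    by (simp add: sum.distrib sum_distrib_left)
  also have "(\<Sum>y\<in>torus N. (\<Sum>x\<in>torus N. F x y * kop N \<omega> \<nu> (F x) y))
     = (\<Sum>x\<in>torus N. (\<Sum>y\<in>torus N. F x y * kop N \<omega> \<nu> (F x) y))" by (rule sum.swap)
  also have "(\<Sum>y\<in>torus N. \<Sum>x\<in>torus N. \<Sum>j\<in>UNIV. ?d x j y * kop N \<omega> \<nu> (?d x j) y)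
     = (\<Sum>x\<in>torus N. \<Sum>j\<in>UNIV. \<Sum>y\<in>torus N. ?d x j y * kop N \<omega> \<nu> (?d x j) y)"
    by (subst sum.swap, intro sum.cong refl, rule sum.swap)
  also have "\<nu> * (\<Sum>x\<in>torus N. (\<Sum>y\<in>torus N. F x y * kop N \<omega> \<nu> (F x) y)) + \<omega> * \<dots> \<ge> 0"
    by (intro add_nonneg_nonneg mult_nonneg_nonneg[OF assms(2)] mult_nonneg_nonneg[OF assms(3)] sum_nonneg kop_nonneg[OF assms])
  finally show ?thesis .
qed


section \<open>The resolvent equations for the second moments\<close>

text \<open>The action of \<open>S\<close> on the matrix of products of momenta, as
  \<open>gen_S_pp\<close> shows. Off the diagonal it is decay at rate at least 2; on the diagonal it
  is \<open>1/d\<close> times the lattice Laplacian of the diagonal entries, that is, diffusion of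
  kinetic energy.\<close>

definition noise :: "nat \<Rightarrow> (('d::finite) site \<Rightarrow> 'd site \<Rightarrow> real) \<Rightarrow> 'd site \<Rightarrow> 'd site \<Rightarrow> real" where
  "noise N a x y = - 2 * a x y
     - (1 / (real CARD('d))\<^sup>2) * (\<Sum>k\<in>UNIV. of_bool (tadd N x (evec k) = y) + of_bool (tadd N y (evec k) = x)) * a x y
     + of_bool (x = y) * ((1 / real CARD('d)) *
        (\<Sum>k\<in>UNIV. a (tadd N x (evec k)) (tadd N x (evec k)) + a (tadd N x (- evec k)) (tadd N x (- evec k))))"

text \<open>The diagonal entries contribute \<open>-1/d\<close> times a Dirichlet form, hence
  nothing positive, and each off-diagonal entry at most \<open>-2\<close> times its square. Of the
  latter only the bonds in direction \<open>k\<close> are kept.\<close>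

lemma noise_dissipative:
  fixes a :: "('d::finite) site \<Rightarrow> 'd site \<Rightarrow> real"
  assumes N: "N \<ge> 2"
  shows "(\<Sum>x\<in>torus N. \<Sum>y\<in>torus N. a x y * noise N a x y) \<le>
    - 2 * (\<Sum>x\<in>torus N. (a x (tadd N x (evec k)))\<^sup>2)"
proof -
  have N1: "N \<ge> 1" using N by simp
  let ?d = "real CARD('d)"
  let ?b = "\<lambda>x. a x x"
  let ?D = "\<lambda>x. \<Sum>k\<in>UNIV. a (tadd N x (evec k)) (tadd N x (evec k)) + a (tadd N x (- evec k)) (tadd N x (- evec k))"
  \<comment> \<open>The additional damping of neighbouring pairs has the good sign and is
    dropped.\<close>
  have pw: "a x y * noise N a x y \<le> - 2 * (a x y)\<^sup>2 + of_bool (x = y) * ((1 / ?d) * (?b x * ?D x))" for x y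
  proof -
    have "(1 / ?d\<^sup>2) * (\<Sum>k\<in>UNIV. of_bool (tadd N x (evec k) = y) + of_bool (tadd N y (evec k) = x)) * (a x y)\<^sup>2 \<ge> 0"
      by (intro mult_nonneg_nonneg sum_nonneg) auto
    thus ?thesis by (auto simp: noise_def algebra_simps power2_eq_square)
  qed
  have kop0: "kop N 1 0 ?b x = 2 * ?d * ?b x - ?D x" for x
    by (simp add: kop_def sum.distrib sum_subtractf)
  have "(\<Sum>x\<in>torus N. ?b x * kop N 1 0 ?b x) \<ge> 0"
    using kop_nonneg[OF N1, of 1 0 ?b] by simp
  hence "(\<Sum>x\<in>torus N. 2 * ?d * (?b x)\<^sup>2 - ?b x * ?D x) \<ge> 0"
    unfolding kop0 by (simp add: algebra_simps power2_eq_square)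
  hence "(\<Sum>x\<in>torus N. ?b x * ?D x) \<le> 2 * ?d * (\<Sum>x\<in>torus N. (?b x)\<^sup>2)"
    by (simp add: sum_subtractf sum_distrib_left)
  hence diag: "(1 / ?d) * (\<Sum>x\<in>torus N. ?b x * ?D x) \<le> 2 * (\<Sum>x\<in>torus N. (?b x)\<^sup>2)"
    by (simp add: field_simps)
  have "(\<Sum>x\<in>torus N. \<Sum>y\<in>torus N. a x y * noise N a x y) \<le>
     (\<Sum>x\<in>torus N. \<Sum>y\<in>torus N. - 2 * (a x y)\<^sup>2 + of_bool (x = y) * ((1 / ?d) * (?b x * ?D x)))"
    by (intro sum_mono pw)
  also have "\<dots> = - 2 * (\<Sum>x\<in>torus N. \<Sum>y\<in>torus N. (a x y)\<^sup>2) +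
      (\<Sum>x\<in>torus N. \<Sum>y\<in>torus N. of_bool (x = y) * ((1 / ?d) * (?b x * ?D x)))"
    by (simp only: sum.distrib sum_distrib_left)
  also have "(\<Sum>x\<in>torus N. \<Sum>y\<in>torus N. of_bool (x = y) * ((1 / ?d) * (?b x * ?D x)))
      = (1 / ?d) * (\<Sum>x\<in>torus N. ?b x * ?D x)"
    unfolding sum_distrib_left[of "1 / ?d" "\<lambda>x. ?b x * ?D x"]
  proof (intro sum.cong refl)
    fix x :: "'d site" assume "x \<in> torus N"
    moreover have "(\<Sum>y\<in>torus N. of_bool (x = y) * ((1 / ?d) * (?b x * ?D x))) =
       (\<Sum>y\<in>torus N. if x = y then (1 / ?d) * (?b x * ?D x) else 0)"
      by (intro sum.cong refl) simp
    ultimately show "(\<Sum>y\<in>torus N. of_bool (x = y) * ((1 / ?d) * (?b x * ?D x))) = (1 / ?d) * (?b x * ?D x)"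
      by (simp only: sum.delta'[OF finite_torus] if_True)
  qed
  also have "\<dots> \<le> 2 * (\<Sum>x\<in>torus N. (?b x)\<^sup>2)" by (rule diag)
  finally have 1: "(\<Sum>x\<in>torus N. \<Sum>y\<in>torus N. a x y * noise N a x y) \<le>
     - 2 * (\<Sum>x\<in>torus N. (\<Sum>y\<in>torus N. (a x y)\<^sup>2) - (?b x)\<^sup>2)"
    by (simp add: sum_subtractf algebra_simps)
  have "(a x (tadd N x (evec k)))\<^sup>2 \<le> (\<Sum>y\<in>torus N. (a x y)\<^sup>2) - (?b x)\<^sup>2" if x: "x \<in> torus N" for x
  proof -
    have "(\<Sum>y\<in>{x, tadd N x (evec k)}. (a x y)\<^sup>2) \<le> (\<Sum>y\<in>torus N. (a x y)\<^sup>2)"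
      using x tadd_in_torus[OF N1] by (intro sum_mono2) auto
    thus ?thesis using tadd_evec_neq[OF N x] by (simp add: eq_commute[of x])
  qed
  hence "(\<Sum>x\<in>torus N. (a x (tadd N x (evec k)))\<^sup>2) \<le> (\<Sum>x\<in>torus N. (\<Sum>y\<in>torus N. (a x y)\<^sup>2) - (?b x)\<^sup>2)"
    by (intro sum_mono) auto
  with 1 show ?thesis by simp
qed

section \<open>The linear system for the moments: energy estimate and bounds on the current\<close>

text \<open>The source \<open>c\<close> is the covariance of momentum-displacement products with the
  current at time 0; the other two kinds of products are uncorrelated with the current, so only
  \<open>eq_b\<close> has a source. The terms with \<open>\<sigma>\<close>, which stands for
  \<open>pinned \<nu>\<close>, come from the motion of the reference site \<open>0\<close>.\<close>

locale moment_equations =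
  fixes N :: nat and \<omega> \<nu> \<gamma> l \<sigma> :: real and s :: "('d::finite) site \<Rightarrow> real"
    and a b g c :: "'d site \<Rightarrow> 'd site \<Rightarrow> real"
  assumes N: "N \<ge> 3" and pos: "\<omega> > 0" "\<nu> \<ge> 0" "\<gamma> > 0" "l > 0" and \<sigma>: "\<sigma> * \<nu> = 0"
    and sym: "\<And>x y. a x y = a y x" "\<And>x y. g x y = g y x"
    and eq_a: "\<And>x y. x \<in> torus N \<Longrightarrow> y \<in> torus N \<Longrightarrow>
      l * a x y = - s x * kop N \<omega> \<nu> (b y) x - s y * kop N \<omega> \<nu> (b x) y + \<gamma> * noise N a x y"
    and eq_b: "\<And>x y. x \<in> torus N \<Longrightarrow> y \<in> torus N \<Longrightarrow>
      l * b x y = c x y + s y * a x y - \<sigma> * s 0 * a x 0 - s x * kop N \<omega> \<nu> (\<lambda>w. g w y) x - \<gamma> * b x y"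
    and eq_g: "\<And>x y. x \<in> torus N \<Longrightarrow> y \<in> torus N \<Longrightarrow>
      l * g x y = s x * b x y - \<sigma> * s 0 * b 0 y + s y * b y x - \<sigma> * s 0 * b 0 x"
begin

lemma N1: "N \<ge> 1" and N2: "N \<ge> 2" using N by auto

abbreviation "K \<equiv> kop N \<omega> \<nu>"
abbreviation "\<Lambda> \<equiv> torus N :: 'd site set"

definition "kg x y = K (\<lambda>w. g w y) x"
definition "kkg x y = K (kg x) y"

lemma kkg_sym: "kkg x y = kkg y x"
proof -
  have "kkg x y = K (\<lambda>y. K (\<lambda>w. g w y) x) y" by (simp add: kkg_def kg_def[abs_def])
  also have "\<dots> = K (\<lambda>x. K (\<lambda>y. g x y) y) x" by (rule kop_commute)
  also have "\<dots> = K (\<lambda>x. K (\<lambda>w. g w x) y) x" by (simp only: sym(2)[of x for x])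
  finally show ?thesis by (simp add: kkg_def kg_def[abs_def])
qed

text \<open>Exchanging \<open>x\<close> and \<open>y\<close> identifies the two transport terms;
  together they are twice the cross term that occurs with the opposite sign in
  \<open>energy_b\<close>.\<close>

lemma energy_a:
  "l * (\<Sum>x\<in>\<Lambda>. \<Sum>y\<in>\<Lambda>. (a x y)\<^sup>2) =
     - 2 * (\<Sum>x\<in>\<Lambda>. \<Sum>y\<in>\<Lambda>. s y * a x y * K (b x) y) + \<gamma> * (\<Sum>x\<in>\<Lambda>. \<Sum>y\<in>\<Lambda>. a x y * noise N a x y)"
proof -
  have "l * (\<Sum>x\<in>\<Lambda>. \<Sum>y\<in>\<Lambda>. (a x y)\<^sup>2) = (\<Sum>x\<in>\<Lambda>. \<Sum>y\<in>\<Lambda>. a x y * (l * a x y))"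
    by (simp add: sum_distrib_left power2_eq_square mult_ac)
  also have "\<dots> = (\<Sum>x\<in>\<Lambda>. \<Sum>y\<in>\<Lambda>. - (s x * a x y * K (b y) x) - s y * a x y * K (b x) y + \<gamma> * (a x y * noise N a x y))"
    by (intro sum.cong refl) (simp add: eq_a algebra_simps)
  also have "\<dots> = - (\<Sum>x\<in>\<Lambda>. \<Sum>y\<in>\<Lambda>. s x * a x y * K (b y) x) - (\<Sum>x\<in>\<Lambda>. \<Sum>y\<in>\<Lambda>. s y * a x y * K (b x) y)
       + \<gamma> * (\<Sum>x\<in>\<Lambda>. \<Sum>y\<in>\<Lambda>. a x y * noise N a x y)"
    by (simp add: sum.distrib sum_subtractf sum_distrib_left sum_negf)
  also have "(\<Sum>x\<in>\<Lambda>. \<Sum>y\<in>\<Lambda>. s x * a x y * K (b y) x) = (\<Sum>x\<in>\<Lambda>. \<Sum>y\<in>\<Lambda>. s y * a x y * K (b x) y)"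
    by (subst sum.swap) (intro sum.cong refl arg_cong2[of _ _ _ _ "(*)"] sym(1))
  finally show ?thesis by simp
qed

text \<open>This removes all terms produced by the moving reference site: each of them is constant
  in one variable and is paired there with the image of \<open>K\<close>.\<close>

lemma sigma_sum_kop: "\<sigma> * (\<Sum>y\<in>\<Lambda>. K u y) = 0"
  using \<sigma> by (auto simp: sum_kop[OF N1])

lemma energy_b:
  "(l + \<gamma>) * (\<Sum>x\<in>\<Lambda>. \<Sum>y\<in>\<Lambda>. b x y * K (b x) y) =
     (\<Sum>x\<in>\<Lambda>. \<Sum>y\<in>\<Lambda>. c x y * K (b x) y) + (\<Sum>x\<in>\<Lambda>. \<Sum>y\<in>\<Lambda>. s y * a x y * K (b x) y)
     - (\<Sum>x\<in>\<Lambda>. \<Sum>y\<in>\<Lambda>. s x * kg x y * K (b x) y)"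
proof -
  have z: "(\<Sum>x\<in>\<Lambda>. \<Sum>y\<in>\<Lambda>. \<sigma> * s 0 * a x 0 * K (b x) y) = 0"
  proof (rule sum.neutral, rule)
    fix x
    have "(\<Sum>y\<in>\<Lambda>. \<sigma> * s 0 * a x 0 * K (b x) y) = s 0 * a x 0 * (\<sigma> * (\<Sum>y\<in>\<Lambda>. K (b x) y))"
      by (simp add: sum_distrib_left mult_ac)
    thus "(\<Sum>y\<in>\<Lambda>. \<sigma> * s 0 * a x 0 * K (b x) y) = 0" by (simp only: sigma_sum_kop mult_zero_right)
  qed
  have "(l + \<gamma>) * (\<Sum>x\<in>\<Lambda>. \<Sum>y\<in>\<Lambda>. b x y * K (b x) y) = (\<Sum>x\<in>\<Lambda>. \<Sum>y\<in>\<Lambda>. (l * b x y + \<gamma> * b x y) * K (b x) y)"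
    by (simp add: sum_distrib_left algebra_simps sum.distrib)
  also have "\<dots> = (\<Sum>x\<in>\<Lambda>. \<Sum>y\<in>\<Lambda>. c x y * K (b x) y + s y * a x y * K (b x) y
     - \<sigma> * s 0 * a x 0 * K (b x) y - s x * kg x y * K (b x) y)"
    by (intro sum.cong refl) (simp add: eq_b kg_def algebra_simps)
  also have "\<dots> = (\<Sum>x\<in>\<Lambda>. \<Sum>y\<in>\<Lambda>. c x y * K (b x) y) + (\<Sum>x\<in>\<Lambda>. \<Sum>y\<in>\<Lambda>. s y * a x y * K (b x) y)
     - (\<Sum>x\<in>\<Lambda>. \<Sum>y\<in>\<Lambda>. \<sigma> * s 0 * a x 0 * K (b x) y) - (\<Sum>x\<in>\<Lambda>. \<Sum>y\<in>\<Lambda>. s x * kg x y * K (b x) y)"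
    by (simp only: sum.distrib sum_subtractf)
  finally show ?thesis unfolding z by simp
qed

text \<open>The weight is \<open>g\<close> with \<open>K\<close> applied in both variables; moving
  one \<open>K\<close> onto \<open>b\<close> by symmetry produces twice the remaining cross term of
  \<open>energy_b\<close>.\<close>

lemma energy_g:
  "l * (\<Sum>x\<in>\<Lambda>. \<Sum>y\<in>\<Lambda>. g x y * kkg x y) = 2 * (\<Sum>x\<in>\<Lambda>. \<Sum>y\<in>\<Lambda>. s x * kg x y * K (b x) y)"
proof -
  have z: "(\<Sum>x\<in>\<Lambda>. \<Sum>y\<in>\<Lambda>. \<sigma> * s 0 * b 0 x * kkg x y) = 0"
  proof (rule sum.neutral, rule)
    fix x
    have "(\<Sum>y\<in>\<Lambda>. \<sigma> * s 0 * b 0 x * kkg x y) = s 0 * b 0 x * (\<sigma> * (\<Sum>y\<in>\<Lambda>. K (kg x) y))"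
      by (simp add: sum_distrib_left mult_ac kkg_def)
    thus "(\<Sum>y\<in>\<Lambda>. \<sigma> * s 0 * b 0 x * kkg x y) = 0" by (simp only: sigma_sum_kop mult_zero_right)
  qed
  have swap: "(\<Sum>x\<in>\<Lambda>. \<Sum>y\<in>\<Lambda>. f y x * kkg x y) = (\<Sum>x\<in>\<Lambda>. \<Sum>y\<in>\<Lambda>. f x y * kkg x y)" for f
  proof -
    have "(\<Sum>x\<in>\<Lambda>. \<Sum>y\<in>\<Lambda>. f y x * kkg x y) = (\<Sum>y\<in>\<Lambda>. \<Sum>x\<in>\<Lambda>. f y x * kkg x y)"
      by (rule sum.swap)
    also have "\<dots> = (\<Sum>y\<in>\<Lambda>. \<Sum>x\<in>\<Lambda>. f y x * kkg y x)"
      by (intro sum.cong refl arg_cong2[of _ _ _ _ "(*)"] kkg_sym)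
    finally show ?thesis .
  qed
  have z': "(\<Sum>x\<in>\<Lambda>. \<Sum>y\<in>\<Lambda>. \<sigma> * s 0 * b 0 y * kkg x y) = 0"
    using swap[of "\<lambda>x y. \<sigma> * s 0 * b 0 x"] z by simp
  have s: "(\<Sum>x\<in>\<Lambda>. \<Sum>y\<in>\<Lambda>. s y * b y x * kkg x y) = (\<Sum>x\<in>\<Lambda>. \<Sum>y\<in>\<Lambda>. s x * b x y * kkg x y)"
    by (rule swap)
  have t: "(\<Sum>x\<in>\<Lambda>. \<Sum>y\<in>\<Lambda>. s x * b x y * kkg x y) = (\<Sum>x\<in>\<Lambda>. \<Sum>y\<in>\<Lambda>. s x * kg x y * K (b x) y)"
  proof (rule sum.cong[OF refl])
    fix x
    have "(\<Sum>y\<in>\<Lambda>. b x y * K (kg x) y) = (\<Sum>y\<in>\<Lambda>. K (b x) y * kg x y)"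
      by (rule kop_symmetric[OF N1])
    hence "s x * (\<Sum>y\<in>\<Lambda>. b x y * K (kg x) y) = s x * (\<Sum>y\<in>\<Lambda>. K (b x) y * kg x y)" by simp
    thus "(\<Sum>y\<in>\<Lambda>. s x * b x y * kkg x y) = (\<Sum>y\<in>\<Lambda>. s x * kg x y * K (b x) y)"
      by (simp add: sum_distrib_left kkg_def mult_ac)
  qed
  have "l * (\<Sum>x\<in>\<Lambda>. \<Sum>y\<in>\<Lambda>. g x y * kkg x y) = (\<Sum>x\<in>\<Lambda>. \<Sum>y\<in>\<Lambda>. (l * g x y) * kkg x y)"
    by (simp add: sum_distrib_left mult_ac)
  also have "\<dots> = (\<Sum>x\<in>\<Lambda>. \<Sum>y\<in>\<Lambda>. s x * b x y * kkg x y - \<sigma> * s 0 * b 0 y * kkg x y +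
       s y * b y x * kkg x y - \<sigma> * s 0 * b 0 x * kkg x y)"
    by (intro sum.cong refl) (simp add: eq_g algebra_simps)
  also have "\<dots> = (\<Sum>x\<in>\<Lambda>. \<Sum>y\<in>\<Lambda>. s x * b x y * kkg x y) - (\<Sum>x\<in>\<Lambda>. \<Sum>y\<in>\<Lambda>. \<sigma> * s 0 * b 0 y * kkg x y) +
       (\<Sum>x\<in>\<Lambda>. \<Sum>y\<in>\<Lambda>. s y * b y x * kkg x y) - (\<Sum>x\<in>\<Lambda>. \<Sum>y\<in>\<Lambda>. \<sigma> * s 0 * b 0 x * kkg x y)"
    by (simp only: sum.distrib sum_subtractf)
  finally show ?thesis unfolding z z' s t by simp
qed

definition "jump k x = b x (tadd N x (evec k)) - b x (tadd N x (- evec k))"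

text \<open>The jump is the sum of the increments of \<open>b x\<close> over the two bonds at
  \<open>x\<close> in direction \<open>k\<close>. The factor \<open>1/2\<close> comes from
  \<open>(u + v)^2 \<le> 2 (u^2 + v^2)\<close>.\<close>

lemma jump_le: "\<omega> / 2 * (\<Sum>x\<in>\<Lambda>. (jump k x)\<^sup>2) \<le> (\<Sum>x\<in>\<Lambda>. \<Sum>y\<in>\<Lambda>. b x y * K (b x) y)"
  unfolding sum_distrib_left
proof (rule sum_mono)
  fix x :: "'d site" assume x: "x \<in> \<Lambda>"
  let ?e = "\<lambda>y. b x (tadd N y (evec k)) - b x y"
  let ?x = "tadd N x (- evec k)"
  have ne: "x \<noteq> ?x" using tadd_evec_neq[OF N2 x] by metis
  have "jump k x = ?e x + ?e ?x"
    by (simp add: jump_def tadd_inverse x)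
  hence "(jump k x)\<^sup>2 \<le> 2 * ((?e x)\<^sup>2 + (?e ?x)\<^sup>2)"
    using sum_squares_bound[of "?e x" "?e ?x"] by (simp add: power2_sum)
  also have "(?e x)\<^sup>2 + (?e ?x)\<^sup>2 = (\<Sum>y\<in>{x, ?x}. (?e y)\<^sup>2)"
    using ne by simp
  also have "\<dots> \<le> (\<Sum>y\<in>\<Lambda>. (?e y)\<^sup>2)"
    using x tadd_in_torus[OF N1] by (intro sum_mono2) auto
  also have "\<dots> \<le> (\<Sum>y\<in>\<Lambda>. \<Sum>j\<in>UNIV. (b x (tadd N y (evec j)) - b x y) * (b x (tadd N y (evec j)) - b x y))"
  proof (rule sum_mono)
    fix y
    show "(?e y)\<^sup>2 \<le> (\<Sum>j\<in>UNIV. (b x (tadd N y (evec j)) - b x y) * (b x (tadd N y (evec j)) - b x y))"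
      unfolding power2_eq_square by (rule member_le_sum) auto
  qed
  finally have "\<omega> / 2 * (jump k x)\<^sup>2 \<le> \<omega> * (\<Sum>y\<in>\<Lambda>. \<Sum>j\<in>UNIV. (b x (tadd N y (evec j)) - b x y) * (b x (tadd N y (evec j)) - b x y))"
    using pos by simp
  also have "\<dots> \<le> (\<Sum>y\<in>\<Lambda>. b x y * K (b x) y)"
    unfolding kop_dirichlet[OF N1] using pos(2) by (simp add: sum_nonneg)
  finally show "\<omega> / 2 * (jump k x)\<^sup>2 \<le> (\<Sum>y\<in>\<Lambda>. b x y * K (b x) y)" .
qed

text \<open>In half of \<open>energy_a\<close> plus \<open>energy_b\<close> plus half of
  \<open>energy_g\<close> the terms carrying \<open>l\<close> are nonnegative and are dropped, so
  the bound is uniform in \<open>l\<close>. The surviving left-hand side is dissipation by the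
  noise.\<close>

lemma energy_bound:
  "\<gamma> * (\<Sum>x\<in>\<Lambda>. (a x (tadd N x (evec k)))\<^sup>2) + \<gamma> * \<omega> / 2 * (\<Sum>x\<in>\<Lambda>. (jump k x)\<^sup>2) \<le>
    (\<Sum>x\<in>\<Lambda>. \<Sum>y\<in>\<Lambda>. c x y * K (b x) y)"
proof -
  let ?A = "\<Sum>x\<in>\<Lambda>. \<Sum>y\<in>\<Lambda>. (a x y)\<^sup>2" and ?NA = "\<Sum>x\<in>\<Lambda>. \<Sum>y\<in>\<Lambda>. a x y * noise N a x y"
  let ?B = "\<Sum>x\<in>\<Lambda>. \<Sum>y\<in>\<Lambda>. b x y * K (b x) y" and ?G = "\<Sum>x\<in>\<Lambda>. \<Sum>y\<in>\<Lambda>. g x y * kkg x y"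
  have G: "l * ?G \<ge> 0"
    using kop_kop_nonneg[OF N1, of \<omega> \<nu> g] pos unfolding kkg_def kg_def by simp
  have A: "l * ?A \<ge> 0" using pos by (simp add: sum_nonneg)
  have B: "?B \<ge> \<omega> / 2 * (\<Sum>x\<in>\<Lambda>. (jump k x)\<^sup>2)" by (rule jump_le)
  hence "?B \<ge> 0" using pos by (smt (verit) divide_nonneg_nonneg mult_nonneg_nonneg sum_nonneg zero_le_power2)
  hence B': "(l + \<gamma>) * ?B \<ge> \<gamma> * (\<omega> / 2 * (\<Sum>x\<in>\<Lambda>. (jump k x)\<^sup>2))"
    using B pos by (intro mult_mono) (auto intro!: mult_nonneg_nonneg sum_nonneg)
  have NA: "\<gamma> * ?NA \<le> \<gamma> * (- 2 * (\<Sum>x\<in>\<Lambda>. (a x (tadd N x (evec k)))\<^sup>2))"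
    using noise_dissipative[OF N2, of a k] pos by (intro mult_left_mono) auto
  from energy_a energy_b energy_g G A B' NA show ?thesis by (simp add: algebra_simps)
qed

text \<open>Equation \<open>eq_b\<close> is taken at both neighbours of \<open>x\<close>, subtracted
  and weighted with \<open>r x\<close>. The terms of the reference site agree at the two neighbours
  and cancel; the weight removes \<open>s x\<close> in front of \<open>kg\<close>, whose sum then
  vanishes. The coefficient of the entries of \<open>a\<close> is zero for equal masses, so it
  measures the disorder across a bond.\<close>

lemma jump_identity:
  assumes sm: "\<And>x. x \<in> \<Lambda> \<Longrightarrow> s x * r x = 1"
  shows "(\<Sum>x\<in>\<Lambda>. r x * (c x (tadd N x (evec k)) - c x (tadd N x (- evec k)))) =
    (l + \<gamma>) * (\<Sum>x\<in>\<Lambda>. r x * jump k x)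
    - (\<Sum>x\<in>\<Lambda>. a x (tadd N x (evec k)) * (r x * s (tadd N x (evec k)) - r (tadd N x (evec k)) * s x))"
proof -
  let ?p = "\<lambda>x. tadd N x (evec k)" and ?m = "\<lambda>x. tadd N x (- evec k)"
  have shift: "(\<Sum>x\<in>\<Lambda>. f x (?m x)) = (\<Sum>x\<in>\<Lambda>. f (?p x) x)" for f :: "'d site \<Rightarrow> 'd site \<Rightarrow> real"
  proof -
    have "(\<Sum>x\<in>\<Lambda>. f x (?m x)) = (\<Sum>x\<in>\<Lambda>. f (?p x) (?m (?p x)))"
      using sum_tadd[OF N1, of "\<lambda>x. f x (?m x)" "evec k"] by simp
    also have "\<dots> = (\<Sum>x\<in>\<Lambda>. f (?p x) x)" by (intro sum.cong refl) (simp add: tadd_inverse)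
    finally show ?thesis .
  qed
  have G: "(\<Sum>x\<in>\<Lambda>. kg x (?p x) - kg x (?m x)) = 0"
  proof -
    \<comment> \<open>A translation followed by the symmetry of \<open>g\<close> reverses
      \<open>v\<close>. It therefore exchanges the contributions of \<open>evec j\<close> and
      \<open>- evec j\<close> in the expansions of the two sums of \<open>kg\<close>.\<close>
    have sw: "(\<Sum>x\<in>\<Lambda>. g (tadd N (?p x) v) x) = (\<Sum>x\<in>\<Lambda>. g (tadd N x (- v)) (?p x))" for v
    proof -
      have "(\<Sum>x\<in>\<Lambda>. g (tadd N x (- v)) (?p x)) = (\<Sum>x\<in>\<Lambda>. g (tadd N (tadd N x v) (- v)) (?p (tadd N x v)))"
        using sum_tadd[OF N1, of "\<lambda>x. g (tadd N x (- v)) (?p x)" v] by simp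
      also have "\<dots> = (\<Sum>x\<in>\<Lambda>. g (tadd N (?p x) v) x)"
        by (intro sum.cong refl) (metis tadd_inverse(1) tadd_commute sym(2))
      finally show ?thesis by simp
    qed
    have kg: "(\<Sum>x\<in>\<Lambda>. kg (f x) (h x)) = \<nu> * (\<Sum>x\<in>\<Lambda>. g (f x) (h x)) - \<omega> * (\<Sum>j\<in>UNIV.
       (\<Sum>x\<in>\<Lambda>. g (tadd N (f x) (evec j)) (h x)) + (\<Sum>x\<in>\<Lambda>. g (tadd N (f x) (- evec j)) (h x)) - 2 * (\<Sum>x\<in>\<Lambda>. g (f x) (h x)))"
      for f h
    proof -
      have "(\<Sum>x\<in>\<Lambda>. kg (f x) (h x)) = \<nu> * (\<Sum>x\<in>\<Lambda>. g (f x) (h x)) - \<omega> * (\<Sum>x\<in>\<Lambda>. \<Sum>j\<in>UNIV.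
         g (tadd N (f x) (evec j)) (h x) + g (tadd N (f x) (- evec j)) (h x) - 2 * g (f x) (h x))"
        unfolding kg_def kop_def by (subst sum_subtractf) (simp only: sum_distrib_left[symmetric])
      also have "(\<Sum>x\<in>\<Lambda>. \<Sum>j\<in>UNIV.
         g (tadd N (f x) (evec j)) (h x) + g (tadd N (f x) (- evec j)) (h x) - 2 * g (f x) (h x)) =
         (\<Sum>j\<in>UNIV. \<Sum>x\<in>\<Lambda>.
         g (tadd N (f x) (evec j)) (h x) + g (tadd N (f x) (- evec j)) (h x) - 2 * g (f x) (h x))"
        by (rule sum.swap)
      finally show ?thesis by (simp only: sum.distrib sum_subtractf sum_distrib_left)
    qed
    note kg[of "\<lambda>x. x" ?p]
    moreover note kg[of ?p "\<lambda>x. x"]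
    moreover have "(\<Sum>x\<in>\<Lambda>. g (?p x) x) = (\<Sum>x\<in>\<Lambda>. g x (?p x))" by (intro sum.cong refl sym(2))
    ultimately have "(\<Sum>x\<in>\<Lambda>. kg (?p x) x) = (\<Sum>x\<in>\<Lambda>. kg x (?p x))"
      by (simp only: sw) (simp only: minus_minus add.commute)
    thus ?thesis unfolding sum_subtractf shift[of kg] by simp
  qed
  have A: "(\<Sum>x\<in>\<Lambda>. r x * (s (?p x) * a x (?p x) - s (?m x) * a x (?m x))) =
     (\<Sum>x\<in>\<Lambda>. a x (?p x) * (r x * s (?p x) - r (?p x) * s x))"
  proof -
    have "(\<Sum>x\<in>\<Lambda>. r x * (s (?p x) * a x (?p x) - s (?m x) * a x (?m x))) =
       (\<Sum>x\<in>\<Lambda>. r x * s (?p x) * a x (?p x)) - (\<Sum>x\<in>\<Lambda>. r x * s (?m x) * a x (?m x))"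
      by (simp add: sum_subtractf algebra_simps)
    also have "(\<Sum>x\<in>\<Lambda>. r x * s (?m x) * a x (?m x)) = (\<Sum>x\<in>\<Lambda>. r (?p x) * s x * a (?p x) x)"
      by (rule shift)
    also have "\<dots> = (\<Sum>x\<in>\<Lambda>. r (?p x) * s x * a x (?p x))"
      by (intro sum.cong refl arg_cong2[of _ _ _ _ "(*)"] sym(1))
    finally show ?thesis by (simp add: sum_subtractf algebra_simps)
  qed
  have "(\<Sum>x\<in>\<Lambda>. r x * (c x (?p x) - c x (?m x))) = (\<Sum>x\<in>\<Lambda>. (l + \<gamma>) * (r x * jump k x)
     - r x * (s (?p x) * a x (?p x) - s (?m x) * a x (?m x)) + (kg x (?p x) - kg x (?m x)))"
  proof (intro sum.cong refl)
    fix x assume x: "x \<in> \<Lambda>"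
    have 1: "c x y = (l + \<gamma>) * b x y - s y * a x y + \<sigma> * s 0 * a x 0 + s x * kg x y" if "y \<in> \<Lambda>" for y
      using eq_b[OF x that] by (simp add: kg_def algebra_simps)
    have 2: "r x * (s x * t) = t" for t
      using sm[OF x] by (simp add: mult.assoc[symmetric] mult.commute[of "r x"])
    have "c x (?p x) - c x (?m x) = (l + \<gamma>) * jump k x - (s (?p x) * a x (?p x) - s (?m x) * a x (?m x)) +
       s x * (kg x (?p x) - kg x (?m x))"
      unfolding 1[OF tadd_in_torus[OF N1]] jump_def by (simp add: algebra_simps)
    thus "r x * (c x (?p x) - c x (?m x)) = (l + \<gamma>) * (r x * jump k x)
     - r x * (s (?p x) * a x (?p x) - s (?m x) * a x (?m x)) + (kg x (?p x) - kg x (?m x))"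
      by (simp only: ring_distribs 2) (simp add: algebra_simps)
  qed
  also have "\<dots> = (l + \<gamma>) * (\<Sum>x\<in>\<Lambda>. r x * jump k x) -
     (\<Sum>x\<in>\<Lambda>. r x * (s (?p x) * a x (?p x) - s (?m x) * a x (?m x))) + (\<Sum>x\<in>\<Lambda>. kg x (?p x) - kg x (?m x))"
    by (simp only: sum.distrib sum_subtractf sum_distrib_left)
  finally show ?thesis unfolding G A by simp
qed

text \<open>In the application \<open>J\<close> is the transformed autocorrelation of the total
  current and the parameter \<open>T\<close> is the squared temperature times the dimension. The
  dissipation, that is \<open>P\<close> and \<open>Q\<close>, is at most a multiple of
  \<open>T * J\<close>. Conversely Cauchy-Schwarz bounds \<open>J^2\<close> (upper bound) and
  \<open>n^2\<close> (lower bound) by \<open>n\<close> times the dissipation, and one factor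
  \<open>J\<close>, respectively \<open>n\<close>, is divided out.\<close>

lemma current_bounds:
  fixes m :: "'d site \<Rightarrow> real" and k :: 'd and T m_lo m_hi :: real
  defines "J \<equiv> \<omega> * (\<Sum>x\<in>\<Lambda>. s x * jump k x)" and "n \<equiv> real (card \<Lambda>)" and "d \<equiv> real CARD('d)"
  assumes m: "0 < m_lo" "\<And>x. x \<in> \<Lambda> \<Longrightarrow> m_lo \<le> m x \<and> m x \<le> m_hi"
    and s: "\<And>x. s x = 1 / sqrt (m x)" and T: "T > 0" and \<kappa>: "\<kappa> > 0" and l: "l \<le> 1"
    and cK: "\<And>x y. x \<in> \<Lambda> \<Longrightarrow> y \<in> \<Lambda> \<Longrightarrow> K (c x) y =
      \<omega> * T * s x * (of_bool (y = tadd N x (evec k)) - of_bool (y = tadd N x (- evec k)))"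
    and c_ge: "\<And>x. x \<in> \<Lambda> \<Longrightarrow> c x (tadd N x (evec k)) - c x (tadd N x (- evec k)) \<ge> s x * \<kappa>"
  shows "J \<le> 2 * \<omega> * T / (\<gamma> * m_lo) * n"
    and "J \<ge> \<kappa>\<^sup>2 / (T * (4 * (1 + \<gamma>)\<^sup>2 * m_hi / (\<gamma> * \<omega>) + 2 * (m_hi / m_lo) / \<gamma>)) * n"
proof -
  let ?p = "\<lambda>x. tadd N x (evec k)" and ?m = "\<lambda>x. tadd N x (- evec k)"
  let ?r = "\<lambda>x. sqrt (m x)"
  define P where "P = (\<Sum>x\<in>\<Lambda>. (jump k x)\<^sup>2)"
  define Q where "Q = (\<Sum>x\<in>\<Lambda>. (a x (?p x))\<^sup>2)"
  have PQ: "P \<ge> 0" "Q \<ge> 0" by (auto simp: P_def Q_def sum_nonneg)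
  have mpos: "m x > 0" if "x \<in> \<Lambda>" for x using m(1) m(2)[OF that] by linarith
  have card: "card \<Lambda> > 0"
    using zero_in_torus[OF N1] by (auto simp: card_gt_0_iff)
  hence n: "n > 0" by (simp add: n_def)
  have mhi: "m_lo \<le> m_hi" using m(2)[OF zero_in_torus[OF N1]] by linarith
  \<comment> \<open>By symmetry \<open>K\<close> moves onto the source, where by \<open>cK\<close>
    it leaves a dipole at the two neighbours of \<open>x\<close>. Hence the right-hand side of
    \<open>energy_bound\<close> is \<open>T * J\<close>.\<close>
  have inner: "(\<Sum>y\<in>\<Lambda>. c x y * K (b x) y) = \<omega> * T * (s x * jump k x)" if x: "x \<in> \<Lambda>" for x
  proof -
    have "(\<Sum>y\<in>\<Lambda>. c x y * K (b x) y) = (\<Sum>y\<in>\<Lambda>. K (c x) y * b x y)" by (rule kop_symmetric[OF N1])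
    also have "\<dots> = (\<Sum>y\<in>\<Lambda>. (if y = ?p x then \<omega> * T * s x * b x y else 0) - (if y = ?m x then \<omega> * T * s x * b x y else 0))"
      using x by (intro sum.cong refl) (auto simp: cK algebra_simps)
    also have "\<dots> = \<omega> * T * (s x * jump k x)"
      by (simp add: tadd_in_torus[OF N1] sum_subtractf jump_def algebra_simps)
    finally show ?thesis .
  qed
  have "(\<Sum>x\<in>\<Lambda>. \<Sum>y\<in>\<Lambda>. c x y * K (b x) y) = T * J"
    by (simp add: J_def inner sum_distrib_left mult_ac)
  with energy_bound[of k] have E: "\<gamma> * Q + \<gamma> * \<omega> / 2 * P \<le> T * J"
    by (simp add: P_def Q_def)
  have PJ: "P \<le> 2 * T * J / (\<gamma> * \<omega>)"
  proof -
    have "\<gamma> * \<omega> / 2 * P \<le> T * J" using E PQ pos by (smt (verit) mult_nonneg_nonneg)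
    thus ?thesis using pos by (simp add: field_simps)
  qed
  have QJ: "Q \<le> T * J / \<gamma>"
  proof -
    have "\<gamma> * \<omega> / 2 * P \<ge> 0" using PQ pos by simp
    hence "\<gamma> * Q \<le> T * J" using E by linarith
    thus ?thesis using pos by (simp add: field_simps)
  qed
  have J0: "J \<ge> 0"
  proof -
    have "\<gamma> * \<omega> / 2 * P \<ge> 0" "\<gamma> * Q \<ge> 0" using PQ pos by simp_all
    hence "T * J \<ge> 0" using E by linarith
    thus ?thesis using T by (simp add: zero_le_mult_iff)
  qed
  have s2: "(\<Sum>x\<in>\<Lambda>. (s x)\<^sup>2) \<le> n / m_lo"
  proof -
    have "(s x)\<^sup>2 \<le> 1 / m_lo" if "x \<in> \<Lambda>" for x
      using m(1) m(2)[OF that] mpos[OF that] by (simp add: s power_divide frac_le)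
    hence "(\<Sum>x\<in>\<Lambda>. (s x)\<^sup>2) \<le> (\<Sum>x\<in>\<Lambda>. 1 / m_lo)" by (rule sum_mono)
    thus ?thesis by (simp add: n_def)
  qed
  have "(\<Sum>x\<in>\<Lambda>. s x * jump k x)\<^sup>2 \<le> (\<Sum>x\<in>\<Lambda>. (s x)\<^sup>2) * P"
    unfolding P_def by (rule Cauchy_Schwarz_ineq_sum)
  also have "\<dots> \<le> n / m_lo * (2 * T * J / (\<gamma> * \<omega>))"
    using s2 PJ PQ n m(1) by (intro mult_mono) auto
  finally have "J\<^sup>2 \<le> \<omega>\<^sup>2 * (n / m_lo * (2 * T * J / (\<gamma> * \<omega>)))"
    unfolding J_def power_mult_distrib by (intro mult_left_mono) auto
  also have "\<dots> = (2 * \<omega> * T / (\<gamma> * m_lo) * n) * J"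
    using pos m(1) by (simp add: field_simps power2_eq_square)
  finally have *: "J * J \<le> (2 * \<omega> * T / (\<gamma> * m_lo) * n) * J" by (simp add: power2_eq_square)
  thus "J \<le> 2 * \<omega> * T / (\<gamma> * m_lo) * n"
  proof (cases "J = 0")
    case True thus ?thesis using pos T m(1) n by simp
  next
    case False
    with J0 have "J > 0" by simp
    with * show ?thesis by (simp only: mult_le_cancel_right_pos)
  qed
  define u where "u x = ?r x * s (?p x) - ?r (?p x) * s x" for x
  have u: "(u x)\<^sup>2 \<le> m_hi / m_lo" if x: "x \<in> \<Lambda>" for x
  proof -
    \<comment> \<open>Both products in \<open>u\<close> lie between 0 and
      \<open>sqrt (m_hi / m_lo)\<close>, hence so does the absolute value of their
      difference.\<close>
    have *: "0 \<le> ?r x * s y" "?r x * s y \<le> sqrt (m_hi / m_lo)" if "x \<in> \<Lambda>" "y \<in> \<Lambda>" for x y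
    proof -
      show "0 \<le> ?r x * s y" using mpos[OF that(1)] mpos[OF that(2)] by (simp add: s)
      have "m x / m y \<le> m_hi / m_lo"
        using m(1) m(2)[OF that(1)] m(2)[OF that(2)] mpos[OF that(1)] by (intro frac_le) auto
      thus "?r x * s y \<le> sqrt (m_hi / m_lo)" by (simp add: s real_sqrt_divide[symmetric])
    qed
    have "\<bar>u x\<bar> \<le> sqrt (m_hi / m_lo)"
      using *[OF x tadd_in_torus[OF N1], of x "evec k"] *[OF tadd_in_torus[OF N1] x, of x "evec k"]
      unfolding u_def by linarith
    hence "\<bar>u x\<bar>\<^sup>2 \<le> (sqrt (m_hi / m_lo))\<^sup>2" by (intro power_mono) auto
    thus ?thesis using m(1) mhi by simp
  qed
  \<comment> \<open>The weights \<open>sqrt (m x)\<close> cancel the factor \<open>s x\<close> in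
    \<open>c_ge\<close>, so that the source is of the order of the volume.\<close>
  have "n * \<kappa> = (\<Sum>x\<in>\<Lambda>. ?r x * (s x * \<kappa>))"
  proof -
    have "?r x * (s x * \<kappa>) = \<kappa>" if "x \<in> \<Lambda>" for x using mpos[OF that] by (simp add: s)
    hence "(\<Sum>x\<in>\<Lambda>. ?r x * (s x * \<kappa>)) = (\<Sum>x\<in>\<Lambda>. \<kappa>)" by (rule sum.cong[OF refl])
    thus ?thesis by (simp add: n_def)
  qed
  also have "\<dots> \<le> (\<Sum>x\<in>\<Lambda>. ?r x * (c x (?p x) - c x (?m x)))"
    using c_ge mpos by (intro sum_mono mult_left_mono) (auto intro: less_imp_le)
  also have "\<dots> = (l + \<gamma>) * (\<Sum>x\<in>\<Lambda>. ?r x * jump k x) - (\<Sum>x\<in>\<Lambda>. a x (?p x) * u x)"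
    unfolding u_def
  proof (rule jump_identity)
    fix x assume "x \<in> \<Lambda>" thus "s x * ?r x = 1" using mpos[of x] by (simp add: s)
  qed
  finally have "(n * \<kappa>)\<^sup>2 \<le> ((l + \<gamma>) * (\<Sum>x\<in>\<Lambda>. ?r x * jump k x) - (\<Sum>x\<in>\<Lambda>. a x (?p x) * u x))\<^sup>2"
    using n \<kappa> by (intro power_mono) auto
  also have "\<dots> \<le> 2 * (((l + \<gamma>) * (\<Sum>x\<in>\<Lambda>. ?r x * jump k x))\<^sup>2 + (\<Sum>x\<in>\<Lambda>. a x (?p x) * u x)\<^sup>2)"
    using sum_squares_bound[of "(l + \<gamma>) * (\<Sum>x\<in>\<Lambda>. ?r x * jump k x)" "- (\<Sum>x\<in>\<Lambda>. a x (?p x) * u x)"]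
    by (simp add: power2_diff)
  also have "((l + \<gamma>) * (\<Sum>x\<in>\<Lambda>. ?r x * jump k x))\<^sup>2 \<le> (1 + \<gamma>)\<^sup>2 * (m_hi * n * P)"
    unfolding power_mult_distrib
  proof (intro mult_mono power_mono)
    have "(\<Sum>x\<in>\<Lambda>. ?r x * jump k x)\<^sup>2 \<le> (\<Sum>x\<in>\<Lambda>. (?r x)\<^sup>2) * P"
      unfolding P_def by (rule Cauchy_Schwarz_ineq_sum)
    also have "(\<Sum>x\<in>\<Lambda>. (?r x)\<^sup>2) \<le> (\<Sum>x\<in>\<Lambda>. m_hi)"
      using m(2) mpos by (intro sum_mono) (auto simp: less_imp_le)
    hence "(\<Sum>x\<in>\<Lambda>. (?r x)\<^sup>2) * P \<le> m_hi * n * P"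
      using PQ by (intro mult_right_mono) (auto simp: n_def mult.commute)
    finally show "(\<Sum>x\<in>\<Lambda>. ?r x * jump k x)\<^sup>2 \<le> m_hi * n * P" .
  qed (use l pos in auto)
  also have "(\<Sum>x\<in>\<Lambda>. a x (?p x) * u x)\<^sup>2 \<le> Q * (m_hi / m_lo * n)"
  proof -
    have "(\<Sum>x\<in>\<Lambda>. a x (?p x) * u x)\<^sup>2 \<le> Q * (\<Sum>x\<in>\<Lambda>. (u x)\<^sup>2)"
      unfolding Q_def by (rule Cauchy_Schwarz_ineq_sum)
    also have "(\<Sum>x\<in>\<Lambda>. (u x)\<^sup>2) \<le> (\<Sum>x\<in>\<Lambda>. m_hi / m_lo)" by (intro sum_mono u)
    hence "Q * (\<Sum>x\<in>\<Lambda>. (u x)\<^sup>2) \<le> Q * (m_hi / m_lo * n)"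
      using PQ by (intro mult_left_mono) (auto simp: n_def mult.commute)
    finally show ?thesis .
  qed
  finally have "n * (n * \<kappa>\<^sup>2) \<le> n * (2 * (1 + \<gamma>)\<^sup>2 * m_hi * P + 2 * (m_hi / m_lo) * Q)"
    by (simp add: algebra_simps power2_eq_square)
  hence "n * \<kappa>\<^sup>2 \<le> 2 * (1 + \<gamma>)\<^sup>2 * m_hi * P + 2 * (m_hi / m_lo) * Q"
    using n by (simp only: mult_le_cancel_left_pos)
  also have "\<dots> \<le> 2 * (1 + \<gamma>)\<^sup>2 * m_hi * (2 * T * J / (\<gamma> * \<omega>)) + 2 * (m_hi / m_lo) * (T * J / \<gamma>)"
    using PJ QJ mhi m(1) by (intro add_mono mult_left_mono) auto
  also have "\<dots> = (T * (4 * (1 + \<gamma>)\<^sup>2 * m_hi / (\<gamma> * \<omega>) + 2 * (m_hi / m_lo) / \<gamma>)) * J"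
    using pos m(1) by (simp add: field_simps)
  finally have 1: "n * \<kappa>\<^sup>2 \<le> (T * (4 * (1 + \<gamma>)\<^sup>2 * m_hi / (\<gamma> * \<omega>) + 2 * (m_hi / m_lo) / \<gamma>)) * J" .
  have "T * (4 * (1 + \<gamma>)\<^sup>2 * m_hi / (\<gamma> * \<omega>) + 2 * (m_hi / m_lo) / \<gamma>) > 0"
    using T pos m(1) mhi by (intro mult_pos_pos add_pos_pos divide_pos_pos zero_less_power) auto
  thus "J \<ge> \<kappa>\<^sup>2 / (T * (4 * (1 + \<gamma>)\<^sup>2 * m_hi / (\<gamma> * \<omega>) + 2 * (m_hi / m_lo) / \<gamma>)) * n"
    using 1 by (subst times_divide_eq_left, subst pos_divide_le_eq) (simp_all only: mult.commute[of J] mult.commute[of "\<kappa>\<^sup>2"])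
qed

end


declare split_paired_All [simp del] split_paired_Ex [simp del]

section \<open>Polynomial observables and the generator\<close>

text \<open>For \<open>\<nu> = 0\<close> displacements are measured relative to the site \<open>0\<close>, so that the polynomials below are
  functions on the quotient by translations.\<close>

definition pinned :: "real \<Rightarrow> real" where
  "pinned \<nu> = (if \<nu> = 0 then 1 else 0)"

lemma pinned_mult: "pinned \<nu> * \<nu> = 0"
  by (simp add: pinned_def)

definition mom :: "('d::finite) site \<Rightarrow> 'd \<Rightarrow> 'd conf \<Rightarrow> real" where
  "mom x i z = fst z x $ i"

definition dsp :: "real \<Rightarrow> ('d::finite) site \<Rightarrow> 'd \<Rightarrow> 'd conf \<Rightarrow> real" where
  "dsp \<nu> x i z = snd z x $ i - pinned \<nu> * snd z 0 $ i"

text \<open>An inductive predicate, so that differentiability, continuity, measurability, polynomial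
  growth in the energy and translation invariance all follow by rule induction. The class is closed
  under partial derivatives and under \<open>L\<close>.\<close>

inductive pol :: "nat \<Rightarrow> real \<Rightarrow> (('d::finite) conf \<Rightarrow> real) \<Rightarrow> bool" for N \<nu> where
  pol_const: "pol N \<nu> (\<lambda>_. a)"
| pol_mom: "x \<in> torus N \<Longrightarrow> pol N \<nu> (mom x i)"
| pol_dsp: "x \<in> torus N \<Longrightarrow> pol N \<nu> (dsp \<nu> x i)"
| pol_add: "pol N \<nu> f \<Longrightarrow> pol N \<nu> g \<Longrightarrow> pol N \<nu> (\<lambda>z. f z + g z)"
| pol_mult: "pol N \<nu> f \<Longrightarrow> pol N \<nu> g \<Longrightarrow> pol N \<nu> (\<lambda>z. f z * g z)"

lemma pol_minus: "pol N \<nu> f \<Longrightarrow> pol N \<nu> (\<lambda>z. - f z)"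
  using pol_mult[OF pol_const[of N \<nu> "-1"]] by simp

lemma pol_diff: "pol N \<nu> f \<Longrightarrow> pol N \<nu> g \<Longrightarrow> pol N \<nu> (\<lambda>z. f z - g z)"
  using pol_add[OF _ pol_minus] by simp

lemma pol_divide: "pol N \<nu> f \<Longrightarrow> pol N \<nu> (\<lambda>z. f z / a)"
  using pol_mult[OF _ pol_const[of N \<nu> "inverse a"]] by (simp add: divide_inverse)

lemma pol_sum: "(\<And>i. i \<in> I \<Longrightarrow> pol N \<nu> (f i)) \<Longrightarrow> pol N \<nu> (\<lambda>z. \<Sum>i\<in>I. f i z)"
  by (induction I rule: infinite_finite_induct) (auto intro: pol_const pol_add)

lemma pol_power: "pol N \<nu> f \<Longrightarrow> pol N \<nu> (\<lambda>z. f z ^ n)"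
  by (induction n) (auto intro: pol_const pol_mult)

lemmas pol_intros = pol_const pol_mom pol_dsp pol_add pol_mult pol_minus pol_diff pol_divide pol_sum pol_power

lemma pol_kop:
  assumes "N \<ge> 1" "x \<in> torus N" "\<And>y. y \<in> torus N \<Longrightarrow> pol N \<nu> (f y)"
  shows "pol N \<nu> (\<lambda>z. kop N \<omega> \<nu>' (\<lambda>y. f y z) x)"
  unfolding kop_def by (intro pol_intros assms(2,3) tadd_in_torus assms(1))

section \<open>Partial derivatives of polynomial observables\<close>

text \<open>The derivative is requested at \<open>t = 0\<close> but at every configuration. Since
  nudges compose additively, this yields the derivative along the whole coordinate line, see
  \<open>has_pdD\<close>.\<close>

definition has_pd :: "('d::finite) coord \<Rightarrow> ('d conf \<Rightarrow> real) \<Rightarrow> ('d conf \<Rightarrow> real) \<Rightarrow> bool" where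
  "has_pd c f f' \<longleftrightarrow> (\<forall>z. ((\<lambda>t. f (nudge c t z)) has_real_derivative f' z) (at 0))"

lemma has_pd_imp_pd: "has_pd c f f' \<Longrightarrow> pd c f = f'"
  by (auto simp: has_pd_def pd_def fun_eq_iff intro: DERIV_imp_deriv)

lemma nudge_0 [simp]: "nudge c 0 z = z"
  by (cases c; cases z) auto

lemma nudge_nudge: "nudge c s (nudge c t z) = nudge c (s + t) z"
  by (cases c; cases z) (auto simp: algebra_simps)

lemma has_pdD:
  assumes "has_pd c f f'"
  shows "((\<lambda>t. f (nudge c t z)) has_real_derivative f' (nudge c t z)) (at t)"
proof -
  have "((\<lambda>s. f (nudge c s (nudge c t z))) has_real_derivative f' (nudge c t z)) (at 0)"
    using assms by (auto simp: has_pd_def)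
  hence "((\<lambda>s. f (nudge c (s + t) z)) has_real_derivative f' (nudge c t z)) (at 0)"
    by (simp add: nudge_nudge)
  thus ?thesis using DERIV_shift[of "\<lambda>s. f (nudge c s z)" "f' (nudge c t z)" 0 t] by simp
qed

lemma has_pd_const: "has_pd c (\<lambda>_. a) (\<lambda>_. 0)"
  by (auto simp: has_pd_def)

lemma has_pd_add: "has_pd c f f' \<Longrightarrow> has_pd c g g' \<Longrightarrow> has_pd c (\<lambda>z. f z + g z) (\<lambda>z. f' z + g' z)"
  by (auto simp: has_pd_def intro!: derivative_intros)

lemma has_pd_mult:
  "has_pd c f f' \<Longrightarrow> has_pd c g g' \<Longrightarrow> has_pd c (\<lambda>z. f z * g z) (\<lambda>z. f' z * g z + f z * g' z)"
  unfolding has_pd_def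
proof
  fix z assume "\<forall>z. ((\<lambda>t. f (nudge c t z)) has_real_derivative f' z) (at 0)"
    "\<forall>z. ((\<lambda>t. g (nudge c t z)) has_real_derivative g' z) (at 0)"
  from DERIV_mult[OF spec[OF this(1), of z] spec[OF this(2), of z]]
  show "((\<lambda>t. f (nudge c t z) * g (nudge c t z)) has_real_derivative f' z * g z + f z * g' z) (at 0)"
    by (simp add: mult.commute add.commute)
qed

lemma has_pd_compose:
  assumes "\<And>y. (g has_real_derivative g' y) (at y)" "has_pd c f f'"
  shows "has_pd c (\<lambda>z. g (f z)) (\<lambda>z. g' (f z) * f' z)"
  unfolding has_pd_def
proof
  fix z
  show "((\<lambda>t. g (f (nudge c t z))) has_real_derivative g' (f z) * f' z) (at 0)"
    using DERIV_chain2[of g "g' (f z)" "\<lambda>t. f (nudge c t z)" 0 "f' z" UNIV] assms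
    by (auto simp: has_pd_def)
qed

lemma has_pd_mom:
  "has_pd (Mom y j) (mom x i) (\<lambda>_. of_bool (x = y \<and> i = j))"
  "has_pd (Pos y j) (mom x i) (\<lambda>_. 0)"
proof -
  have "mom x i (nudge (Mom y j) t z) = mom x i z + t * of_bool (x = y \<and> i = j)" for t z
    by (cases z) (auto simp: mom_def axis_def)
  thus "has_pd (Mom y j) (mom x i) (\<lambda>_. of_bool (x = y \<and> i = j))"
    unfolding has_pd_def by (auto intro!: derivative_eq_intros)
  have "mom x i (nudge (Pos y j) t z) = mom x i z" for t z
    by (cases z) (auto simp: mom_def axis_def)
  thus "has_pd (Pos y j) (mom x i) (\<lambda>_. 0)"
    unfolding has_pd_def by auto
qed

lemma has_pd_dsp:
  "has_pd (Pos y j) (dsp \<nu> x i) (\<lambda>_. of_bool (x = y \<and> i = j) - pinned \<nu> * of_bool (0 = y \<and> i = j))"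
  "has_pd (Mom y j) (dsp \<nu> x i) (\<lambda>_. 0)"
proof -
  have "dsp \<nu> x i (nudge (Pos y j) t z) =
      dsp \<nu> x i z + t * (of_bool (x = y \<and> i = j) - pinned \<nu> * of_bool (0 = y \<and> i = j))" for t z
    by (cases z) (auto simp: dsp_def axis_def algebra_simps)
  thus "has_pd (Pos y j) (dsp \<nu> x i) (\<lambda>_. of_bool (x = y \<and> i = j) - pinned \<nu> * of_bool (0 = y \<and> i = j))"
    unfolding has_pd_def by (auto intro!: derivative_eq_intros)
  have "dsp \<nu> x i (nudge (Mom y j) t z) = dsp \<nu> x i z" for t z
    by (cases z) (auto simp: dsp_def axis_def)
  thus "has_pd (Mom y j) (dsp \<nu> x i) (\<lambda>_. 0)"
    unfolding has_pd_def by auto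
qed

lemmas pd_mom = has_pd_mom[THEN has_pd_imp_pd]
lemmas pd_dsp = has_pd_dsp[THEN has_pd_imp_pd]

lemma pol_has_pd:
  assumes "pol N \<nu> f"
  shows "has_pd c f (pd c f) \<and> pol N \<nu> (pd c f)"
proof -
  from assms have "\<exists>f'. has_pd c f f' \<and> pol N \<nu> f'"
  proof induction
    case (pol_const a) show ?case using has_pd_const pol.pol_const by blast
  next
    case (pol_mom x i) show ?case by (cases c) (use has_pd_mom pol.pol_const in blast)+
  next
    case (pol_dsp x i) show ?case by (cases c) (use has_pd_dsp pol.pol_const in blast)+
  next
    case (pol_add f g)
    then obtain f' g' where "has_pd c f f'" "pol N \<nu> f'" "has_pd c g g'" "pol N \<nu> g'" by blast
    with pol_add.hyps show ?case
      by (intro exI[of _ "\<lambda>z. f' z + g' z"] conjI has_pd_add pol_intros)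
  next
    case (pol_mult f g)
    then obtain f' g' where "has_pd c f f'" "pol N \<nu> f'" "has_pd c g g'" "pol N \<nu> g'" by blast
    with pol_mult.hyps show ?case
      by (intro exI[of _ "\<lambda>z. f' z * g z + f z * g' z"] conjI has_pd_mult pol_intros)
  qed
  thus ?thesis using has_pd_imp_pd by metis
qed

lemmas has_pd_pol = pol_has_pd[THEN conjunct1] and pol_pd = pol_has_pd[THEN conjunct2]

definition smooth :: "(('d::finite) conf \<Rightarrow> real) \<Rightarrow> bool" where
  "smooth f \<longleftrightarrow> (\<forall>c. has_pd c f (pd c f))"

lemma smooth_pol: "pol N \<nu> f \<Longrightarrow> smooth f"
  by (auto simp: smooth_def has_pd_pol)

lemma pd_const: "pd c (\<lambda>_. a) = (\<lambda>_. 0)"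
  by (rule has_pd_imp_pd[OF has_pd_const])

lemma pd_add: "smooth f \<Longrightarrow> smooth g \<Longrightarrow> pd c (\<lambda>z. f z + g z) = (\<lambda>z. pd c f z + pd c g z)"
  by (intro has_pd_imp_pd has_pd_add) (auto simp: smooth_def)

lemma pd_mult: "smooth f \<Longrightarrow> smooth g \<Longrightarrow> pd c (\<lambda>z. f z * g z) = (\<lambda>z. pd c f z * g z + f z * pd c g z)"
  by (intro has_pd_imp_pd has_pd_mult) (auto simp: smooth_def)

lemma pd_cmult: "smooth f \<Longrightarrow> pd c (\<lambda>z. a * f z) = (\<lambda>z. a * pd c f z)"
  using pd_mult[OF smooth_pol[OF pol_const[of 0 0 a]], of f c] by (simp add: pd_const)

lemma pd_sum:
  assumes "\<And>i. i \<in> I \<Longrightarrow> pol N \<nu> (f i)"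
  shows "pd c (\<lambda>z. \<Sum>i\<in>I. f i z) = (\<lambda>z. \<Sum>i\<in>I. pd c (f i) z)"
  using assms
proof (induction I rule: infinite_finite_induct)
  case (insert i I)
  thus ?case using pd_add[OF smooth_pol smooth_pol[OF pol_sum[of I]], of N \<nu> "f i" N \<nu> f c] by simp
qed (simp_all add: pd_const)

section \<open>Product rules for the generator and its action on coordinates\<close>

lemma rot_const: "rot i j x y (\<lambda>_. a) = (\<lambda>_. 0)"
  by (simp add: rot_def pd_const fun_eq_iff)

lemma rot_mult:
  assumes "smooth f" "smooth g"
  shows "rot i j x y (\<lambda>z. f z * g z) = (\<lambda>z. rot i j x y f z * g z + f z * rot i j x y g z)"
  by (simp add: rot_def pd_mult[OF assms] fun_eq_iff algebra_simps)

lemma rot_add: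
  assumes "smooth f" "smooth g"
  shows "rot i j x y (\<lambda>z. f z + g z) = (\<lambda>z. rot i j x y f z + rot i j x y g z)"
  by (simp add: rot_def pd_add[OF assms] fun_eq_iff algebra_simps)

lemma pol_rot:
  assumes "x \<in> torus N" "y \<in> torus N" "pol N \<nu> f"
  shows "pol N \<nu> (rot i j x y f)"
proof -
  have "rot i j x y f = (\<lambda>z. mom y j z * pd (Mom x i) f z - mom x i z * pd (Mom y j) f z)"
    by (simp add: rot_def mom_def fun_eq_iff)
  thus ?thesis using assms by (auto intro!: pol_intros pol_pd)
qed

lemma rot_mom:
  "rot i j y w (mom x a) z = of_bool (x = y \<and> a = i) * mom w j z - of_bool (x = w \<and> a = j) * mom y i z"
  by (simp add: rot_def pd_mom mom_def)

lemma rot_dsp: "rot i j y w (dsp \<nu> x a) = (\<lambda>_. 0)"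
  by (simp add: rot_def pd_dsp fun_eq_iff)

lemma gen_A_mult:
  assumes "smooth f" "smooth g"
  shows "gen_A N m \<omega> \<nu> (\<lambda>z. f z * g z) z = gen_A N m \<omega> \<nu> f z * g z + f z * gen_A N m \<omega> \<nu> g z"
  unfolding gen_A_def pd_mult[OF assms] sum_distrib_left sum_distrib_right sum.distrib[symmetric]
  by (intro sum.cong refl) (simp add: algebra_simps)

lemma gen_A_sum:
  assumes "\<And>i. i \<in> I \<Longrightarrow> pol N \<nu> (f i)" "finite I"
  shows "gen_A N m \<omega> \<nu> (\<lambda>z. \<Sum>i\<in>I. f i z) z = (\<Sum>i\<in>I. gen_A N m \<omega> \<nu> (f i) z)"
  using assms(2,1)
proof (induction I rule: finite_induct)
  case empty thus ?case by (simp add: gen_A_def pd_const)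
next
  case (insert i I)
  have "pol N \<nu> (f i)" "pol N \<nu> (\<lambda>z. \<Sum>i\<in>I. f i z)" using insert by (auto intro: pol_sum)
  note * = this[THEN smooth_pol]
  have "gen_A N m \<omega> \<nu> (\<lambda>z. f i z + (\<Sum>i\<in>I. f i z)) z = gen_A N m \<omega> \<nu> (f i) z + gen_A N m \<omega> \<nu> (\<lambda>z. \<Sum>i\<in>I. f i z) z"
    unfolding gen_A_def pd_add[OF *] sum_distrib_left sum.distrib[symmetric]
    by (intro sum.cong refl) (simp add: algebra_simps)
  thus ?case using insert by simp
qed

lemma gen_S_sum:
  assumes N: "N \<ge> 1" and "\<And>i. i \<in> I \<Longrightarrow> pol N \<nu> (f i)" "finite I"
  shows "gen_S N (\<lambda>z. \<Sum>i\<in>I. f i z) z = (\<Sum>i\<in>I. gen_S N (f i) z)"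
  using assms(3,2)
proof (induction I rule: finite_induct)
  case empty thus ?case by (simp add: gen_S_def rot_const)
next
  case (insert i I)
  have p: "pol N \<nu> (f i)" "pol N \<nu> (\<lambda>z. \<Sum>i\<in>I. f i z)" using insert by (auto intro: pol_sum)
  have "gen_S N (\<lambda>z. f i z + (\<Sum>i\<in>I. f i z)) z = gen_S N (f i) z + gen_S N (\<lambda>z. \<Sum>i\<in>I. f i z) z"
    unfolding gen_S_def sum_distrib_left sum.distrib[symmetric] rot_add[OF p[THEN smooth_pol]]
    by (intro sum.cong refl)
      (simp add: algebra_simps rot_add smooth_pol[OF pol_rot[OF _ tadd_in_torus[OF N] p(1)]] smooth_pol[OF pol_rot[OF _ tadd_in_torus[OF N] p(2)]])
  thus ?case using insert by simp
qed

text \<open>Each rotation is a derivation, so its square violates the product rule by twice the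
  product of the first derivatives; the factor 2 turns \<open>1/(2 d^2)\<close> into
  \<open>1/d^2\<close>.\<close>

lemma gen_S_mult:
  fixes f g :: "('d::finite) conf \<Rightarrow> real"
  assumes N: "N \<ge> 1" and p: "pol N \<nu> f" "pol N \<nu> g"
  shows "gen_S N (\<lambda>z. f z * g z) z = gen_S N f z * g z + f z * gen_S N g z +
    1 / (real CARD('d))\<^sup>2 * (\<Sum>i\<in>UNIV. \<Sum>j\<in>UNIV. \<Sum>k\<in>UNIV. \<Sum>x\<in>torus N.
       rot i j x (tadd N x (evec k)) f z * rot i j x (tadd N x (evec k)) g z)"
proof -
  have 1: "rot i j x (tadd N x (evec k)) (rot i j x (tadd N x (evec k)) (\<lambda>z. f z * g z)) z =
    rot i j x (tadd N x (evec k)) (rot i j x (tadd N x (evec k)) f) z * g z +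
    f z * rot i j x (tadd N x (evec k)) (rot i j x (tadd N x (evec k)) g) z +
    2 * (rot i j x (tadd N x (evec k)) f z * rot i j x (tadd N x (evec k)) g z)"
    if x: "x \<in> torus N" for i j k x
  proof -
    let ?R = "rot i j x (tadd N x (evec k))"
    note q = pol_rot[OF x tadd_in_torus[OF N]]
    have "?R (?R (\<lambda>z. f z * g z)) = ?R (\<lambda>z. ?R f z * g z + f z * ?R g z)"
      by (simp add: rot_mult[OF p[THEN smooth_pol]])
    also have "\<dots> = (\<lambda>z. ?R (\<lambda>z. ?R f z * g z) z + ?R (\<lambda>z. f z * ?R g z) z)"
      using p q by (intro rot_add smooth_pol[where N = N and \<nu> = \<nu>] pol_intros)
    also have "?R (\<lambda>z. ?R f z * g z) = (\<lambda>z. ?R (?R f) z * g z + ?R f z * ?R g z)"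
      using p q by (intro rot_mult smooth_pol[where N = N and \<nu> = \<nu>])
    also have "?R (\<lambda>z. f z * ?R g z) = (\<lambda>z. ?R f z * ?R g z + f z * ?R (?R g) z)"
      using p q by (intro rot_mult smooth_pol[where N = N and \<nu> = \<nu>])
    finally show ?thesis by (simp add: fun_eq_iff)
  qed
  show ?thesis
    unfolding gen_S_def
    by (simp only: 1 sum.distrib sum_distrib_left[symmetric] sum_distrib_right[symmetric] cong: sum.cong)
       (simp add: algebra_simps)
qed

lemma sum_of_bool_eq: "finite A \<Longrightarrow> (\<Sum>y\<in>A. of_bool (x = y) * f y) = of_bool (x \<in> A) * (f x :: real)"
proof -
  assume "finite A"
  have "(\<Sum>y\<in>A. of_bool (x = y) * f y) = (\<Sum>y\<in>A. if x = y then f y else 0)"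
    by (intro sum.cong refl) simp
  thus ?thesis using \<open>finite A\<close> by simp
qed

text \<open>Passing to relative displacements subtracts a constant field, and only when
  \<open>\<nu> = 0\<close>, where the operator annihilates constants.\<close>

lemma kop_dsp: "kop N \<omega> \<nu> (\<lambda>y. dsp \<nu> y a z) x = kop N \<omega> \<nu> (\<lambda>y. snd z y $ a) x"
  by (cases "\<nu> = 0") (simp_all add: dsp_def pinned_def kop_diff kop_const)

lemma gen_A_mom:
  assumes "x \<in> torus N"
  shows "gen_A N m \<omega> \<nu> (mom x a) z = - (1 / sqrt (m x)) * kop N \<omega> \<nu> (\<lambda>y. dsp \<nu> y a z) x"
proof -
  let ?F = "\<lambda>y i. (\<omega> *\<^sub>R laplace N (snd z) y - \<nu> *\<^sub>R snd z y) $ i"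
  have F: "?F y i = - kop N \<omega> \<nu> (\<lambda>y. dsp \<nu> y i z) y" for y i
    by (simp add: kop_dsp) (simp add: kop_def laplace_def)
  have "gen_A N m \<omega> \<nu> (mom x a) z = (\<Sum>y\<in>torus N. of_bool (x = y) * (\<Sum>i\<in>UNIV. of_bool (a = i) * (1 / sqrt (m y) * ?F y i)))"
    unfolding gen_A_def sum_distrib_left pd_mom by (intro sum.cong refl) auto
  also have "\<dots> = 1 / sqrt (m x) * ?F x a"
    by (simp only: sum_of_bool_eq[OF finite_torus] sum_of_bool_eq[OF finite]) (simp add: assms)
  finally show ?thesis unfolding F by simp
qed

text \<open>The second term is the velocity of the reference site; it is where the
  \<open>\<sigma>\<close> terms of \<open>moment_equations\<close> come from.\<close>

lemma gen_A_dsp: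
  assumes "x \<in> torus N" "N \<ge> 1"
  shows "gen_A N m \<omega> \<nu> (dsp \<nu> x a) z = 1 / sqrt (m x) * mom x a z - pinned \<nu> * (1 / sqrt (m 0)) * mom 0 a z"
proof -
  have "gen_A N m \<omega> \<nu> (dsp \<nu> x a) z =
     (\<Sum>y\<in>torus N. of_bool (x = y) * (\<Sum>i\<in>UNIV. of_bool (a = i) * (1 / sqrt (m y) * mom y i z))) -
     (\<Sum>y\<in>torus N. of_bool (0 = y) * (\<Sum>i\<in>UNIV. of_bool (a = i) * (pinned \<nu> * (1 / sqrt (m y)) * mom y i z)))"
    unfolding gen_A_def sum_distrib_left pd_dsp mom_def sum_subtractf[symmetric]
    by (intro sum.cong refl) (auto simp: right_diff_distrib diff_divide_distrib)
  thus ?thesis by (simp only: sum_of_bool_eq[OF finite_torus] sum_of_bool_eq[OF finite]) (simp only: assms(1) zero_in_torus[OF assms(2)] UNIV_I of_bool_eq mult_1_left)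
qed

text \<open>The field generates rotations in the plane of two momentum components, so its square is
  minus the identity on these two and zero on all others.\<close>

lemma rot_rot_mom:
  assumes "y \<noteq> w" "y \<in> torus N" "w \<in> torus N"
  shows "rot i j y w (rot i j y w (mom x a)) z = - (of_bool (x = y \<and> a = i) + of_bool (x = w \<and> a = j)) * mom x a z"
proof -
  let ?b = "of_bool (x = y \<and> a = i) :: real" and ?c = "of_bool (x = w \<and> a = j) :: real"
  have 1: "rot i j y w (mom x a) = (\<lambda>z. ?b * mom w j z + (- ?c) * mom y i z)"
    by (simp add: rot_mom fun_eq_iff)
  have p: "pol N 0 (mom w j)" "pol N 0 (mom y i)" using assms by (auto intro: pol_intros)
  have "rot i j y w (rot i j y w (mom x a)) = (\<lambda>z. rot i j y w (\<lambda>z. ?b * mom w j z) z + rot i j y w (\<lambda>z. (- ?c) * mom y i z) z)"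
    unfolding 1 by (intro rot_add smooth_pol[where N = N and \<nu> = 0] pol_intros p)
  also have "rot i j y w (\<lambda>z. ?b * mom w j z) = (\<lambda>z. ?b * rot i j y w (mom w j) z)"
    using rot_mult[OF smooth_pol[OF pol_const] smooth_pol[OF p(1)], of i j y w ?b] by (simp add: rot_const)
  also have "rot i j y w (\<lambda>z. (- ?c) * mom y i z) = (\<lambda>z. (- ?c) * rot i j y w (mom y i) z)"
    using rot_mult[OF smooth_pol[OF pol_const] smooth_pol[OF p(2)], of i j y w "- ?c"] by (simp add: rot_const)
  finally have F: "rot i j y w (rot i j y w (mom x a)) = (\<lambda>z. ?b * rot i j y w (mom w j) z + (- ?c) * rot i j y w (mom y i) z)" .
  show ?thesis unfolding F using assms(1) by (auto simp: rot_mom)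
qed

text \<open>The rate is 1: in each direction \<open>k\<close> a given component is moved by
  \<open>d\<close> rotations having its site as first endpoint and by \<open>d\<close> having it as
  second, which makes \<open>2 d^2\<close> in all.\<close>

lemma gen_S_mom:
  fixes x :: "('d::finite) site"
  assumes N: "N \<ge> 2" and x: "x \<in> torus N"
  shows "gen_S N (mom x a) z = - mom x a z"
proof -
  have N1: "N \<ge> 1" using N by simp
  have "(\<Sum>y\<in>torus N. rot i j y (tadd N y (evec k)) (rot i j y (tadd N y (evec k)) (mom x a)) z)
     = - (of_bool (a = i) + of_bool (a = j)) * mom x a z" for i j k
  proof -
    have S: "(\<Sum>y\<in>torus N. of_bool (x = y \<and> a = j)) = (of_bool (a = j) :: real)" for j
    proof -
      have "(\<Sum>y\<in>torus N. of_bool (x = y \<and> a = j)) = (\<Sum>y\<in>torus N. of_bool (x = y) * (of_bool (a = j) :: real))"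
        by (intro sum.cong refl) auto
      thus ?thesis using x by (simp add: sum_of_bool_eq)
    qed
    have "(\<Sum>y\<in>torus N. rot i j y (tadd N y (evec k)) (rot i j y (tadd N y (evec k)) (mom x a)) z) =
      (\<Sum>y\<in>torus N. - (of_bool (x = y \<and> a = i) + of_bool (x = tadd N y (evec k) \<and> a = j)) * mom x a z)"
    proof (intro sum.cong refl)
      fix y :: "'d site" assume y: "y \<in> torus N"
      show "rot i j y (tadd N y (evec k)) (rot i j y (tadd N y (evec k)) (mom x a)) z =
         - (of_bool (x = y \<and> a = i) + of_bool (x = tadd N y (evec k) \<and> a = j)) * mom x a z"
        using tadd_evec_neq(1)[OF N y, of k] by (intro rot_rot_mom[OF _ y tadd_in_torus[OF N1]]) auto
    qed
    also have "\<dots> = - ((\<Sum>y\<in>torus N. of_bool (x = y \<and> a = i)) + (\<Sum>y\<in>torus N. of_bool (x = tadd N y (evec k) \<and> a = j))) * mom x a z"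
      by (simp only: sum.distrib sum_distrib_right[symmetric] sum_negf)
    also have "(\<Sum>y\<in>torus N. of_bool (x = tadd N y (evec k) \<and> a = j)) = (\<Sum>y\<in>torus N. of_bool (x = y \<and> a = j) :: real)"
      by (rule sum_tadd[OF N1])
    finally show ?thesis by (simp only: S)
  qed
  hence "gen_S N (mom x a) z = 1 / (2 * (real CARD('d))\<^sup>2) *
     (\<Sum>i\<in>(UNIV::'d set). \<Sum>j\<in>(UNIV::'d set). \<Sum>k\<in>(UNIV::'d set). - (of_bool (a = i) + of_bool (a = j)) * mom x a z)"
    by (simp only: gen_S_def)
  also have "(\<Sum>i\<in>(UNIV::'d set). \<Sum>j\<in>(UNIV::'d set). \<Sum>k\<in>(UNIV::'d set). - (of_bool (a = i) + of_bool (a = j)) * mom x a z)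
    = - ((\<Sum>i\<in>(UNIV::'d set). \<Sum>j\<in>(UNIV::'d set). \<Sum>k\<in>(UNIV::'d set). of_bool (a = i) + of_bool (a = j)) * mom x a z)"
    by (simp only: sum_negf sum_distrib_right[symmetric] mult_minus_left)
  also have "(\<Sum>i\<in>(UNIV::'d set). \<Sum>j\<in>(UNIV::'d set). \<Sum>k\<in>(UNIV::'d set). of_bool (a = i) + of_bool (a = j)) = 2 * (real CARD('d))\<^sup>2"
  proof -
    have "(\<Sum>i\<in>(UNIV::'d set). of_bool (a = i)) = (1::real)"
      using sum_of_bool_eq[of "UNIV :: 'd set" a "\<lambda>_. 1"] by simp
    thus ?thesis by (simp add: sum.distrib sum_distrib_left[symmetric] power2_eq_square)
  qed
  finally show ?thesis by simp
qed

lemma gen_S_dsp: "gen_S N (dsp \<nu> x a) z = 0"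
  by (simp add: gen_S_def rot_dsp rot_const)

text \<open>The carre du champ of two momenta. A rotation contributes only if its bond meets both
  sites. For \<open>x = y\<close> each bond at the site yields the squared momenta of the other
  endpoint; for neighbours only the rotation with \<open>i = j = a\<close> on the common bond acts
  on both factors.\<close>

lemma rot_product_sum:
  fixes x y :: "('d::finite) site"
  assumes N1: "N \<ge> 1" and x: "x \<in> torus N" and y: "y \<in> torus N"
  shows "(\<Sum>i\<in>UNIV. \<Sum>j\<in>UNIV. \<Sum>k\<in>UNIV. \<Sum>w\<in>torus N.
       rot i j w (tadd N w (evec k)) (mom x a) z * rot i j w (tadd N w (evec k)) (mom y a) z) =
    of_bool (x = y) * (\<Sum>i\<in>UNIV. \<Sum>k\<in>UNIV. (mom (tadd N x (evec k)) i z)\<^sup>2 + (mom (tadd N x (- evec k)) i z)\<^sup>2)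
    - (\<Sum>k\<in>UNIV. of_bool (tadd N x (evec k) = y) + of_bool (tadd N y (evec k) = x)) * (mom x a z * mom y a z)"
proof -
  have "(\<Sum>w\<in>torus N. rot i j w (tadd N w (evec k)) (mom x a) z * rot i j w (tadd N w (evec k)) (mom y a) z) =
     of_bool (a = i) * (of_bool (x = y) * (mom (tadd N x (evec k)) j z)\<^sup>2)
     + of_bool (a = j) * (of_bool (x = y) * (mom (tadd N x (- evec k)) i z)\<^sup>2)
     - of_bool (a = i) * (of_bool (a = j) * ((of_bool (tadd N x (evec k) = y) + of_bool (tadd N y (evec k) = x)) * (mom x a z * mom y a z)))"
    for i j k
  proof -
    have eq: "x = tadd N w (evec k) \<longleftrightarrow> tadd N x (- evec k) = w" if "w \<in> torus N" for w :: "'d site"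
      using x that by (auto simp: tadd_inverse)
    have "(\<Sum>w\<in>torus N. rot i j w (tadd N w (evec k)) (mom x a) z * rot i j w (tadd N w (evec k)) (mom y a) z) =
      (\<Sum>w\<in>torus N. of_bool (x = w) * (of_bool (a = i) * (of_bool (x = y) * (mom (tadd N x (evec k)) j z)\<^sup>2))
        + of_bool (tadd N x (- evec k) = w) * (of_bool (a = j) * (of_bool (x = y) * (mom (tadd N x (- evec k)) i z)\<^sup>2))
        - of_bool (x = w) * (of_bool (a = i) * (of_bool (a = j) * (of_bool (tadd N x (evec k) = y) * (mom x a z * mom y a z))))
        - of_bool (y = w) * (of_bool (a = i) * (of_bool (a = j) * (of_bool (tadd N y (evec k) = x) * (mom x a z * mom y a z)))))"
    proof (intro sum.cong refl)
      fix w :: "'d site" assume w: "w \<in> torus N"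
      have y': "y = tadd N w (evec k) \<and> x = tadd N w (evec k) \<longleftrightarrow> x = y \<and> tadd N x (- evec k) = w"
        using eq[OF w] by auto
      show "rot i j w (tadd N w (evec k)) (mom x a) z * rot i j w (tadd N w (evec k)) (mom y a) z =
        of_bool (x = w) * (of_bool (a = i) * (of_bool (x = y) * (mom (tadd N x (evec k)) j z)\<^sup>2))
        + of_bool (tadd N x (- evec k) = w) * (of_bool (a = j) * (of_bool (x = y) * (mom (tadd N x (- evec k)) i z)\<^sup>2))
        - of_bool (x = w) * (of_bool (a = i) * (of_bool (a = j) * (of_bool (tadd N x (evec k) = y) * (mom x a z * mom y a z))))
        - of_bool (y = w) * (of_bool (a = i) * (of_bool (a = j) * (of_bool (tadd N y (evec k) = x) * (mom x a z * mom y a z))))"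
        unfolding rot_mom eq[OF w, symmetric] using eq[OF w]
        by (auto simp: of_bool_def power2_eq_square)
    qed
    also have "\<dots> = of_bool (a = i) * (of_bool (x = y) * (mom (tadd N x (evec k)) j z)\<^sup>2)
     + of_bool (a = j) * (of_bool (x = y) * (mom (tadd N x (- evec k)) i z)\<^sup>2)
     - of_bool (a = i) * (of_bool (a = j) * (of_bool (tadd N x (evec k) = y) * (mom x a z * mom y a z)))
     - of_bool (a = i) * (of_bool (a = j) * (of_bool (tadd N y (evec k) = x) * (mom x a z * mom y a z)))"
      by (simp only: sum.distrib sum_subtractf sum_of_bool_eq[OF finite_torus]) (simp add: x y tadd_in_torus[OF N1])
    finally show ?thesis by (simp add: algebra_simps)
  qed
  hence "(\<Sum>i\<in>UNIV. \<Sum>j\<in>UNIV. \<Sum>k\<in>UNIV. \<Sum>w\<in>torus N.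
       rot i j w (tadd N w (evec k)) (mom x a) z * rot i j w (tadd N w (evec k)) (mom y a) z) =
     (\<Sum>i\<in>UNIV. of_bool (a = i) * (\<Sum>j\<in>UNIV. \<Sum>k\<in>UNIV. of_bool (x = y) * (mom (tadd N x (evec k)) j z)\<^sup>2))
     + (\<Sum>i\<in>UNIV. \<Sum>j\<in>UNIV. of_bool (a = j) * (\<Sum>k\<in>UNIV. of_bool (x = y) * (mom (tadd N x (- evec k)) i z)\<^sup>2))
     - (\<Sum>i\<in>UNIV. of_bool (a = i) * (\<Sum>j\<in>UNIV. of_bool (a = j) * (\<Sum>k\<in>UNIV. (of_bool (tadd N x (evec k) = y) + of_bool (tadd N y (evec k) = x)) * (mom x a z * mom y a z))))"
    by (simp only: sum.distrib sum_subtractf sum_distrib_left)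
  also have "\<dots> = of_bool (x = y) * ((\<Sum>j\<in>UNIV. \<Sum>k\<in>UNIV. (mom (tadd N x (evec k)) j z)\<^sup>2) + (\<Sum>i\<in>UNIV. \<Sum>k\<in>UNIV. (mom (tadd N x (- evec k)) i z)\<^sup>2))
     - (\<Sum>k\<in>UNIV. of_bool (tadd N x (evec k) = y) + of_bool (tadd N y (evec k) = x)) * (mom x a z * mom y a z)"
    by (simp only: sum_of_bool_eq[OF finite])
       (simp add: sum_distrib_left sum_distrib_right ring_distribs)
  finally show ?thesis by (simp only: sum.distrib)
qed

section \<open>Quadratic observables and their images under the generator\<close>

definition pp :: "('d::finite) site \<Rightarrow> 'd site \<Rightarrow> 'd conf \<Rightarrow> real" where
  "pp x y z = (\<Sum>i\<in>UNIV. mom x i z * mom y i z)"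

definition pr :: "real \<Rightarrow> ('d::finite) site \<Rightarrow> 'd site \<Rightarrow> 'd conf \<Rightarrow> real" where
  "pr \<nu> x y z = (\<Sum>i\<in>UNIV. mom x i z * dsp \<nu> y i z)"

definition rr :: "real \<Rightarrow> ('d::finite) site \<Rightarrow> 'd site \<Rightarrow> 'd conf \<Rightarrow> real" where
  "rr \<nu> x y z = (\<Sum>i\<in>UNIV. dsp \<nu> x i z * dsp \<nu> y i z)"

lemma pol_pp: "x \<in> torus N \<Longrightarrow> y \<in> torus N \<Longrightarrow> pol N \<nu> (pp x y)"
  and pol_pr: "x \<in> torus N \<Longrightarrow> y \<in> torus N \<Longrightarrow> pol N \<nu> (pr \<nu> x y)"
  and pol_rr: "x \<in> torus N \<Longrightarrow> y \<in> torus N \<Longrightarrow> pol N \<nu> (rr \<nu> x y)"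
  unfolding pp_def[abs_def] pr_def[abs_def] rr_def[abs_def] by (auto intro!: pol_intros)

text \<open>Each momentum decays at rate 1, which gives \<open>-2\<close>. In the carre du champ the
  squared neighbour momenta are independent of the component \<open>a\<close>; summing over
  \<open>a\<close> turns their prefactor \<open>1/d^2\<close> into \<open>1/d\<close>.\<close>

lemma gen_S_pp:
  fixes x y :: "('d::finite) site"
  assumes N: "N \<ge> 2" and x: "x \<in> torus N" and y: "y \<in> torus N"
  shows "gen_S N (pp x y) z = noise N (\<lambda>x y. pp x y z) x y"
proof -
  have N1: "N \<ge> 1" using N by simp
  let ?d = "real CARD('d)"
  have "gen_S N (pp x y) z = (\<Sum>a\<in>UNIV. gen_S N (\<lambda>z. mom x a z * mom y a z) z)"
    unfolding pp_def[abs_def] using x y by (intro gen_S_sum[where \<nu> = 0] N1 pol_intros finite)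
  also have "\<dots> = (\<Sum>a\<in>UNIV. - 2 * (mom x a z * mom y a z) + 1 / ?d\<^sup>2 *
    (of_bool (x = y) * (\<Sum>i\<in>UNIV. \<Sum>k\<in>UNIV. (mom (tadd N x (evec k)) i z)\<^sup>2 + (mom (tadd N x (- evec k)) i z)\<^sup>2)
    - (\<Sum>k\<in>UNIV. of_bool (tadd N x (evec k) = y) + of_bool (tadd N y (evec k) = x)) * (mom x a z * mom y a z)))"
    (is "_ = (\<Sum>a\<in>UNIV. - 2 * _ a + 1 / ?d\<^sup>2 * (?B - ?n * _ a))")
    unfolding gen_S_mult[OF N1 pol_mom[OF x, of 0] pol_mom[OF y, of 0]] gen_S_mom[OF N x] gen_S_mom[OF N y]
      rot_product_sum[OF N1 x y] by simp
  also have "\<dots> = - 2 * pp x y z + (1 / ?d\<^sup>2 * (?d * ?B) - 1 / ?d\<^sup>2 * ?n * pp x y z)"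
    unfolding pp_def
  proof -
    fix f :: "'d \<Rightarrow> real" and c n B :: real
    show "(\<Sum>a\<in>UNIV. - 2 * f a + c * (B - n * f a)) = - 2 * (\<Sum>a\<in>UNIV. f a) + (c * (?d * B) - c * n * (\<Sum>a\<in>UNIV. f a))"
      by (simp add: sum.distrib sum_subtractf sum_distrib_left[symmetric] right_diff_distrib mult.assoc)
  qed
  also have "1 / ?d\<^sup>2 * (?d * ?B) = of_bool (x = y) * (1 / ?d * (\<Sum>k\<in>UNIV. pp (tadd N x (evec k)) (tadd N x (evec k)) z + pp (tadd N x (- evec k)) (tadd N x (- evec k)) z))"
    unfolding pp_def sum.distrib[symmetric]
    by (subst sum.swap) (auto simp: power2_eq_square distrib_left[symmetric])
  finally show ?thesis by (simp add: noise_def)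
qed

lemma gen_S_pr:
  assumes N: "N \<ge> 2" and x: "x \<in> torus N" and y: "y \<in> torus N"
  shows "gen_S N (pr \<nu> x y) z = - pr \<nu> x y z"
proof -
  have N1: "N \<ge> 1" using N by simp
  have "gen_S N (pr \<nu> x y) z = (\<Sum>a\<in>UNIV. gen_S N (\<lambda>z. mom x a z * dsp \<nu> y a z) z)"
    unfolding pr_def[abs_def] using x y by (intro gen_S_sum[where \<nu> = \<nu>] N1 pol_intros finite)
  thus ?thesis
    by (simp add: gen_S_mult[OF N1 pol_mom[OF x, of \<nu>] pol_dsp[OF y, of \<nu>]] gen_S_mom[OF N x] gen_S_dsp rot_dsp
        pr_def sum_negf)
qed

lemma gen_S_rr:
  assumes N: "N \<ge> 2" and x: "x \<in> torus N" and y: "y \<in> torus N"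
  shows "gen_S N (rr \<nu> x y) z = 0"
proof -
  have N1: "N \<ge> 1" using N by simp
  have "gen_S N (rr \<nu> x y) z = (\<Sum>a\<in>UNIV. gen_S N (\<lambda>z. dsp \<nu> x a z * dsp \<nu> y a z) z)"
    unfolding rr_def[abs_def] using x y by (intro gen_S_sum[where \<nu> = \<nu>] N1 pol_intros finite)
  thus ?thesis
    by (simp add: gen_S_mult[OF N1 pol_dsp[OF x, of \<nu>] pol_dsp[OF y, of \<nu>]] gen_S_dsp rot_dsp)
qed

lemma kop_sum_mult: "kop N \<omega> \<nu> (\<lambda>w. \<Sum>i\<in>(UNIV::('d::finite) set). c i * u i w) x = (\<Sum>i\<in>UNIV. c i * kop N \<omega> \<nu> (u i) x)"
  by (simp add: kop_sum kop_cmult)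

lemma gen_L_pp:
  assumes N: "N \<ge> 2" and x: "x \<in> torus N" and y: "y \<in> torus N"
  shows "gen_L N m \<omega> \<nu> \<gamma> (pp x y) z =
    - (1 / sqrt (m x)) * kop N \<omega> \<nu> (\<lambda>w. pr \<nu> y w z) x - 1 / sqrt (m y) * kop N \<omega> \<nu> (\<lambda>w. pr \<nu> x w z) y
    + \<gamma> * noise N (\<lambda>x y. pp x y z) x y"
proof -
  have "gen_A N m \<omega> \<nu> (pp x y) z = (\<Sum>a\<in>UNIV. gen_A N m \<omega> \<nu> (\<lambda>z. mom x a z * mom y a z) z)"
    unfolding pp_def[abs_def] using x y by (intro gen_A_sum pol_intros finite)
  also have "\<dots> = - (1 / sqrt (m x)) * kop N \<omega> \<nu> (\<lambda>w. pr \<nu> y w z) x - 1 / sqrt (m y) * kop N \<omega> \<nu> (\<lambda>w. pr \<nu> x w z) y"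
    unfolding gen_A_mult[OF smooth_pol[OF pol_mom[OF x]] smooth_pol[OF pol_mom[OF y]]] gen_A_mom[OF x] gen_A_mom[OF y]
    by (simp add: pr_def kop_sum_mult sum.distrib sum_subtractf sum_distrib_left sum_negf mult_ac)
  finally show ?thesis by (simp add: gen_L_def gen_S_pp[OF assms])
qed

lemma gen_L_pr:
  assumes N: "N \<ge> 2" and x: "x \<in> torus N" and y: "y \<in> torus N"
  shows "gen_L N m \<omega> \<nu> \<gamma> (pr \<nu> x y) z = 1 / sqrt (m y) * pp x y z - pinned \<nu> * (1 / sqrt (m 0)) * pp x 0 z
    - 1 / sqrt (m x) * kop N \<omega> \<nu> (\<lambda>w. rr \<nu> w y z) x - \<gamma> * pr \<nu> x y z"
proof -
  have N1: "N \<ge> 1" using N by simp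
  have r: "kop N \<omega> \<nu> (\<lambda>w. rr \<nu> w y z) x = (\<Sum>i\<in>UNIV. dsp \<nu> y i z * kop N \<omega> \<nu> (\<lambda>w. dsp \<nu> w i z) x)"
    unfolding kop_sum_mult[symmetric] by (simp add: rr_def mult.commute)
  have "gen_A N m \<omega> \<nu> (pr \<nu> x y) z = (\<Sum>a\<in>UNIV. gen_A N m \<omega> \<nu> (\<lambda>z. mom x a z * dsp \<nu> y a z) z)"
    unfolding pr_def[abs_def] using x y by (intro gen_A_sum[where \<nu> = \<nu>] pol_intros finite)
  also have "\<dots> = 1 / sqrt (m y) * pp x y z - pinned \<nu> * (1 / sqrt (m 0)) * pp x 0 z
    - 1 / sqrt (m x) * kop N \<omega> \<nu> (\<lambda>w. rr \<nu> w y z) x"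
    unfolding gen_A_mult[OF smooth_pol[OF pol_mom[OF x]] smooth_pol[OF pol_dsp[OF y]]] gen_A_mom[OF x] gen_A_dsp[OF y N1] r
    by (simp add: pp_def sum.distrib sum_subtractf sum_distrib_left sum_negf algebra_simps)
  finally show ?thesis by (simp add: gen_L_def gen_S_pr[OF assms])
qed

lemma gen_L_rr:
  assumes N: "N \<ge> 2" and x: "x \<in> torus N" and y: "y \<in> torus N"
  shows "gen_L N m \<omega> \<nu> \<gamma> (rr \<nu> x y) z = 1 / sqrt (m x) * pr \<nu> x y z - pinned \<nu> * (1 / sqrt (m 0)) * pr \<nu> 0 y z
    + 1 / sqrt (m y) * pr \<nu> y x z - pinned \<nu> * (1 / sqrt (m 0)) * pr \<nu> 0 x z"
proof -
  have N1: "N \<ge> 1" using N by simp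
  have "gen_A N m \<omega> \<nu> (rr \<nu> x y) z = (\<Sum>a\<in>UNIV. gen_A N m \<omega> \<nu> (\<lambda>z. dsp \<nu> x a z * dsp \<nu> y a z) z)"
    unfolding rr_def[abs_def] using x y by (intro gen_A_sum[where \<nu> = \<nu>] pol_intros finite)
  also have "\<dots> = 1 / sqrt (m x) * pr \<nu> x y z - pinned \<nu> * (1 / sqrt (m 0)) * pr \<nu> 0 y z
    + 1 / sqrt (m y) * pr \<nu> y x z - pinned \<nu> * (1 / sqrt (m 0)) * pr \<nu> 0 x z"
    unfolding gen_A_mult[OF smooth_pol[OF pol_dsp[OF x]] smooth_pol[OF pol_dsp[OF y]]] gen_A_dsp[OF x N1] gen_A_dsp[OF y N1]
    by (simp add: pr_def sum.distrib sum_subtractf sum_distrib_left algebra_simps)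
  finally show ?thesis by (simp add: gen_L_def gen_S_rr[OF assms])
qed


section \<open>Energy cutoffs\<close>

lemma continuous_on_pol: "pol N \<nu> f \<Longrightarrow> continuous_on A f"
proof (induction rule: pol.induct)
  case (pol_mom x i)
  show ?case unfolding mom_def[abs_def]
    by (intro continuous_intros continuous_on_product_then_coordinatewise)
next
  case (pol_dsp x i)
  show ?case unfolding dsp_def[abs_def]
    by (intro continuous_intros continuous_on_product_then_coordinatewise)
qed (intro continuous_intros; assumption)+

text \<open>Only the origin requires an argument: there the difference quotient is itself
  \<open>max 0 h ^ Suc n\<close>.\<close>

lemma has_real_derivative_max_power:
  "((\<lambda>y. max 0 y ^ Suc (Suc n)) has_real_derivative (real n + 2) * max 0 y ^ Suc n) (at (y::real))"
proof (cases y "0::real" rule: linorder_cases)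
  case less
  have "((\<lambda>_. 0) has_real_derivative 0) (at y)" by simp
  moreover have "\<forall>\<^sub>F z in nhds y. max 0 z ^ Suc (Suc n) = (0::real)"
    using eventually_nhds_in_open[of "{..<0}" y] less by (auto elim!: eventually_mono)
  ultimately have "((\<lambda>y. max 0 y ^ Suc (Suc n)) has_real_derivative 0) (at y)"
    using DERIV_cong_ev[of y y "\<lambda>y. max 0 y ^ Suc (Suc n)" "\<lambda>_. 0" 0 0] by simp
  thus ?thesis using less by simp
next
  case equal
  have "(\<lambda>h::real. max 0 h ^ Suc n) \<midarrow>0\<rightarrow> max 0 0 ^ Suc n" by (intro tendsto_intros)
  hence lim: "(\<lambda>h::real. max 0 h ^ Suc n) \<midarrow>0\<rightarrow> 0" by simp
  have eq: "(max 0 (0 + h) ^ Suc (Suc n) - max 0 0 ^ Suc (Suc n)) / h = max 0 h ^ Suc n" if "h \<noteq> 0" for h :: real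
    using that by (cases "h > 0") auto
  have "(\<lambda>h::real. (max 0 (0 + h) ^ Suc (Suc n) - max 0 0 ^ Suc (Suc n)) / h) \<midarrow>0\<rightarrow> 0"
    using lim eq by (subst LIM_equal[of 0 _ "\<lambda>h. max 0 h ^ Suc n"]) auto
  thus ?thesis using equal by (simp add: DERIV_def)
next
  case greater
  have "((\<lambda>y. y ^ Suc (Suc n)) has_real_derivative (real n + 2) * y ^ Suc n) (at y)"
    using DERIV_pow[of "Suc (Suc n)" y] by (simp add: algebra_simps)
  moreover have "\<forall>\<^sub>F z in nhds y. max 0 z ^ Suc (Suc n) = (z::real) ^ Suc (Suc n)"
    using eventually_nhds_in_open[of "{0<..}" y] greater by (auto elim!: eventually_mono)
  ultimately have "((\<lambda>y. max 0 y ^ Suc (Suc n)) has_real_derivative (real n + 2) * y ^ Suc n) (at y)"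
    using DERIV_cong_ev[of y y "\<lambda>y. max 0 y ^ Suc (Suc n)" "\<lambda>y. y ^ Suc (Suc n)" "(real n + 2) * y ^ Suc n" "(real n + 2) * y ^ Suc n"]
    by simp
  thus ?thesis using greater by simp
qed

text \<open>A family of powers rather than one bump function: differentiating lowers the exponent
  within the family, exponent 3 is smooth enough for test functions, and exponent 6 is the square of
  exponent 3, which \<open>energy_conserved\<close> exploits.\<close>

definition cutoff :: "nat \<Rightarrow> real \<Rightarrow> real \<Rightarrow> real" where
  "cutoff n R h = max 0 (1 - h / R) ^ n"

lemma has_real_derivative_cutoff:
  "(cutoff (Suc (Suc n)) R has_real_derivative - (real n + 2) / R * cutoff (Suc n) R h) (at h)"
proof -
  have "((\<lambda>h. 1 - h / R) has_real_derivative - (1 / R)) (at h)"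
    unfolding divide_inverse by (auto intro!: derivative_eq_intros)
  from DERIV_chain2[OF has_real_derivative_max_power this, of n]
  show ?thesis unfolding cutoff_def[abs_def] by (rule DERIV_cong) (simp only: divide_inverse mult_minus_left mult_minus_right mult_1_left mult_ac)
qed

lemma continuous_on_cutoff: "continuous_on A (cutoff n R)"
  unfolding cutoff_def[abs_def] divide_inverse by (intro continuous_intros)

lemma cutoff_nonneg: "0 \<le> cutoff n R h"
  by (simp add: cutoff_def)

lemma cutoff_le_1: "R > 0 \<Longrightarrow> h \<ge> 0 \<Longrightarrow> cutoff n R h \<le> 1"
  by (auto simp: cutoff_def intro!: power_le_one)

lemma cutoff_eq_0: "R > 0 \<Longrightarrow> h \<ge> R \<Longrightarrow> cutoff (Suc n) R h = 0"
  by (auto simp: cutoff_def)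

lemma cutoff_tendsto: "(\<lambda>k. cutoff n (real (Suc k)) h) \<longlonglongrightarrow> 1"
proof -
  have "(\<lambda>k. max 0 (1 - h * inverse (real (Suc k))) ^ n) \<longlonglongrightarrow> max 0 (1 - h * 0) ^ n"
    by (intro tendsto_intros LIMSEQ_inverse_real_of_nat)
  thus ?thesis by (simp add: cutoff_def divide_inverse)
qed

lemma C1_conf_pol_cutoff:
  fixes f h :: "('d::finite) conf \<Rightarrow> real"
  assumes f: "pol N \<nu> f" and h: "pol N \<nu> h"
  shows "C1_conf N (\<lambda>z. f z * cutoff (Suc (Suc n)) R (h z))"
    and "has_pd c (\<lambda>z. f z * cutoff (Suc (Suc n)) R (h z))
       (\<lambda>z. pd c f z * cutoff (Suc (Suc n)) R (h z) + f z * (- (real n + 2) / R * cutoff (Suc n) R (h z) * pd c h z))"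
proof -
  show *: "has_pd c (\<lambda>z. f z * cutoff (Suc (Suc n)) R (h z))
       (\<lambda>z. pd c f z * cutoff (Suc (Suc n)) R (h z) + f z * (- (real n + 2) / R * cutoff (Suc n) R (h z) * pd c h z))" for c
    by (rule has_pd_mult[OF has_pd_pol[OF f] has_pd_compose[OF has_real_derivative_cutoff has_pd_pol[OF h]]])
  have cc: "continuous_on A (\<lambda>z. cutoff k R (h z))" for k A
    using continuous_on_compose2[OF continuous_on_cutoff[of UNIV] continuous_on_pol[OF h]] by auto
  show "C1_conf N (\<lambda>z. f z * cutoff (Suc (Suc n)) R (h z))"
    unfolding C1_conf_def has_pd_imp_pd[OF *]
  proof (intro conjI ballI)
    fix c z
    show "(\<lambda>t. f (nudge c t z) * cutoff (Suc (Suc n)) R (h (nudge c t z))) differentiable at 0"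
      using *[of c] unfolding has_pd_def real_differentiable_def by blast
  qed (intro continuous_intros cc continuous_on_pol[OF f] continuous_on_pol[OF pol_pd[OF f]] continuous_on_pol[OF pol_pd[OF h]])+
qed

lemma smooth_pol_cutoff:
  assumes "pol N \<nu> f" "pol N \<nu> h"
  shows "smooth (\<lambda>z. f z * cutoff (Suc (Suc n)) R (h z))"
  unfolding smooth_def has_pd_imp_pd[OF C1_conf_pol_cutoff(2)[OF assms]]
  using C1_conf_pol_cutoff(2)[OF assms] by blast

lemma C1_conf_add:
  assumes "C1_conf N f" "C1_conf N g" "smooth f" "smooth g"
  shows "C1_conf N (\<lambda>z. f z + g z)"
  using assms unfolding C1_conf_def pd_add[OF assms(3,4)]
  by (auto intro!: continuous_intros differentiable_add)

text \<open>A partial derivative is again a sum of polynomials times cutoffs, with the exponent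
  lowered by at most one; starting from 3 or more, it is still covered by
  \<open>C1_conf_pol_cutoff\<close>.\<close>

lemma C2_conf_pol_cutoff:
  fixes f h :: "('d::finite) conf \<Rightarrow> real"
  assumes f: "pol N \<nu> f" and h: "pol N \<nu> h"
  shows "C2_conf N (\<lambda>z. f z * cutoff (Suc (Suc (Suc n))) R (h z))"
  unfolding C2_conf_def
proof (intro conjI ballI C1_conf_pol_cutoff[OF f h])
  fix c
  have 1: "pd c (\<lambda>z. f z * cutoff (Suc (Suc (Suc n))) R (h z)) =
     (\<lambda>z. pd c f z * cutoff (Suc (Suc (Suc n))) R (h z) +
          (f z * ((- (real (Suc n) + 2) / R) * pd c h z)) * cutoff (Suc (Suc n)) R (h z))"
    unfolding has_pd_imp_pd[OF C1_conf_pol_cutoff(2)[OF f h]] by (simp add: mult_ac)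
  have p: "pol N \<nu> (pd c f)" "pol N \<nu> (\<lambda>z. f z * ((- (real (Suc n) + 2) / R) * pd c h z))"
    by (intro pol_intros pol_pd f h)+
  show "C1_conf N (pd c (\<lambda>z. f z * cutoff (Suc (Suc (Suc n))) R (h z)))"
    unfolding 1
    by (rule C1_conf_add[OF C1_conf_pol_cutoff(1)[OF p(1) h] C1_conf_pol_cutoff(1)[OF p(2) h]
        smooth_pol_cutoff[OF p(1) h] smooth_pol_cutoff[OF p(2) h]])
qed

section \<open>The Hamiltonian\<close>

lemma inner_field_kop:
  "q x \<bullet> (\<nu> *\<^sub>R q x - \<omega> *\<^sub>R laplace N q x) = (\<Sum>i\<in>UNIV. q x $ i * kop N \<omega> \<nu> (\<lambda>y. q y $ i) x)"
  unfolding inner_vec_def by (simp add: kop_def laplace_def)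

lemma force_component:
  "(\<omega> *\<^sub>R laplace N (snd z) x - \<nu> *\<^sub>R snd z x) $ i = - kop N \<omega> \<nu> (\<lambda>y. dsp \<nu> y i z) x"
  unfolding kop_dsp by (simp add: kop_def laplace_def)

locale chain =
  fixes N :: nat and m :: "('d::finite) site \<Rightarrow> real" and \<omega> \<nu> \<gamma> \<beta> :: real
  assumes N: "N \<ge> 3" and pos: "\<omega> > 0" "\<nu> \<ge> 0" "\<gamma> > 0" "\<beta> > 0"
begin

lemma N1: "N \<ge> 1" and N2: "N \<ge> 2" using N by auto

abbreviation "\<Lambda> \<equiv> torus N :: 'd site set"
abbreviation "K \<equiv> kop N \<omega> \<nu>"
abbreviation H :: "'d conf \<Rightarrow> real" where "H \<equiv> hamiltonian N \<omega> \<nu>"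
abbreviation r :: "'d site \<Rightarrow> 'd \<Rightarrow> 'd conf \<Rightarrow> real" where "r \<equiv> dsp \<nu>"
abbreviation poly :: "('d conf \<Rightarrow> real) \<Rightarrow> bool" where "poly \<equiv> pol N \<nu>"
abbreviation "elastic i z \<equiv> \<nu> * (\<Sum>x\<in>\<Lambda>. (r x i z)\<^sup>2) + \<omega> * (\<Sum>x\<in>\<Lambda>. \<Sum>j\<in>UNIV. (r (tadd N x (evec j)) i z - r x i z)\<^sup>2)"

text \<open>For \<open>\<nu> = 0\<close> only differences of displacements contribute and the
  reference site cancels in them; otherwise \<open>r\<close> is the displacement itself.\<close>

lemma hamiltonian_dirichlet:
  "H z = (\<Sum>x\<in>\<Lambda>. \<Sum>i\<in>UNIV. (mom x i z)\<^sup>2) / 2 +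
    (\<Sum>i\<in>UNIV. elastic i z) / 2"
proof (cases z)
  case z: (Pair p q)
  have 1: "(\<Sum>x\<in>\<Lambda>. (norm (p x))\<^sup>2) = (\<Sum>x\<in>\<Lambda>. \<Sum>i\<in>UNIV. (mom x i z)\<^sup>2)"
    by (simp add: z mom_def power2_norm_eq_inner inner_vec_def) (simp add: power2_eq_square)
  have "(\<Sum>x\<in>\<Lambda>. q x \<bullet> (\<nu> *\<^sub>R q x - \<omega> *\<^sub>R laplace N q x)) = (\<Sum>i\<in>UNIV. \<Sum>x\<in>\<Lambda>. q x $ i * K (\<lambda>y. q y $ i) x)"
    unfolding inner_field_kop by (rule sum.swap)
  also have "\<dots> = (\<Sum>i\<in>UNIV. elastic i z)"
    unfolding kop_dirichlet[OF N1]
    by (intro sum.cong refl arg_cong2[of _ _ _ _ "(+)"]; cases "\<nu> = 0") (simp_all add: z dsp_def pinned_def power2_eq_square)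
  finally have 2: "(\<Sum>x\<in>\<Lambda>. q x \<bullet> (\<nu> *\<^sub>R q x - \<omega> *\<^sub>R laplace N q x)) = \<dots>" .
  show ?thesis unfolding 2[symmetric] 1[symmetric]
    by (simp add: z hamiltonian_def sum.distrib sum_divide_distrib)
qed

lemma hamiltonian_nonneg: "H z \<ge> 0"
  unfolding hamiltonian_dirichlet using pos
  by (intro add_nonneg_nonneg divide_nonneg_nonneg sum_nonneg mult_nonneg_nonneg) auto

lemma poly_hamiltonian: "poly H"
proof -
  have "poly (\<lambda>z. (\<Sum>x\<in>\<Lambda>. \<Sum>i\<in>UNIV. (mom x i z)\<^sup>2) / 2 +
    (\<Sum>i\<in>UNIV. elastic i z) / 2)"
    by (intro pol_intros tadd_in_torus N1)
  thus ?thesis by (simp add: hamiltonian_dirichlet[abs_def])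
qed

lemma mom_le_hamiltonian: "x \<in> \<Lambda> \<Longrightarrow> (\<Sum>i\<in>UNIV. (mom x i z)\<^sup>2) \<le> 2 * H z"
proof -
  assume x: "x \<in> \<Lambda>"
  have "(\<Sum>i\<in>UNIV. (mom x i z)\<^sup>2) \<le> (\<Sum>x\<in>\<Lambda>. \<Sum>i\<in>UNIV. (mom x i z)\<^sup>2)"
    using x by (intro member_le_sum sum_nonneg) auto
  moreover have "(\<Sum>i\<in>UNIV. elastic i z) \<ge> 0"
    using pos by (intro add_nonneg_nonneg sum_nonneg mult_nonneg_nonneg) auto
  ultimately show ?thesis unfolding hamiltonian_dirichlet by (simp add: field_simps)
qed

text \<open>For \<open>\<nu> = 0\<close> the bound propagates along lattice paths from the reference
  site, where \<open>r\<close> vanishes. The constant deteriorates along the path, and so with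
  \<open>N\<close>, but it serves only integrability and compactness for fixed
  \<open>N\<close>.\<close>

lemma dsp_le_hamiltonian: "x \<in> \<Lambda> \<Longrightarrow> \<exists>C\<ge>0. \<forall>z i. (r x i z)\<^sup>2 \<le> C * H z"
proof (cases "\<nu> = 0")
  case False
  assume x: "x \<in> \<Lambda>"
  have "(r x i z)\<^sup>2 \<le> 2 / \<nu> * H z" for z i
  proof -
    have "\<nu> * (r x i z)\<^sup>2 \<le> \<nu> * (\<Sum>x\<in>\<Lambda>. (r x i z)\<^sup>2)"
      using x pos by (intro mult_left_mono member_le_sum[where f = "\<lambda>x. (r x i z)\<^sup>2"]) auto
    also have "\<dots> \<le> elastic i z"
      using pos by (simp add: sum_nonneg)
    also have "\<dots> \<le> (\<Sum>i\<in>UNIV. elastic i z)"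
      using pos by (intro member_le_sum add_nonneg_nonneg sum_nonneg mult_nonneg_nonneg) auto
    also have "\<dots> \<le> 2 * H z"
      unfolding hamiltonian_dirichlet by (simp add: sum_nonneg)
    finally show ?thesis using pos False by (simp add: field_simps)
  qed
  thus ?thesis using pos by (intro exI[of _ "2 / \<nu>"]) auto
next
  case True
  assume "x \<in> \<Lambda>"
  from this N1 show ?thesis
  proof (induction rule: torus_induct)
    case zero
    show ?case using True hamiltonian_nonneg by (intro exI[of _ 0]) (auto simp: dsp_def pinned_def)
  next
    case (step x k)
    then obtain C where C: "C \<ge> 0" "\<And>z i. (r x i z)\<^sup>2 \<le> C * H z" by blast
    \<comment> \<open>The new constant is that of \<open>(u + v)^2 \<le> 2 u^2 + 2 v^2\<close>,
      where the squared increment is at most \<open>2 / \<omega>\<close> times the energy.\<close>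
    have "(r (tadd N x (evec k)) i z)\<^sup>2 \<le> (2 * C + 4 / \<omega>) * H z" for z i
    proof -
      let ?e = "r (tadd N x (evec k)) i z - r x i z"
      have "?e\<^sup>2 \<le> (\<Sum>j\<in>UNIV. (r (tadd N x (evec j)) i z - r x i z)\<^sup>2)"
        by (rule member_le_sum[where f = "\<lambda>j. (r (tadd N x (evec j)) i z - r x i z)\<^sup>2"]) auto
      also have "\<dots> \<le> (\<Sum>x\<in>\<Lambda>. \<Sum>j\<in>UNIV. (r (tadd N x (evec j)) i z - r x i z)\<^sup>2)"
        using step(1) by (intro member_le_sum[where f = "\<lambda>x. \<Sum>j\<in>UNIV. (r (tadd N x (evec j)) i z - r x i z)\<^sup>2"] sum_nonneg) auto
      finally have "\<omega> * ?e\<^sup>2 \<le> \<omega> * (\<Sum>x\<in>\<Lambda>. \<Sum>j\<in>UNIV. (r (tadd N x (evec j)) i z - r x i z)\<^sup>2)"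
        using pos by (intro mult_left_mono) auto
      also have "\<dots> \<le> \<nu> * (\<Sum>x\<in>\<Lambda>. (r x i z)\<^sup>2) + \<dots>" using True by simp
      also have "\<dots> \<le> (\<Sum>i\<in>UNIV. elastic i z)"
        using pos by (intro member_le_sum[where f = "\<lambda>i. elastic i z"]
          add_nonneg_nonneg sum_nonneg mult_nonneg_nonneg) auto
      also have "\<dots> \<le> 2 * H z"
        unfolding hamiltonian_dirichlet by (simp add: sum_nonneg)
      finally have e: "?e\<^sup>2 \<le> 2 / \<omega> * H z" using pos by (simp add: field_simps)
      have "(r (tadd N x (evec k)) i z)\<^sup>2 = (r x i z + ?e)\<^sup>2" by simp
      also have "\<dots> \<le> 2 * (r x i z)\<^sup>2 + 2 * ?e\<^sup>2"
        using sum_squares_bound[of "r x i z" ?e] by (simp only: power2_sum)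
      also have "\<dots> \<le> (2 * C + 4 / \<omega>) * H z"
        using e C(2)[of i z] by (simp add: algebra_simps)
      finally show ?thesis .
    qed
    thus ?case using C pos by (intro exI[of _ "2 * C + 4 / \<omega>"]) auto
  qed
qed

text \<open>Growth is measured by the energy instead of the coordinates, so that conservation of
  energy carries the bound from one time to another.\<close>

lemma poly_bound: "poly f \<Longrightarrow> \<exists>C k. C \<ge> 0 \<and> (\<forall>z. \<bar>f z\<bar> \<le> C * (1 + H z) ^ k)"
proof (induction rule: pol.induct)
  case (pol_const a)
  show ?case by (intro exI[of _ "\<bar>a\<bar>"] exI[of _ 0]) auto
next
  case (pol_mom x i)
  have "\<bar>mom x i z\<bar> \<le> 2 * (1 + H z) ^ 1" for z
  proof -
    have "(mom x i z)\<^sup>2 \<le> 2 * H z"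
      using mom_le_hamiltonian[OF pol_mom, of z] member_le_sum[of i UNIV "\<lambda>i. (mom x i z)\<^sup>2"] by auto
    moreover have "2 * \<bar>mom x i z\<bar> \<le> 1 + (mom x i z)\<^sup>2"
      using sum_squares_bound[of 1 "\<bar>mom x i z\<bar>"] by simp
    ultimately show ?thesis using hamiltonian_nonneg[of z] by simp
  qed
  thus ?case by (intro exI[of _ 2] exI[of _ 1]) simp
next
  case (pol_dsp x i)
  then obtain C where C: "C \<ge> 0" "\<And>z i. (r x i z)\<^sup>2 \<le> C * H z" using dsp_le_hamiltonian by blast
  have "\<bar>r x i z\<bar> \<le> (1 + C) * (1 + H z) ^ 1" for z
  proof -
    have "2 * \<bar>r x i z\<bar> \<le> 1 + (r x i z)\<^sup>2"
      using sum_squares_bound[of 1 "\<bar>r x i z\<bar>"] by simp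
    hence "\<bar>r x i z\<bar> \<le> 1 + C * H z" using C(2)[of i z] by simp
    thus ?thesis using hamiltonian_nonneg[of z] C by (simp add: algebra_simps)
  qed
  thus ?case using C by (intro exI[of _ "1 + C"] exI[of _ 1]) simp
next
  case (pol_add f g)
  then obtain C k D l where *: "C \<ge> 0" "\<And>z. \<bar>f z\<bar> \<le> C * (1 + H z) ^ k" "D \<ge> 0" "\<And>z. \<bar>g z\<bar> \<le> D * (1 + H z) ^ l" by blast
  have "\<bar>f z + g z\<bar> \<le> (C + D) * (1 + H z) ^ max k l" for z
  proof -
    have "(1 + H z) ^ k \<le> (1 + H z) ^ max k l" "(1 + H z) ^ l \<le> (1 + H z) ^ max k l"
      using hamiltonian_nonneg[of z] by (intro power_increasing; simp)+
    hence "C * (1 + H z) ^ k \<le> C * (1 + H z) ^ max k l" "D * (1 + H z) ^ l \<le> D * (1 + H z) ^ max k l"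
      using * by (auto intro: mult_left_mono)
    thus ?thesis using *(2)[of z] *(4)[of z] by (simp add: algebra_simps)
  qed
  thus ?case using * by (intro exI[of _ "C + D"] exI[of _ "max k l"]) auto
next
  case (pol_mult f g)
  then obtain C k D l where *: "C \<ge> 0" "\<And>z. \<bar>f z\<bar> \<le> C * (1 + H z) ^ k" "D \<ge> 0" "\<And>z. \<bar>g z\<bar> \<le> D * (1 + H z) ^ l" by blast
  have "\<bar>f z * g z\<bar> \<le> (C * D) * (1 + H z) ^ (k + l)" for z
  proof -
    have "\<bar>f z\<bar> * \<bar>g z\<bar> \<le> (C * (1 + H z) ^ k) * (D * (1 + H z) ^ l)"
      using * hamiltonian_nonneg[of z] by (intro mult_mono) auto
    thus ?thesis by (simp add: abs_mult power_add mult_ac)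
  qed
  thus ?case using * by (intro exI[of _ "C * D"] exI[of _ "k + l"]) auto
qed

text \<open>Along a coordinate line the energy is a quadratic polynomial in \<open>t\<close>, which
  is expanded exactly. The second formula includes the reference site.\<close>

lemma pd_hamiltonian:
  assumes "x \<in> \<Lambda>"
  shows "pd (Mom x i) H = mom x i" and "pd (Pos x i) H = (\<lambda>z. K (\<lambda>y. r y i z) x)"
proof -
  have "has_pd (Mom x i) H (mom x i)"
    unfolding has_pd_def
  proof
    fix z
    have rr: "r y j (nudge (Mom x i) t z) = r y j z" for y j t by (cases z) (simp add: dsp_def)
    have pp: "mom y j (nudge (Mom x i) t z) = mom y j z + of_bool (y = x) * (of_bool (j = i) * t)" for y j t
      by (cases z) (auto simp: mom_def axis_def)
    have e: "(\<Sum>y\<in>\<Lambda>. \<Sum>j\<in>UNIV. (mom y j (nudge (Mom x i) t z))\<^sup>2) =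
       (\<Sum>y\<in>\<Lambda>. \<Sum>j\<in>UNIV. (mom y j z)\<^sup>2) + 2 * mom x i z * t + t\<^sup>2" for t
    proof -
      have "(\<Sum>y\<in>\<Lambda>. \<Sum>j\<in>UNIV. (mom y j (nudge (Mom x i) t z))\<^sup>2) =
        (\<Sum>y\<in>\<Lambda>. \<Sum>j\<in>UNIV. (mom y j z)\<^sup>2 + of_bool (x = y) * (of_bool (i = j) * (2 * mom y j z * t + t\<^sup>2)))"
        unfolding pp by (intro sum.cong refl) (auto simp: power2_sum)
      also have "\<dots> = (\<Sum>y\<in>\<Lambda>. \<Sum>j\<in>UNIV. (mom y j z)\<^sup>2) + (2 * mom x i z * t + t\<^sup>2)"
        by (simp only: sum.distrib sum_distrib_left[symmetric] sum_of_bool_eq[OF finite_torus] sum_of_bool_eq[OF finite])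
           (simp add: assms)
      finally show ?thesis by simp
    qed
    show "((\<lambda>t. H (nudge (Mom x i) t z)) has_real_derivative mom x i z) (at 0)"
      unfolding hamiltonian_dirichlet[of "nudge _ _ _"] rr e by (auto intro!: derivative_eq_intros)
  qed
  thus "pd (Mom x i) H = mom x i" by (rule has_pd_imp_pd)
  have "has_pd (Pos x i) H (\<lambda>z. K (\<lambda>y. r y i z) x)"
    unfolding has_pd_def
  proof
    fix z :: "'d conf"
    obtain p q where z: "z = (p, q)" by (cases z)
    define D where "D y = (of_bool (x = y) :: real)" for y
    have eH: "H (nudge (Pos x i) t z) = H z + t * K (\<lambda>y. q y $ i) x + t\<^sup>2 * K D x / 2" for t
    proof -
      let ?q = "q(x := q x + t *\<^sub>R axis i 1)"
      have c: "?q y $ j = q y $ j + of_bool (i = j) * t * D y" for j y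
        by (auto simp: axis_def D_def)
      have DK: "(\<Sum>y\<in>\<Lambda>. D y * K F y) = K F x" for F
        using assms by (simp add: D_def sum_of_bool_eq)
      have "(\<Sum>y\<in>\<Lambda>. \<Sum>j\<in>UNIV. ?q y $ j * K (\<lambda>y. ?q y $ j) y) =
        (\<Sum>j\<in>UNIV. \<Sum>y\<in>\<Lambda>. (q y $ j + of_bool (i = j) * t * D y) * K (\<lambda>y. q y $ j + of_bool (i = j) * t * D y) y)"
        unfolding c by (rule sum.swap)
      also have "\<dots> = (\<Sum>j\<in>UNIV. (\<Sum>y\<in>\<Lambda>. q y $ j * K (\<lambda>y. q y $ j) y) + of_bool (i = j) *
           (t * (\<Sum>y\<in>\<Lambda>. D y * K (\<lambda>y. q y $ j) y) + t * (\<Sum>y\<in>\<Lambda>. q y $ j * K D y) + t\<^sup>2 * (\<Sum>y\<in>\<Lambda>. D y * K D y)))"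
        by (intro sum.cong refl)
           (auto simp: kop_add kop_cmult kop_const algebra_simps sum.distrib sum_distrib_left power2_eq_square)
      also have "\<dots> = (\<Sum>j\<in>UNIV. (\<Sum>y\<in>\<Lambda>. q y $ j * K (\<lambda>y. q y $ j) y)) +
           (t * (\<Sum>y\<in>\<Lambda>. D y * K (\<lambda>y. q y $ i) y) + t * (\<Sum>y\<in>\<Lambda>. q y $ i * K D y) + t\<^sup>2 * (\<Sum>y\<in>\<Lambda>. D y * K D y))"
        by (simp only: sum.distrib sum_of_bool_eq[OF finite]) simp
      also have "(\<Sum>y\<in>\<Lambda>. q y $ i * K D y) = (\<Sum>y\<in>\<Lambda>. D y * K (\<lambda>y. q y $ i) y)"
        using kop_symmetric[OF N1, of "\<lambda>y. q y $ i" \<omega> \<nu> D] by (simp add: mult.commute)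
      finally show ?thesis
        unfolding DK by (simp add: z hamiltonian_def inner_field_kop sum.distrib sum_divide_distrib[symmetric] sum.swap[of _ UNIV \<Lambda>])
    qed
    have "((\<lambda>t. H (nudge (Pos x i) t z)) has_real_derivative K (\<lambda>y. q y $ i) x) (at 0)"
      unfolding eH by (auto intro!: derivative_eq_intros)
    thus "((\<lambda>t. H (nudge (Pos x i) t z)) has_real_derivative K (\<lambda>y. r y i z) x) (at 0)"
      unfolding kop_dsp by (simp add: z)
  qed
  thus "pd (Pos x i) H = (\<lambda>z. K (\<lambda>y. r y i z) x)" by (rule has_pd_imp_pd)
qed

text \<open>The energy is annihilated site by site: in \<open>A\<close> the transport and force
  terms cancel, and in a rotation the two products of momenta cancel. A function of the energy thus
  passes through these derivations like a constant, and through a rotation twice because the image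
  of a polynomial is a polynomial.\<close>

lemma gen_L_pol_cutoff:
  assumes f: "poly f"
  shows "gen_L N m \<omega> \<nu> \<gamma> (\<lambda>z. f z * cutoff (Suc (Suc (Suc n))) R (H z)) z =
    gen_L N m \<omega> \<nu> \<gamma> f z * cutoff (Suc (Suc (Suc n))) R (H z)"
proof -
  let ?g = "cutoff (Suc (Suc (Suc n))) R"
  define G where "G z = - (real (Suc n) + 2) / R * cutoff (Suc (Suc n)) R (H z)" for z
  have pd: "pd c (\<lambda>z. f z * ?g (H z)) = (\<lambda>z. pd c f z * ?g (H z) + f z * (G z * pd c H z))" if "poly f" for c f
    unfolding G_def by (rule has_pd_imp_pd[OF C1_conf_pol_cutoff(2)[OF that poly_hamiltonian]])
  have A: "gen_A N m \<omega> \<nu> (\<lambda>z. f z * ?g (H z)) z = gen_A N m \<omega> \<nu> f z * ?g (H z)"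
    unfolding gen_A_def pd[OF f] force_component sum_distrib_right sum_distrib_left
    by (intro sum.cong refl) (simp add: pd_hamiltonian algebra_simps mom_def)
  have R: "rot i j x y (\<lambda>z. f z * ?g (H z)) = (\<lambda>z. rot i j x y f z * ?g (H z))"
    if "poly f" "x \<in> \<Lambda>" "y \<in> \<Lambda>" for i j x y f
    unfolding rot_def pd[OF that(1)] pd_hamiltonian[OF that(2)] pd_hamiltonian[OF that(3)]
    by (simp add: fun_eq_iff mom_def algebra_simps)
  have "gen_S N (\<lambda>z. f z * ?g (H z)) z = gen_S N f z * ?g (H z)"
    unfolding gen_S_def sum_distrib_right sum_distrib_left
    by (intro sum.cong refl) (simp add: R f pol_rot tadd_in_torus[OF N1] algebra_simps)
  with A show ?thesis by (simp add: gen_L_def algebra_simps)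
qed

lemma poly_gen_L:
  assumes f: "poly f"
  shows "poly (gen_L N m \<omega> \<nu> \<gamma> f)"
proof -
  have "gen_L N m \<omega> \<nu> \<gamma> f = (\<lambda>z. (\<Sum>x\<in>\<Lambda>. 1 / sqrt (m x) * (\<Sum>i\<in>UNIV. mom x i z * pd (Pos x i) f z
     + - K (\<lambda>y. r y i z) x * pd (Mom x i) f z)) + \<gamma> * (1 / (2 * (real CARD('d))\<^sup>2) *
     (\<Sum>i\<in>UNIV. \<Sum>j\<in>UNIV. \<Sum>k\<in>UNIV. \<Sum>x\<in>torus N.
        rot i j x (tadd N x (evec k)) (rot i j x (tadd N x (evec k)) f) z)))"
    unfolding gen_L_def[abs_def] gen_A_def gen_S_def force_component mom_def ..
  thus ?thesis by (simp only:) (intro pol_intros pol_pd pol_rot pol_kop f N1 tadd_in_torus; assumption)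
qed

text \<open>The support lies in a sublevel set of the energy, which bounds the momenta and the
  displacements relative to the reference site. Translation invariance holds by induction, the
  energy being a polynomial too.\<close>

lemma test_fun_pol_cutoff:
  assumes f: "poly f" and R: "R > 0"
  shows "test_fun N \<nu> (\<lambda>z. f z * cutoff (Suc (Suc (Suc n))) R (H z))"
  unfolding test_fun_def
proof (intro conjI impI)
  show "C2_conf N (\<lambda>z. f z * cutoff (Suc (Suc (Suc n))) R (H z))"
    by (rule C2_conf_pol_cutoff[OF f poly_hamiltonian])
  assume \<nu>: "\<nu> = 0"
  have inv: "f (p, \<lambda>x\<in>\<Lambda>. q x + a) = f (p, q)" if "poly f" for f p q a
    using that
    by (induction rule: pol.induct) (auto simp: mom_def dsp_def pinned_def \<nu> zero_in_torus[OF N1])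
  show "\<forall>(p, q)\<in>space (phase N). \<forall>a. f (p, \<lambda>x\<in>\<Lambda>. q x + a) * cutoff (Suc (Suc (Suc n))) R (H (p, \<lambda>x\<in>\<Lambda>. q x + a)) =
      f (p, q) * cutoff (Suc (Suc (Suc n))) R (H (p, q))"
    using inv[OF f] inv[OF poly_hamiltonian] by auto
next
  obtain C where C: "\<And>x. x \<in> \<Lambda> \<Longrightarrow> C x \<ge> 0 \<and> (\<forall>z i. (r x i z)\<^sup>2 \<le> C x * H z)"
    using dsp_le_hamiltonian by metis
  define D where "D = real CARD('d) * (\<Sum>x\<in>\<Lambda>. C x) * R"
  have np: "norm (p x) \<le> sqrt (2 * R)" if "H (p, q) < R" "x \<in> \<Lambda>" for p q x
  proof -
    have "(norm (p x))\<^sup>2 = (\<Sum>i\<in>UNIV. (mom x i (p, q))\<^sup>2)"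
      by (simp add: mom_def power2_norm_eq_inner inner_vec_def) (simp add: power2_eq_square)
    hence "(norm (p x))\<^sup>2 \<le> 2 * R"
      using mom_le_hamiltonian[OF that(2), of "(p, q)"] that(1) by simp
    thus ?thesis by (rule real_le_rsqrt)
  qed
  have nr: "norm (q x - pinned \<nu> *\<^sub>R q 0) \<le> sqrt D" if "H (p, q) < R" "x \<in> \<Lambda>" for p q x
  proof -
    have "(norm (q x - pinned \<nu> *\<^sub>R q 0))\<^sup>2 = (\<Sum>i\<in>UNIV. (r x i (p, q))\<^sup>2)"
      by (simp add: dsp_def power2_norm_eq_inner inner_vec_def) (simp add: power2_eq_square)
    also have "\<dots> \<le> (\<Sum>i\<in>(UNIV::'d set). (\<Sum>x\<in>\<Lambda>. C x) * R)"
    proof (rule sum_mono)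
      fix i :: 'd
      have "(r x i (p, q))\<^sup>2 \<le> C x * H (p, q)" using C[OF that(2)] by blast
      also have "\<dots> \<le> (\<Sum>x\<in>\<Lambda>. C x) * R"
        using C that hamiltonian_nonneg[of "(p, q)"] by (intro mult_mono member_le_sum sum_nonneg) auto
      finally show "(r x i (p, q))\<^sup>2 \<le> (\<Sum>x\<in>\<Lambda>. C x) * R" .
    qed
    also have "\<dots> = D" by (simp add: D_def)
    finally show ?thesis by (rule real_le_rsqrt)
  qed
  \<comment> \<open>The factor 2 arises because \<open>q x - q y\<close> is estimated through the
    reference site.\<close>
  define B where "B = sqrt (2 * R) + 2 * sqrt D"
  have D0: "D \<ge> 0" unfolding D_def using C R by (intro mult_nonneg_nonneg sum_nonneg) auto
  hence B: "sqrt (2 * R) \<le> B" "2 * sqrt D \<le> B" "sqrt D \<le> B"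
    using R by (auto simp: B_def)
  show "\<exists>B. \<forall>(p, q)\<in>space (phase N). f (p, q) * cutoff (Suc (Suc (Suc n))) R (H (p, q)) \<noteq> 0 \<longrightarrow>
        (\<forall>x\<in>\<Lambda>. norm (p x) \<le> B) \<and>
        (if \<nu> = 0 then \<forall>x\<in>\<Lambda>. \<forall>y\<in>\<Lambda>. norm (q x - q y) \<le> B else \<forall>x\<in>\<Lambda>. norm (q x) \<le> B)"
  proof (intro exI[of _ B] ballI case_prodI2 impI conjI)
    fix z :: "'d conf" and p q
    assume "z = (p, q)" and nz: "f (p, q) * cutoff (Suc (Suc (Suc n))) R (H (p, q)) \<noteq> 0"
    from nz have HR: "H (p, q) < R" using cutoff_eq_0[OF R] by (metis mult_zero_right not_less)
    show "norm (p x) \<le> B" if "x \<in> \<Lambda>" for x using np[OF HR that] B(1) by simp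
    show "if \<nu> = 0 then \<forall>x\<in>\<Lambda>. \<forall>y\<in>\<Lambda>. norm (q x - q y) \<le> B else \<forall>x\<in>\<Lambda>. norm (q x) \<le> B"
    proof (cases "\<nu> = 0")
      case True
      have "norm (q x - q y) \<le> B" if "x \<in> \<Lambda>" "y \<in> \<Lambda>" for x y
      proof -
        have "norm ((q x - q 0) - (q y - q 0)) \<le> norm (q x - q 0) + norm (q y - q 0)" by (rule norm_triangle_ineq4)
        thus ?thesis using nr[OF HR that(1)] nr[OF HR that(2)] B(2) True by (simp add: pinned_def)
      qed
      thus ?thesis using True by simp
    next
      case False
      have "norm (q x) \<le> B" if "x \<in> \<Lambda>" for x
        using nr[OF HR that] B(3) False by (simp add: pinned_def)
      thus ?thesis using False by simp
    qed
  qed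
qed

end


section \<open>The reference measure\<close>

text \<open>Naming the factor at each site lets the theory of products with varying factors handle
  the point mass at the pinned site.\<close>

definition qmeasure :: "real \<Rightarrow> ('d::finite) site \<Rightarrow> (real ^ 'd) measure" where
  "qmeasure \<nu> x = (if \<nu> = 0 \<and> x = 0 then return borel 0 else lborel)"

lemma sets_qmeasure [simp, measurable_cong]: "sets (qmeasure \<nu> x) = sets borel"
  by (simp add: qmeasure_def)

lemma space_qmeasure [simp]: "space (qmeasure \<nu> x) = UNIV"
  by (simp add: qmeasure_def)

lemma ref_measure_eq: "ref_measure N \<nu> = (\<Pi>\<^sub>M x\<in>torus N. lborel) \<Otimes>\<^sub>M (\<Pi>\<^sub>M x\<in>torus N. qmeasure \<nu> x)"
  by (simp add: ref_measure_def qmeasure_def)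

lemma sets_ref_measure [measurable_cong]: "sets (ref_measure N \<nu>) = sets (phase N)"
  unfolding ref_measure_eq phase_def by (intro sets_pair_measure_cong sets_PiM_cong) auto

lemma product_sigma_finite_lborel: "product_sigma_finite (\<lambda>_. lborel :: (real ^ 'd::finite) measure)"
  by (simp add: product_sigma_finite_def lborel.sigma_finite_measure_axioms)

lemma product_sigma_finite_qmeasure: "product_sigma_finite (qmeasure \<nu> :: ('d::finite) site \<Rightarrow> _)"
  unfolding product_sigma_finite_def qmeasure_def
  by (auto intro!: prob_space_imp_sigma_finite prob_space_return lborel.sigma_finite_measure_axioms)

lemma sigma_finite_lborel_PiM: "sigma_finite_measure (\<Pi>\<^sub>M x\<in>torus N. lborel :: (real ^ 'd::finite) measure)"
  by (intro product_sigma_finite.sigma_finite product_sigma_finite_lborel) simp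

lemma sigma_finite_qmeasure_PiM: "sigma_finite_measure (\<Pi>\<^sub>M x\<in>(torus N :: ('d::finite) site set). qmeasure \<nu> x)"
  by (intro product_sigma_finite.sigma_finite product_sigma_finite_qmeasure) simp

lemma sigma_finite_ref_measure: "sigma_finite_measure (ref_measure N \<nu> :: ('d::finite) conf measure)"
  unfolding ref_measure_eq
  by (intro sigma_finite_pair_measure sigma_finite_lborel_PiM sigma_finite_qmeasure_PiM)

lemma measurable_coordinate [measurable]:
  "x \<in> torus N \<Longrightarrow> (\<lambda>z. fst z x) \<in> phase N \<rightarrow>\<^sub>M borel"
  "x \<in> torus N \<Longrightarrow> (\<lambda>z. snd z x) \<in> phase N \<rightarrow>\<^sub>M borel"
  unfolding phase_def by measurable

lemma measurable_vec_nth: "(\<lambda>v::real ^ 'd::finite. v $ i) \<in> borel_measurable borel"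
  by (intro borel_measurable_continuous_onI continuous_intros)

lemma measurable_pol:
  assumes N: "N \<ge> 1"
  shows "pol N \<nu> f \<Longrightarrow> f \<in> borel_measurable (phase N)"
proof (induction rule: pol.induct)
  case (pol_mom x i)
  show ?case unfolding mom_def[abs_def]
    using measurable_compose[OF measurable_coordinate(1)[OF pol_mom] measurable_vec_nth] .
next
  case (pol_dsp x i)
  show ?case unfolding dsp_def[abs_def]
    by (intro borel_measurable_diff borel_measurable_times borel_measurable_const
        measurable_compose[OF measurable_coordinate(2) measurable_vec_nth] pol_dsp zero_in_torus N)
qed auto

text \<open>It suffices to test rectangles, on which the shift changes a single factor.\<close>

lemma distr_PiM_fun_upd:
  fixes M :: "'i \<Rightarrow> 'a::{real_normed_vector, second_countable_topology} measure"
  assumes M: "product_sigma_finite M" "\<And>x. x \<in> I \<Longrightarrow> sets (M x) = sets borel" and I: "finite I" "x \<in> I"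
    and shift: "distr (M x) (M x) (\<lambda>v. v + a) = M x"
  shows "distr (PiM I M) (PiM I M) (\<lambda>q. q(x := q x + a)) = PiM I M"
proof -
  interpret product_sigma_finite M by (rule M(1))
  have mb: "(\<lambda>v. v + a) \<in> measurable (M x) (M x)"
    unfolding measurable_cong_sets[OF M(2)[OF I(2)] M(2)[OF I(2)]] by simp
  have mu[measurable]: "(\<lambda>q. q(x := q x + a)) \<in> PiM I M \<rightarrow>\<^sub>M PiM I M"
    by (rule measurable_fun_upd[of I I x])
       (use I in \<open>auto intro!: measurable_compose[OF measurable_component_singleton[of x I M] mb]\<close>)
  show ?thesis
  proof (rule PiM_eqI)
    fix A assume A: "\<And>i. i \<in> I \<Longrightarrow> A i \<in> sets (M i)"
    define A' where "A' = A(x := (\<lambda>v. v + a) -` A x \<inter> space (M x))"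
    have A': "A' i \<in> sets (M i)" if "i \<in> I" for i
      using A that measurable_sets[OF mb A[OF I(2)]] by (auto simp: A'_def)
    have sp: "v \<in> space (M i)" if "i \<in> I" for v i
      using sets_eq_imp_space_eq[OF M(2)[OF that]] by simp
    have "(\<lambda>q. q(x := q x + a)) -` Pi\<^sub>E I A \<inter> space (PiM I M) = Pi\<^sub>E I A'"
      using I sp by (auto simp: space_PiM A'_def PiE_iff extensional_def split: if_splits)
    hence "emeasure (distr (PiM I M) (PiM I M) (\<lambda>q. q(x := q x + a))) (Pi\<^sub>E I A) = emeasure (PiM I M) (Pi\<^sub>E I A')"
      using A I by (subst emeasure_distr) (auto intro!: sets_PiM_I_finite)
    also have "\<dots> = (\<Prod>i\<in>I. emeasure (M i) (A' i))" using A' I by (intro emeasure_PiM) auto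
    also have "\<dots> = (\<Prod>i\<in>I. emeasure (M i) (A i))"
    proof (intro prod.cong refl)
      fix i assume i: "i \<in> I"
      have "emeasure (M x) (A x) = emeasure (distr (M x) (M x) (\<lambda>v. v + a)) (A x)" by (simp add: shift)
      also have "\<dots> = emeasure (M x) (A' x)" using mb A I by (subst emeasure_distr) (auto simp: A'_def)
      finally show "emeasure (M i) (A' i) = emeasure (M i) (A i)" by (auto simp: A'_def)
    qed
    finally show "emeasure (distr (PiM I M) (PiM I M) (\<lambda>q. q(x := q x + a))) (Pi\<^sub>E I A) = (\<Prod>i\<in>I. emeasure (M i) (A i))" .
  qed (use I in auto)
qed

lemma distr_lborel_plus: "distr lborel lborel (\<lambda>v. v + a) = (lborel :: 'a::euclidean_space measure)"
proof -
  have "distr lborel lborel (\<lambda>v. v + a) = distr lborel borel ((+) a)"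
    by (intro distr_cong) (auto simp: add.commute)
  thus ?thesis by (simp add: lborel_distr_plus)
qed

text \<open>The directions in which the reference measure is translation invariant, hence those in
  which one may integrate by parts. The missing direction at the pinned site is recovered in
  \<open>E_force_jmp\<close>.\<close>

fun free_coord :: "nat \<Rightarrow> real \<Rightarrow> ('d::finite) coord \<Rightarrow> bool" where
  "free_coord N \<nu> (Mom x i) \<longleftrightarrow> x \<in> torus N"
| "free_coord N \<nu> (Pos x i) \<longleftrightarrow> x \<in> torus N \<and> \<not> (\<nu> = 0 \<and> x = 0)"

lemma distr_ref_measure_nudge:
  assumes "free_coord N \<nu> c"
  shows "distr (ref_measure N \<nu>) (ref_measure N \<nu>) (nudge c t) = ref_measure N \<nu>"
proof (cases c)
  case (Mom x i)
  hence x: "x \<in> torus N" using assms by simp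
  let ?P = "\<Pi>\<^sub>M x\<in>(torus N :: 'a site set). lborel :: (real ^ 'a) measure" and ?Q = "\<Pi>\<^sub>M x\<in>torus N. qmeasure \<nu> x :: (real ^ 'a) measure"
  let ?f = "\<lambda>q::'a field. q(x := q x + t *\<^sub>R axis i 1)"
  have d: "distr ?P ?P ?f = ?P"
    by (rule distr_PiM_fun_upd[OF product_sigma_finite_lborel _ _ x distr_lborel_plus]) auto
  have f: "?f \<in> ?P \<rightarrow>\<^sub>M ?P"
    by (rule measurable_fun_upd[of _ "torus N" x]) (use x in auto)
  have "ref_measure N \<nu> = distr ?P ?P ?f \<Otimes>\<^sub>M distr ?Q ?Q (\<lambda>q. q)"
    by (simp add: ref_measure_eq d distr_id)
  also have "\<dots> = distr (?P \<Otimes>\<^sub>M ?Q) (?P \<Otimes>\<^sub>M ?Q) (\<lambda>(p, q). (?f p, q))"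
    using f sigma_finite_qmeasure_PiM by (intro pair_measure_distr) (auto simp: distr_id)
  also have "(\<lambda>(p, q). (?f p, q)) = nudge c t" by (auto simp: Mom fun_eq_iff split_paired_All)
  finally show ?thesis by (simp add: ref_measure_eq)
next
  case (Pos x i)
  hence x: "x \<in> torus N" "\<not> (\<nu> = 0 \<and> x = 0)" using assms by auto
  let ?P = "\<Pi>\<^sub>M x\<in>(torus N :: 'a site set). lborel :: (real ^ 'a) measure" and ?Q = "\<Pi>\<^sub>M x\<in>torus N. qmeasure \<nu> x :: (real ^ 'a) measure"
  let ?f = "\<lambda>q::'a field. q(x := q x + t *\<^sub>R axis i 1)"
  have "qmeasure \<nu> x = lborel" using x by (auto simp: qmeasure_def)
  hence d: "distr ?Q ?Q ?f = ?Q"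
    by (intro distr_PiM_fun_upd[OF product_sigma_finite_qmeasure _ _ x(1)]) (auto simp: distr_lborel_plus)
  have f: "?f \<in> ?Q \<rightarrow>\<^sub>M ?Q"
    by (rule measurable_fun_upd[of _ "torus N" x]) (use x in auto)
  have "ref_measure N \<nu> = distr ?P ?P (\<lambda>p. p) \<Otimes>\<^sub>M distr ?Q ?Q ?f"
    by (simp add: ref_measure_eq d distr_id)
  also have "\<dots> = distr (?P \<Otimes>\<^sub>M ?Q) (?P \<Otimes>\<^sub>M ?Q) (\<lambda>(p, q). (p, ?f q))"
    using f d sigma_finite_qmeasure_PiM by (intro pair_measure_distr) auto
  also have "(\<lambda>(p, q). (p, ?f q)) = nudge c t" by (auto simp: Pos fun_eq_iff split_paired_All)
  finally show ?thesis by (simp add: ref_measure_eq)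
qed

lemma measurable_nudge:
  assumes "free_coord N \<nu> c"
  shows "(\<lambda>(t, z). nudge c t z) \<in> lborel \<Otimes>\<^sub>M phase N \<rightarrow>\<^sub>M phase N"
proof (cases c)
  case (Mom x i)
  hence x: "x \<in> torus N" using assms by simp
  have [measurable]: "(\<lambda>w. fst (snd w) x) \<in> lborel \<Otimes>\<^sub>M phase N \<rightarrow>\<^sub>M borel"
    "(\<lambda>w. snd w) \<in> lborel \<Otimes>\<^sub>M phase N \<rightarrow>\<^sub>M phase N"
    using measurable_compose[OF measurable_snd measurable_coordinate(1)[OF x]] by auto
  have [measurable]: "fst \<in> phase N \<rightarrow>\<^sub>M (\<Pi>\<^sub>M x\<in>torus N. borel)" "snd \<in> phase N \<rightarrow>\<^sub>M (\<Pi>\<^sub>M x\<in>torus N. borel)"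
    by (simp_all add: phase_def)
  have "(\<lambda>w. ((fst (snd w))(x := fst (snd w) x + fst w *\<^sub>R axis i 1), snd (snd w))) \<in> lborel \<Otimes>\<^sub>M phase N \<rightarrow>\<^sub>M
      (\<Pi>\<^sub>M x\<in>torus N. borel) \<Otimes>\<^sub>M (\<Pi>\<^sub>M x\<in>torus N. borel)"
    by (intro measurable_Pair measurable_fun_upd[of _ "torus N" x]) (use x in \<open>auto; measurable\<close>)+
  also have "(\<lambda>w. ((fst (snd w))(x := fst (snd w) x + fst w *\<^sub>R axis i 1), snd (snd w))) = (\<lambda>(t, z). nudge c t z)"
    by (auto simp: Mom fun_eq_iff split_paired_All)
  finally show ?thesis by (simp add: phase_def)
next
  case (Pos x i)
  hence x: "x \<in> torus N" using assms by simp
  have [measurable]: "(\<lambda>w. snd (snd w) x) \<in> lborel \<Otimes>\<^sub>M phase N \<rightarrow>\<^sub>M borel"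
    "(\<lambda>w. snd w) \<in> lborel \<Otimes>\<^sub>M phase N \<rightarrow>\<^sub>M phase N"
    using measurable_compose[OF measurable_snd measurable_coordinate(2)[OF x]] by auto
  have [measurable]: "fst \<in> phase N \<rightarrow>\<^sub>M (\<Pi>\<^sub>M x\<in>torus N. borel)" "snd \<in> phase N \<rightarrow>\<^sub>M (\<Pi>\<^sub>M x\<in>torus N. borel)"
    by (simp_all add: phase_def)
  have "(\<lambda>w. (fst (snd w), (snd (snd w))(x := snd (snd w) x + fst w *\<^sub>R axis i 1))) \<in> lborel \<Otimes>\<^sub>M phase N \<rightarrow>\<^sub>M
      (\<Pi>\<^sub>M x\<in>torus N. borel) \<Otimes>\<^sub>M (\<Pi>\<^sub>M x\<in>torus N. borel)"
    by (intro measurable_Pair measurable_fun_upd[of _ "torus N" x]) (use x in \<open>auto; measurable\<close>)+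
  also have "(\<lambda>w. (fst (snd w), (snd (snd w))(x := snd (snd w) x + fst w *\<^sub>R axis i 1))) = (\<lambda>(t, z). nudge c t z)"
    by (auto simp: Pos fun_eq_iff split_paired_All)
  finally show ?thesis by (simp add: phase_def)
qed

text \<open>Lebesgue measure is invariant under shifts of a coordinate, and \<open>f(z + e) - f(z)\<close> is the integral
  of the derivative along the segment from \<open>z\<close> to \<open>z + e\<close>; integrating over \<open>z\<close> first gives the claim.\<close>

lemma integral_pd_eq_0:
  fixes f f' :: "('d::finite) conf \<Rightarrow> real"
  assumes c: "free_coord N \<nu> c" and f: "has_pd c f f'" and f': "has_pd c f' f''"
    and int: "integrable (ref_measure N \<nu>) f" "integrable (ref_measure N \<nu>) f'"
  shows "(\<integral>z. f' z \<partial>(ref_measure N \<nu>)) = 0"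
proof -
  let ?R = "ref_measure N \<nu> :: 'd conf measure"
  interpret R: sigma_finite_measure ?R by (rule sigma_finite_ref_measure)
  interpret pair_sigma_finite "lborel :: real measure" ?R ..
  have mn[measurable]: "(\<lambda>(t, z). nudge c t z) \<in> lborel \<Otimes>\<^sub>M ?R \<rightarrow>\<^sub>M ?R"
    using measurable_nudge[OF c] by (simp cong: measurable_cong_sets add: sets_ref_measure)
  have mt[measurable]: "nudge c t \<in> ?R \<rightarrow>\<^sub>M ?R" for t
    using measurable_compose[OF measurable_Pair1'[of t lborel ?R] mn] by simp
  have [measurable]: "f \<in> borel_measurable ?R" "f' \<in> borel_measurable ?R" using int by auto
  have inv: "(\<integral>z. g (nudge c t z) \<partial>?R) = (\<integral>z. g z \<partial>?R)" if [measurable]: "g \<in> borel_measurable ?R" for g :: "'d conf \<Rightarrow> real" and t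
    using integral_distr[of "nudge c t" ?R ?R g] by (simp add: distr_ref_measure_nudge[OF c])
  have inv_int: "integrable ?R (\<lambda>z. g (nudge c t z))" if "integrable ?R g" for g :: "'d conf \<Rightarrow> real" and t
    using integrable_distr[of "nudge c t" ?R ?R g] that by (simp add: distr_ref_measure_nudge[OF c])
  define F where "F = (\<lambda>(t, z). f' (nudge c t z) * indicator {0..1::real} t)"
  have [measurable]: "F \<in> borel_measurable (lborel \<Otimes>\<^sub>M ?R)"
    unfolding F_def case_prod_beta
    using measurable_compose[OF mn, of f' borel] by (intro borel_measurable_times) (auto simp: case_prod_beta)
  have intF: "integrable (lborel \<Otimes>\<^sub>M ?R) F"
  proof (rule Fubini_integrable)
    have "(\<integral>z. norm (F (t, z)) \<partial>?R) = indicator {0..1} t *\<^sub>R (\<integral>z. \<bar>f' z\<bar> \<partial>?R)" for t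
      using inv[of "\<lambda>z. \<bar>f' z\<bar>" t] by (simp add: F_def abs_mult split: split_indicator)
    moreover have "integrable lborel (\<lambda>t. indicator {0..1::real} t *\<^sub>R (\<integral>z. \<bar>f' z\<bar> \<partial>?R))"
      by (intro integrable_real_indicator integrable_scaleR_left) auto
    ultimately show "integrable lborel (\<lambda>t. \<integral>z. norm (F (t, z)) \<partial>?R)" by simp
    show "AE t in lborel. integrable ?R (\<lambda>z. F (t, z))"
      using inv_int[OF int(2)] by (auto simp: F_def)
  qed simp
  have seg: "(\<integral>t. F (t, z) \<partial>lborel) = f (nudge c 1 z) - f z" for z
  proof -
    have "(\<integral>t. f' (nudge c t z) * indicator {0..1} t \<partial>lborel) = f (nudge c 1 z) - f (nudge c 0 z)"
    proof (rule integral_FTC_Icc_real)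
      fix t :: real
      show "DERIV (\<lambda>t. f (nudge c t z)) t :> f' (nudge c t z)" by (rule has_pdD[OF f])
      show "isCont (\<lambda>t. f' (nudge c t z)) t" using has_pdD[OF f'] by (rule DERIV_isCont)
    qed simp
    thus ?thesis by (simp add: F_def)
  qed
  have "(\<integral>z. f' z \<partial>?R) = (\<integral>t. indicator {0..1::real} t *\<^sub>R (\<integral>z. f' z \<partial>?R) \<partial>lborel)"
    by (subst integral_scaleR_left) auto
  also have "\<dots> = (\<integral>t. (\<integral>z. F (t, z) \<partial>?R) \<partial>lborel)"
    by (intro Bochner_Integration.integral_cong refl) (auto simp: F_def inv split: split_indicator)
  also have "\<dots> = (\<integral>z. (\<integral>t. F (t, z) \<partial>lborel) \<partial>?R)"
    using Fubini_integral[of "\<lambda>t z. F (t, z)"] intF by simp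
  also have "\<dots> = (\<integral>z. f (nudge c 1 z) - f z \<partial>?R)" by (simp add: seg)
  also have "\<dots> = (\<integral>z. f (nudge c 1 z) \<partial>?R) - (\<integral>z. f z \<partial>?R)"
    by (intro Bochner_Integration.integral_diff inv_int int)
  also have "\<dots> = 0" by (simp add: inv)
  finally show ?thesis .
qed

lemma nn_integral_exp_square_finite:
  assumes a: "a > 0"
  shows "(\<integral>\<^sup>+v. ennreal (exp (- a * (norm v)\<^sup>2)) \<partial>(lborel :: 'a::euclidean_space measure)) < \<infinity>"
proof -
  have "(norm v)\<^sup>2 = (\<Sum>b\<in>Basis. (v \<bullet> b)\<^sup>2)" for v :: 'a
    unfolding power2_norm_eq_inner by (subst euclidean_inner) (simp add: power2_eq_square)
  hence e: "ennreal (exp (- a * (norm v)\<^sup>2)) = (\<Prod>b\<in>Basis. ennreal (exp (- a * (v \<bullet> b)\<^sup>2)))" for v :: 'a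
    by (simp add: prod_ennreal exp_sum[symmetric] sum_distrib_left sum_negf)
  have one: "(\<integral>\<^sup>+s. ennreal (exp (- a * s\<^sup>2)) \<partial>(lborel :: real measure)) < \<infinity>"
  proof -
    \<comment> \<open>The standard deviation for which \<open>exp (- a * s^2)\<close> is an
      unnormalised normal density.\<close>
    define \<sigma> where "\<sigma> = sqrt (1 / (2 * a))"
    have s2: "\<sigma>\<^sup>2 = 1 / (2 * a)" using a by (simp add: \<sigma>_def)
    have "\<sigma> > 0" using a by (simp add: \<sigma>_def)
    hence "integrable lborel (\<lambda>s. sqrt (2 * pi * \<sigma>\<^sup>2) * normal_density 0 \<sigma> s)"
      by simp
    also have "(\<lambda>s. sqrt (2 * pi * \<sigma>\<^sup>2) * normal_density 0 \<sigma> s) = (\<lambda>s. exp (- a * s\<^sup>2))"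
      using a by (auto simp: normal_density_def fun_eq_iff s2)
    finally show ?thesis by (simp add: integrable_iff_bounded)
  qed
  have "(\<integral>\<^sup>+v. ennreal (exp (- a * (norm v)\<^sup>2)) \<partial>(lborel :: 'a measure)) =
     (\<Prod>b\<in>(Basis :: 'a set). (\<integral>\<^sup>+s. ennreal (exp (- a * s\<^sup>2)) \<partial>lborel))"
    unfolding e by (rule nn_integral_lborel_prod) auto
  also have "\<dots> < \<infinity>" using one by (simp add: ennreal_prod_eq_top power_less_top_ennreal)
  finally show ?thesis .
qed

text \<open>Almost everywhere relative and absolute displacements agree, which makes the Gaussian
  majorant in \<open>integrable_exp_hamiltonian\<close> factorise over the sites.\<close>

lemma AE_ref_measure_pinned:
  assumes N: "N \<ge> 1" and \<nu>: "\<nu> = 0"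
  shows "AE z in (ref_measure N \<nu> :: ('d::finite) conf measure). snd z 0 = 0"
proof -
  let ?P = "\<Pi>\<^sub>M x\<in>(torus N :: 'd site set). lborel :: (real ^ 'd) measure" and ?Q = "\<Pi>\<^sub>M x\<in>(torus N :: 'd site set). qmeasure \<nu> x"
  interpret P: sigma_finite_measure ?P by (rule sigma_finite_lborel_PiM)
  interpret Q: sigma_finite_measure ?Q by (rule sigma_finite_qmeasure_PiM)
  interpret pair_sigma_finite ?P ?Q ..
  interpret q: product_sigma_finite "qmeasure \<nu> :: 'd site \<Rightarrow> _" by (rule product_sigma_finite_qmeasure)
  have 0: "(0 :: 'd site) \<in> torus N" by (rule zero_in_torus[OF N])
  let ?A = "\<lambda>x::'d site. if x = 0 then - {0} else (UNIV :: (real ^ 'd) set)"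
  have "emeasure ?Q (Pi\<^sub>E (torus N) ?A) = (\<Prod>x\<in>torus N. emeasure (qmeasure \<nu> x) (?A x))"
    by (rule q.emeasure_PiM) auto
  also have "\<dots> = 0"
    using 0 by (intro prod_zero) (auto intro!: bexI[of _ 0] simp: qmeasure_def \<nu>)
  finally have "Pi\<^sub>E (torus N) ?A \<in> null_sets ?Q"
    by (auto intro!: null_setsI sets_PiM_I_finite)
  moreover have "{q \<in> space ?Q. q 0 \<noteq> 0} \<subseteq> Pi\<^sub>E (torus N) ?A"
    by (auto simp: space_PiM PiE_iff extensional_def)
  ultimately have Q: "AE q in ?Q. q 0 = 0"
    by (intro AE_I') auto
  have m: "(\<lambda>z. snd z 0) \<in> ?P \<Otimes>\<^sub>M ?Q \<rightarrow>\<^sub>M borel"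
    using 0 by measurable
  have "{z \<in> space (?P \<Otimes>\<^sub>M ?Q). snd z 0 = 0} \<in> sets (?P \<Otimes>\<^sub>M ?Q)"
    using m by measurable
  thus ?thesis unfolding ref_measure_eq
    by (rule AE_pair_measure) (use Q in simp)
qed

context chain
begin

abbreviation "R \<equiv> ref_measure N \<nu> :: 'd conf measure"

text \<open>The energy dominates a multiple of the sum of all squared coordinates, so the
  exponential is bounded by a product of Gaussians in single sites. At the pinned site the factor is
  integrated against a point mass.\<close>

lemma integrable_exp_hamiltonian:
  assumes e: "e > 0"
  shows "integrable R (\<lambda>z. exp (- e * H z))"
proof -
  obtain C where C: "\<And>x. x \<in> \<Lambda> \<Longrightarrow> C x \<ge> 0 \<and> (\<forall>z i. (r x i z)\<^sup>2 \<le> C x * H z)"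
    using dsp_le_hamiltonian by metis
  define D where "D = real (card \<Lambda>) * 2 + (\<Sum>x\<in>\<Lambda>. real CARD('d) * C x)"
  have D: "D \<ge> 0" unfolding D_def using C by (intro add_nonneg_nonneg sum_nonneg mult_nonneg_nonneg) auto
  \<comment> \<open>\<open>D\<close> collects the constants that bound the squared coordinates by
    the energy, so \<open>a\<close> times their sum is at most \<open>e * H z\<close>.\<close>
  define a where "a = e / (1 + D)"
  have a: "a > 0" using e D by (simp add: a_def)
  let ?S = "\<lambda>z. (\<Sum>x\<in>\<Lambda>. \<Sum>i\<in>UNIV. (mom x i z)\<^sup>2) + (\<Sum>x\<in>\<Lambda>. \<Sum>i\<in>UNIV. (r x i z)\<^sup>2)"
  have S: "a * ?S z \<le> e * H z" for z
  proof -
    have "(\<Sum>x\<in>\<Lambda>. \<Sum>i\<in>UNIV. (mom x i z)\<^sup>2) \<le> (\<Sum>x\<in>\<Lambda>. 2 * H z)"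
      by (intro sum_mono mom_le_hamiltonian)
    moreover have "(\<Sum>x\<in>\<Lambda>. \<Sum>i\<in>UNIV. (r x i z)\<^sup>2) \<le> (\<Sum>x\<in>\<Lambda>. \<Sum>i\<in>(UNIV::'d set). C x * H z)"
      using C by (intro sum_mono) auto
    ultimately have "?S z \<le> D * H z"
      by (simp add: D_def algebra_simps sum_distrib_left sum_distrib_right)
    also have "\<dots> \<le> (1 + D) * H z" using hamiltonian_nonneg[of z] by (simp add: algebra_simps)
    finally have "a * ?S z \<le> a * ((1 + D) * H z)" using a by (intro mult_left_mono) auto
    thus ?thesis using D by (simp add: a_def)
  qed
  let ?h = "\<lambda>v::real^'d. ennreal (exp (- a * (norm v)\<^sup>2))"
  let ?P = "\<Pi>\<^sub>M x\<in>\<Lambda>. lborel :: (real ^ 'd) measure" and ?Q = "\<Pi>\<^sub>M x\<in>\<Lambda>. qmeasure \<nu> x"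
  interpret Q: sigma_finite_measure ?Q by (rule sigma_finite_qmeasure_PiM)
  interpret p: product_sigma_finite "\<lambda>_::'d site. lborel :: (real^'d) measure" by (rule product_sigma_finite_lborel)
  interpret q: product_sigma_finite "qmeasure \<nu> :: 'd site \<Rightarrow> _" by (rule product_sigma_finite_qmeasure)
  have ae: "AE z in R. pinned \<nu> *\<^sub>R snd z 0 = 0"
    using AE_ref_measure_pinned[OF N1, of \<nu>] by (cases "\<nu> = 0") (auto simp: pinned_def)
  have "(\<integral>\<^sup>+z. ennreal (exp (- e * H z)) \<partial>R) \<le> (\<integral>\<^sup>+z. (\<Prod>x\<in>\<Lambda>. ?h (fst z x)) * (\<Prod>x\<in>\<Lambda>. ?h (snd z x)) \<partial>R)"
  proof (rule nn_integral_mono_AE, use ae in eventually_elim)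
    case (elim z)
    have r: "r x i z = snd z x $ i" for x i
      using elim by (auto simp: dsp_def)
    have n: "(\<Sum>i\<in>UNIV. (v $ i)\<^sup>2) = (norm v)\<^sup>2" for v :: "real ^ 'd"
      by (simp add: power2_norm_eq_inner inner_vec_def) (simp add: power2_eq_square)
    have "exp (- e * H z) \<le> exp (- (a * ?S z))" using S[of z] by simp
    also have "\<dots> = (\<Prod>x\<in>\<Lambda>. exp (- a * (norm (fst z x))\<^sup>2)) * (\<Prod>x\<in>\<Lambda>. exp (- a * (norm (snd z x))\<^sup>2))"
      by (simp add: exp_sum[symmetric] exp_add[symmetric] r n mom_def sum_distrib_left sum_negf algebra_simps)
    finally show ?case by (simp add: prod_ennreal ennreal_mult[symmetric] prod_nonneg)
  qed
  also have "\<dots> = (\<integral>\<^sup>+p. (\<integral>\<^sup>+q. (\<Prod>x\<in>\<Lambda>. ?h (p x)) * (\<Prod>x\<in>\<Lambda>. ?h (q x)) \<partial>?Q) \<partial>?P)"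
    unfolding ref_measure_eq by (subst Q.nn_integral_fst[symmetric]) auto
  also have "\<dots> = (\<integral>\<^sup>+p. (\<Prod>x\<in>\<Lambda>. ?h (p x)) * (\<integral>\<^sup>+q. (\<Prod>x\<in>\<Lambda>. ?h (q x)) \<partial>?Q) \<partial>?P)"
    by (intro nn_integral_cong nn_integral_cmult) measurable
  also have "\<dots> = (\<integral>\<^sup>+p. (\<Prod>x\<in>\<Lambda>. ?h (p x)) \<partial>?P) * (\<integral>\<^sup>+q. (\<Prod>x\<in>\<Lambda>. ?h (q x)) \<partial>?Q)"
    by (intro nn_integral_multc) measurable
  also have "(\<integral>\<^sup>+p. (\<Prod>x\<in>\<Lambda>. ?h (p x)) \<partial>?P) = (\<Prod>x\<in>\<Lambda>. (\<integral>\<^sup>+v. ?h v \<partial>lborel))"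
    by (intro p.product_nn_integral_prod) auto
  also have "(\<integral>\<^sup>+q. (\<Prod>x\<in>\<Lambda>. ?h (q x)) \<partial>?Q) = (\<Prod>x\<in>\<Lambda>. (\<integral>\<^sup>+v. ?h v \<partial>qmeasure \<nu> x))"
    by (intro q.product_nn_integral_prod) auto
  also have "(\<Prod>x\<in>\<Lambda>. (\<integral>\<^sup>+v. ?h v \<partial>lborel)) * (\<Prod>x\<in>\<Lambda>. (\<integral>\<^sup>+v. ?h v \<partial>qmeasure \<nu> x)) < \<infinity>"
  proof -
    have l: "(\<integral>\<^sup>+v. ?h v \<partial>lborel) < \<infinity>" by (rule nn_integral_exp_square_finite[OF a])
    have lq: "(\<integral>\<^sup>+v. ?h v \<partial>qmeasure \<nu> x) < \<infinity>" for x
      using l by (auto simp: qmeasure_def nn_integral_return)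
    have prod: "(\<Prod>x\<in>A. g x) < \<infinity>" if "finite A" "\<And>x. g x < \<infinity>" for A :: "'d site set" and g :: "'d site \<Rightarrow> ennreal"
      using that by (induction A rule: finite_induct) (auto simp: ennreal_mult_less_top)
    have "(\<Prod>x\<in>\<Lambda>. (\<integral>\<^sup>+v. ?h v \<partial>lborel)) < \<infinity>" "(\<Prod>x\<in>\<Lambda>. (\<integral>\<^sup>+v. ?h v \<partial>qmeasure \<nu> x)) < \<infinity>"
      by (rule prod[OF finite_torus l], rule prod[OF finite_torus lq])
    thus ?thesis unfolding infinity_ennreal_def ennreal_mult_less_top by blast
  qed
  finally show ?thesis
    using measurable_pol[OF N1 poly_hamiltonian] by (simp add: integrable_iff_bounded cong: measurable_cong_sets)
qed

lemma poly_times_exp_bound: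
  assumes f: "poly f" and b: "b > 0"
  shows "\<exists>C. \<forall>z. \<bar>f z\<bar> * exp (- b * H z) \<le> C * exp (- (b / 2) * H z)"
proof -
  obtain C k where C: "C \<ge> 0" "\<And>z. \<bar>f z\<bar> \<le> C * (1 + H z) ^ k" using poly_bound[OF f] by blast
  \<comment> \<open>With \<open>t \<le> 1\<close> one has
    \<open>t * (1 + H z) \<le> exp (t * H z)\<close>, and the \<open>k\<close>-th power of this
    exponential uses up at most half of the available decay.\<close>
  define t where "t = min 1 (b / (2 * (real k + 1)))"
  have t: "0 < t" "t \<le> 1" "real k * t \<le> b / 2"
  proof -
    show "0 < t" "t \<le> 1" using b by (auto simp: t_def)
    have "real k * t \<le> real k * (b / (2 * (real k + 1)))" by (intro mult_left_mono) (auto simp: t_def)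
    also have "\<dots> \<le> b / 2" using b by (simp add: field_simps)
    finally show "real k * t \<le> b / 2" .
  qed
  have "\<bar>f z\<bar> * exp (- b * H z) \<le> (C * (1 / t) ^ k) * exp (- (b / 2) * H z)" for z
  proof -
    have H: "H z \<ge> 0" by (rule hamiltonian_nonneg)
    have "t * (1 + H z) \<le> 1 + t * H z" using t by (simp add: algebra_simps)
    also have "\<dots> \<le> exp (t * H z)" by (rule exp_ge_add_one_self)
    finally have "1 + H z \<le> (1 / t) * exp (t * H z)" using t by (simp add: field_simps)
    hence "(1 + H z) ^ k \<le> ((1 / t) * exp (t * H z)) ^ k" using H by (intro power_mono) auto
    also have "\<dots> = (1 / t) ^ k * exp (real k * t * H z)"
      by (simp add: power_mult_distrib exp_of_nat_mult[symmetric] mult_ac power_divide)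
    also have "\<dots> \<le> (1 / t) ^ k * exp (b / 2 * H z)"
    proof (intro mult_left_mono)
      have "real k * t * H z \<le> b / 2 * H z" using t H by (intro mult_right_mono) auto
      thus "exp (real k * t * H z) \<le> exp (b / 2 * H z)" by simp
    qed (use t in auto)
    finally have "\<bar>f z\<bar> \<le> C * ((1 / t) ^ k * exp (b / 2 * H z))"
      using C by (meson order_trans mult_left_mono)
    hence "\<bar>f z\<bar> * exp (- b * H z) \<le> C * ((1 / t) ^ k * exp (b / 2 * H z)) * exp (- b * H z)"
      by (intro mult_right_mono) auto
    also have "\<dots> = (C * (1 / t) ^ k) * (exp (b / 2 * H z) * exp (- b * H z))" by simp
    also have "exp (b / 2 * H z) * exp (- b * H z) = exp (- (b / 2) * H z)"
      by (simp add: exp_add[symmetric] algebra_simps)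
    finally show ?thesis .
  qed
  thus ?thesis by blast
qed

lemma integrable_poly_exp:
  assumes f: "poly f"
  shows "integrable R (\<lambda>z. f z * exp (- \<beta> * H z))"
proof -
  obtain C where C: "\<And>z. \<bar>f z\<bar> * exp (- \<beta> * H z) \<le> C * exp (- (\<beta> / 2) * H z)"
    using poly_times_exp_bound[OF f pos(4)] by blast
  show ?thesis
  proof (rule Bochner_Integration.integrable_bound)
    show "integrable R (\<lambda>z. C * exp (- (\<beta> / 2) * H z))"
      using integrable_exp_hamiltonian[of "\<beta> / 2"] pos by (intro integrable_mult_right) auto
    show "(\<lambda>z. f z * exp (- \<beta> * H z)) \<in> borel_measurable R"
      using measurable_pol[OF N1 poly_hamiltonian] measurable_pol[OF N1 f] by (simp cong: measurable_cong_sets add: sets_ref_measure)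
    show "AE z in R. norm (f z * exp (- \<beta> * H z)) \<le> norm (C * exp (- (\<beta> / 2) * H z))"
      by (intro AE_I2) (unfold real_norm_def abs_mult abs_exp_cancel, rule order_trans[OF C], simp)
  qed
qed

lemma integral_by_parts:
  assumes c: "free_coord N \<nu> c" and f: "poly f"
  shows "(\<integral>z. pd c f z * exp (- \<beta> * H z) \<partial>R) = \<beta> * (\<integral>z. pd c H z * f z * exp (- \<beta> * H z) \<partial>R)"
proof -
  note H = poly_hamiltonian
  have exp: "has_pd c (\<lambda>z. exp (- \<beta> * H z)) (\<lambda>z. exp (- \<beta> * H z) * (- \<beta>) * pd c H z)"
    by (rule has_pd_compose[of "\<lambda>y. exp (- \<beta> * y)" "\<lambda>y. exp (- \<beta> * y) * (- \<beta>)", OF _ has_pd_pol[OF H]])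
       (auto intro!: derivative_eq_intros)
  have G: "has_pd c (\<lambda>z. g z * exp (- \<beta> * H z)) (\<lambda>z. (pd c g z - \<beta> * (pd c H z * g z)) * exp (- \<beta> * H z))" if "poly g" for g
  proof -
    have "has_pd c (\<lambda>z. g z * exp (- \<beta> * H z)) (\<lambda>z. pd c g z * exp (- \<beta> * H z) + g z * (exp (- \<beta> * H z) * (- \<beta>) * pd c H z))"
      by (rule has_pd_mult[OF has_pd_pol[OF that] exp])
    also have "(\<lambda>z. pd c g z * exp (- \<beta> * H z) + g z * (exp (- \<beta> * H z) * (- \<beta>) * pd c H z)) =
        (\<lambda>z. (pd c g z - \<beta> * (pd c H z * g z)) * exp (- \<beta> * H z))"
      by (simp add: fun_eq_iff algebra_simps)
    finally show ?thesis .
  qed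
  have p: "poly (\<lambda>z. pd c f z - \<beta> * (pd c H z * f z))" "poly (\<lambda>z. pd c H z * f z)"
    by (intro pol_intros pol_pd[OF f] pol_pd[OF H] f)+
  have "0 = (\<integral>z. (pd c f z - \<beta> * (pd c H z * f z)) * exp (- \<beta> * H z) \<partial>R)"
    by (rule integral_pd_eq_0[OF c G[OF f] G[OF p(1)] integrable_poly_exp[OF f] integrable_poly_exp[OF p(1)], symmetric])
  also have "\<dots> = (\<integral>z. pd c f z * exp (- \<beta> * H z) - \<beta> * (pd c H z * f z * exp (- \<beta> * H z)) \<partial>R)"
    by (simp add: algebra_simps)
  also have "\<dots> = (\<integral>z. pd c f z * exp (- \<beta> * H z) \<partial>R) - \<beta> * (\<integral>z. pd c H z * f z * exp (- \<beta> * H z) \<partial>R)"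
    using integrable_poly_exp[OF pol_pd[OF f, of c]] integrable_poly_exp[OF p(2)]
    by (subst Bochner_Integration.integral_diff) auto
  finally show ?thesis by simp
qed

end


section \<open>Moments of the Gibbs measure\<close>

lemma pd_diff:
  assumes "pol N \<nu> f" "pol N \<nu> g"
  shows "pd c (\<lambda>z. f z - g z) = (\<lambda>z. pd c f z - pd c g z)"
proof -
  have "pd c (\<lambda>z. f z + (-1) * g z) = (\<lambda>z. pd c f z + pd c (\<lambda>z. (-1) * g z) z)"
    using assms by (intro pd_add smooth_pol[where N = N and \<nu> = \<nu>] pol_intros)
  thus ?thesis unfolding pd_cmult[OF smooth_pol[OF assms(2)]] by simp
qed

lemma pd_kop:
  assumes N: "N \<ge> 1" and x: "x \<in> torus N" and f: "\<And>y. y \<in> torus N \<Longrightarrow> pol N \<nu> (f y)"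
  shows "pd c (\<lambda>z. kop N \<omega> \<nu>' (\<lambda>y. f y z) x) = (\<lambda>z. kop N \<omega> \<nu>' (\<lambda>y. pd c (f y) z) x)"
proof -
  let ?p = "\<lambda>j. tadd N x (evec j)" and ?m = "\<lambda>j. tadd N x (- evec j)"
  note fx = f[OF x] and fp = f[OF tadd_in_torus[OF N]]
  have t: "pol N \<nu> (\<lambda>z. f (?p j) z + f (?m j) z - 2 * f x z)" for j
    by (intro pol_intros fx fp)
  have "pd c (\<lambda>z. f (?p j) z + f (?m j) z - 2 * f x z) = (\<lambda>z. pd c (f (?p j)) z + pd c (f (?m j)) z - 2 * pd c (f x) z)" for j
    using pd_diff[of N \<nu> "\<lambda>z. f (?p j) z + f (?m j) z" "\<lambda>z. 2 * f x z" c] pd_add[OF smooth_pol[OF fp] smooth_pol[OF fp]]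
      pd_cmult[OF smooth_pol[OF fx]] by (simp add: pol_intros fx fp)
  hence "pd c (\<lambda>z. \<Sum>j\<in>UNIV. f (?p j) z + f (?m j) z - 2 * f x z) = (\<lambda>z. \<Sum>j\<in>UNIV. pd c (f (?p j)) z + pd c (f (?m j)) z - 2 * pd c (f x) z)"
    using pd_sum[of UNIV N \<nu> "\<lambda>j z. f (?p j) z + f (?m j) z - 2 * f x z" c] t by simp
  hence "pd c (\<lambda>z. \<omega> * (\<Sum>j\<in>UNIV. f (?p j) z + f (?m j) z - 2 * f x z)) =
      (\<lambda>z. \<omega> * (\<Sum>j\<in>UNIV. pd c (f (?p j)) z + pd c (f (?m j)) z - 2 * pd c (f x) z))"
    using pd_cmult[OF smooth_pol[OF pol_sum[of UNIV N \<nu> "\<lambda>j z. f (?p j) z + f (?m j) z - 2 * f x z"]], where a = \<omega> and c = c] t by simp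
  moreover have "pol N \<nu> (\<lambda>z. \<omega> * (\<Sum>j\<in>UNIV. f (?p j) z + f (?m j) z - 2 * f x z))"
    by (intro pol_intros t fx fp)
  ultimately show ?thesis
    using pd_diff[of N \<nu> "\<lambda>z. \<nu>' * f x z" "\<lambda>z. \<omega> * (\<Sum>j\<in>UNIV. f (?p j) z + f (?m j) z - 2 * f x z)" c]
      pd_cmult[OF smooth_pol[OF fx], where a = \<nu>' and c = c] pol_mult[OF pol_const[of N \<nu> \<nu>'] fx]
    by (simp add: kop_def)
qed

text \<open>Normalisation enters as a hypothesis because the dynamics provides it:
  \<open>gibbs\<close> is the law of the pinned initial state, see
  \<open>prob_space_gibbs\<close>.\<close>

locale gibbs_chain = chain N m \<omega> \<nu> \<gamma> \<beta> for N and m :: "('d::finite) site \<Rightarrow> real" and \<omega> \<nu> \<gamma> \<beta> +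
  fixes k :: 'd
  assumes prob_gibbs: "prob_space (gibbs N \<omega> \<nu> \<beta> :: 'd conf measure)"
begin

abbreviation "\<mu> \<equiv> gibbs N \<omega> \<nu> \<beta> :: 'd conf measure"
abbreviation "E f \<equiv> (\<integral>z. f z \<partial>\<mu>)"
abbreviation "J \<equiv> current N m \<omega> k"
abbreviation "s x \<equiv> 1 / sqrt (m x)"
abbreviation "T \<equiv> 1 / \<beta>"
abbreviation "sp x \<equiv> tadd N x (evec k)"
abbreviation "sm x \<equiv> tadd N x (- evec k)"

definition "partition_fn = (\<integral>z. exp (- \<beta> * H z) \<partial>R)"

lemma gibbs_eq: "\<mu> = density R (\<lambda>z. ennreal (exp (- \<beta> * H z) / partition_fn))"
  by (simp add: gibbs_def partition_fn_def)

lemma measurable_exp_H: "(\<lambda>z. exp (- \<beta> * H z) / partition_fn) \<in> borel_measurable R"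
  using measurable_pol[OF N1 poly_hamiltonian] by (simp cong: measurable_cong_sets add: sets_ref_measure)

lemma partition_fn_pos: "partition_fn > 0"
proof -
  have "partition_fn \<ge> 0" by (simp add: partition_fn_def)
  moreover have "partition_fn \<noteq> 0"
  proof
    assume "partition_fn = 0"
    \<comment> \<open>Division by zero gives 0, so the density would vanish identically.\<close>
    hence "emeasure \<mu> (space \<mu>) = 0"
      by (simp add: gibbs_eq emeasure_density)
    thus False using prob_space.emeasure_space_1[OF prob_gibbs] by simp
  qed
  ultimately show ?thesis by simp
qed

lemma
  assumes f: "poly f"
  shows integrable_gibbs: "integrable \<mu> f"
    and gibbs_expectation: "E f = (\<integral>z. f z * exp (- \<beta> * H z) \<partial>R) / partition_fn"
proof -
  have m: "f \<in> borel_measurable R"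
    using measurable_pol[OF N1 f] by (simp cong: measurable_cong_sets add: sets_ref_measure)
  have e: "(exp (- \<beta> * H z) / partition_fn) *\<^sub>R f z = f z * exp (- \<beta> * H z) / partition_fn" for z
    by simp
  have nn: "AE z in R. 0 \<le> exp (- \<beta> * H z) / partition_fn"
    using partition_fn_pos by (simp add: less_imp_le)
  have "integrable R (\<lambda>z. f z * exp (- \<beta> * H z) / partition_fn)"
    by (intro Bochner_Integration.integrable_divide integrable_poly_exp f) 
  thus "integrable \<mu> f"
    unfolding gibbs_eq using integrable_density[OF m measurable_exp_H nn] by (simp add: mult.commute)
  show "E f = (\<integral>z. f z * exp (- \<beta> * H z) \<partial>R) / partition_fn"
    unfolding gibbs_eq integral_density[OF m measurable_exp_H nn] e by simp
qed

lemma E_sum: "(\<And>i. i \<in> I \<Longrightarrow> poly (f i)) \<Longrightarrow> E (\<lambda>z. \<Sum>i\<in>I. f i z) = (\<Sum>i\<in>I. E (f i))"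
  by (intro Bochner_Integration.integral_sum integrable_gibbs)

lemma E_diff: "poly f \<Longrightarrow> poly g \<Longrightarrow> E (\<lambda>z. f z - g z) = E f - E g"
  by (intro Bochner_Integration.integral_diff integrable_gibbs)

lemma E_add: "poly f \<Longrightarrow> poly g \<Longrightarrow> E (\<lambda>z. f z + g z) = E f + E g"
  by (intro Bochner_Integration.integral_add integrable_gibbs)

lemma E_kop:
  assumes x: "x \<in> \<Lambda>" and f: "\<And>y. y \<in> \<Lambda> \<Longrightarrow> poly (f y)"
  shows "E (\<lambda>z. K (\<lambda>y. f y z) x) = K (\<lambda>y. E (f y)) x"
proof -
  note fx = f[OF x] and fp = f[OF tadd_in_torus[OF N1]]
  have t: "E (\<lambda>z. f (tadd N x (evec j)) z + f (tadd N x (- evec j)) z - 2 * f x z) =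
      E (f (tadd N x (evec j))) + E (f (tadd N x (- evec j))) - 2 * E (f x)" for j
    by (subst E_diff, (intro pol_intros fx fp)+, subst E_add, (intro pol_intros fx fp)+) simp
  have "E (\<lambda>z. K (\<lambda>y. f y z) x) = E (\<lambda>z. \<nu> * f x z) - E (\<lambda>z. \<omega> * (\<Sum>j\<in>UNIV. f (tadd N x (evec j)) z + f (tadd N x (- evec j)) z - 2 * f x z))"
    unfolding kop_def by (intro E_diff pol_intros fx fp)
  also have "E (\<lambda>z. \<omega> * (\<Sum>j\<in>UNIV. f (tadd N x (evec j)) z + f (tadd N x (- evec j)) z - 2 * f x z)) =
     \<omega> * (\<Sum>j\<in>UNIV. E (\<lambda>z. f (tadd N x (evec j)) z + f (tadd N x (- evec j)) z - 2 * f x z))"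
    by (subst E_sum[symmetric]) (auto intro!: pol_intros fx fp)
  finally show ?thesis unfolding t by (simp add: kop_def)
qed

lemma gibbs_by_parts:
  assumes "free_coord N \<nu> c" "poly f"
  shows "E (\<lambda>z. pd c H z * f z) = T * E (pd c f)"
proof -
  have "poly (\<lambda>z. pd c H z * f z)" by (intro pol_intros pol_pd poly_hamiltonian assms)
  thus ?thesis
    using integral_by_parts[OF assms] pos
    by (simp add: gibbs_expectation gibbs_expectation[OF pol_pd[OF assms(2), of c]] field_simps)
qed

section \<open>Covariances with the current at time 0\<close>

definition "jmp x i z = r (sp x) i z - r (sm x) i z"

lemma poly_jmp: "poly (jmp x i)"
  unfolding jmp_def[abs_def] by (intro pol_intros tadd_in_torus N1)

lemma pd_jmp:
  "pd (Mom y j) (jmp x i) = (\<lambda>_. 0)"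
  "pd (Pos y j) (jmp x i) = (\<lambda>_. of_bool (sp x = y \<and> i = j) - of_bool (sm x = y \<and> i = j))"
  unfolding jmp_def[abs_def] pd_diff[OF pol_dsp[OF tadd_in_torus[OF N1]] pol_dsp[OF tadd_in_torus[OF N1]]] pd_dsp
  by auto

lemma current_jmp: "J = (\<lambda>z. \<Sum>x\<in>\<Lambda>. \<Sum>i\<in>UNIV. (\<omega> * s x) * (mom x i z * jmp x i z))"
  by (simp add: current_def fun_eq_iff jmp_def dsp_def mom_def inner_vec_def sum_distrib_left sum_divide_distrib case_prod_beta)

lemma current_pr: "J = (\<lambda>z. \<omega> * (\<Sum>x\<in>\<Lambda>. s x * (pr \<nu> x (sp x) z - pr \<nu> x (sm x) z)))"
  by (simp add: current_jmp fun_eq_iff jmp_def pr_def sum_distrib_left sum_subtractf right_diff_distrib mult_ac)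

lemma poly_current: "poly J"
  unfolding current_jmp by (intro pol_intros poly_jmp)

text \<open>Every summand of the current carries a momentum, which is a derivative of the energy.
  Integrating by parts in it differentiates \<open>f\<close> only, since \<open>jmp\<close> does not
  involve momenta.\<close>

lemma E_current:
  assumes f: "poly f"
  shows "E (\<lambda>z. f z * J z) = \<omega> * T * (\<Sum>x\<in>\<Lambda>. s x * (\<Sum>i\<in>UNIV. E (\<lambda>z. pd (Mom x i) f z * jmp x i z)))"
proof -
  have "E (\<lambda>z. f z * J z) = E (\<lambda>z. \<Sum>x\<in>\<Lambda>. \<Sum>i\<in>UNIV. (\<omega> * s x) * (mom x i z * (f z * jmp x i z)))"
    by (simp add: current_jmp sum_distrib_left mult_ac)
  also have "\<dots> = (\<Sum>x\<in>\<Lambda>. \<Sum>i\<in>UNIV. (\<omega> * s x) * E (\<lambda>z. mom x i z * (f z * jmp x i z)))"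
    by (subst E_sum, (intro pol_intros poly_jmp f; assumption), intro sum.cong refl, subst E_sum,
        intro pol_intros poly_jmp f) auto
  also have "\<dots> = (\<Sum>x\<in>\<Lambda>. \<Sum>i\<in>UNIV. (\<omega> * s x) * (T * E (\<lambda>z. pd (Mom x i) f z * jmp x i z)))"
  proof (intro sum.cong refl arg_cong2[of _ _ _ _ "(*)"])
    fix x :: "'d site" and i assume x: "x \<in> \<Lambda>"
    have "E (\<lambda>z. pd (Mom x i) H z * (f z * jmp x i z)) = T * E (pd (Mom x i) (\<lambda>z. f z * jmp x i z))"
      using x by (intro gibbs_by_parts pol_intros poly_jmp f) simp
    thus "E (\<lambda>z. mom x i z * (f z * jmp x i z)) = T * E (\<lambda>z. pd (Mom x i) f z * jmp x i z)"
      by (simp add: pd_hamiltonian[OF x] pd_mult[OF smooth_pol[OF f] smooth_pol[OF poly_jmp]] pd_jmp)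
  qed
  finally show ?thesis by (simp add: sum_distrib_left mult_ac)
qed

lemma E_rr_current:
  assumes "x \<in> \<Lambda>" "y \<in> \<Lambda>"
  shows "E (\<lambda>z. rr \<nu> x y z * J z) = 0"
proof -
  have "pd (Mom w j) (rr \<nu> x y) = (\<lambda>_. 0)" for w j
    unfolding rr_def[abs_def]
    by (subst pd_sum[where N = N and \<nu> = \<nu>])
       (simp_all add: pol_intros assms pd_mult[OF smooth_pol[OF pol_dsp[OF assms(1)]] smooth_pol[OF pol_dsp[OF assms(2)]]] pd_dsp)
  thus ?thesis by (simp add: E_current[OF pol_rr[OF assms]])
qed

lemma E_mom_jmp: "x \<in> \<Lambda> \<Longrightarrow> E (\<lambda>z. mom x i z * jmp y j z) = 0"
  using gibbs_by_parts[of "Mom x i" "jmp y j"] poly_jmp by (simp add: pd_hamiltonian pd_jmp)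

text \<open>One integration by parts leaves a single momentum times a displacement, of mean zero.
  With \<open>E_rr_current\<close> this explains why only the equation for \<open>b\<close> has a
  source.\<close>

lemma E_pp_current:
  assumes x: "x \<in> \<Lambda>" and y: "y \<in> \<Lambda>"
  shows "E (\<lambda>z. pp x y z * J z) = 0"
proof -
  have "E (\<lambda>z. pd (Mom w j) (pp x y) z * jmp w j z) = 0" for w j
  proof -
    have "pd (Mom w j) (pp x y) = (\<lambda>z. \<Sum>i\<in>UNIV. of_bool (x = w \<and> i = j) * mom y i z + mom x i z * of_bool (y = w \<and> i = j))"
      unfolding pp_def[abs_def]
      by (subst pd_sum[where N = N and \<nu> = \<nu>])
         (simp_all add: pol_intros assms pd_mult[OF smooth_pol[OF pol_mom[OF x]] smooth_pol[OF pol_mom[OF y]]] pd_mom)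
    hence "E (\<lambda>z. pd (Mom w j) (pp x y) z * jmp w j z) =
       E (\<lambda>z. \<Sum>i\<in>UNIV. of_bool (x = w \<and> i = j) * (mom y i z * jmp w j z) + of_bool (y = w \<and> i = j) * (mom x i z * jmp w j z))"
      by (simp add: sum_distrib_right sum_distrib_left algebra_simps)
    also have "\<dots> = (\<Sum>i\<in>UNIV. of_bool (x = w \<and> i = j) * E (\<lambda>z. mom y i z * jmp w j z) + of_bool (y = w \<and> i = j) * E (\<lambda>z. mom x i z * jmp w j z))"
      by (subst E_sum, intro pol_intros poly_jmp x y, intro sum.cong refl, subst E_add,
          (intro pol_intros poly_jmp x y)+) simp
    also have "\<dots> = 0" by (simp add: E_mom_jmp x y)
    finally show ?thesis .
  qed
  thus ?thesis by (simp add: E_current[OF pol_pp[OF assms]])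
qed

definition "current_cov x y = E (\<lambda>z. pr \<nu> x y z * J z)"

lemma current_cov_eq:
  assumes x: "x \<in> \<Lambda>" and y: "y \<in> \<Lambda>"
  shows "current_cov x y = \<omega> * T * s x * (\<Sum>i\<in>UNIV. E (\<lambda>z. r y i z * jmp x i z))"
proof -
  have "pd (Mom w j) (pr \<nu> x y) = (\<lambda>z. \<Sum>i\<in>UNIV. of_bool (j = i) * (of_bool (x = w) * r y i z))" for w j
    unfolding pr_def[abs_def]
    by (subst pd_sum[where N = N and \<nu> = \<nu>])
       (auto simp: pol_intros assms pd_mult[OF smooth_pol[OF pol_mom[OF x]] smooth_pol[OF pol_dsp[OF y]]] pd_mom pd_dsp fun_eq_iff intro!: sum.cong)
  hence pd: "pd (Mom w j) (pr \<nu> x y) = (\<lambda>z. of_bool (x = w) * r y j z)" for w j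
    by (simp only: sum_of_bool_eq[OF finite]) simp
  have "current_cov x y = \<omega> * T * (\<Sum>w\<in>\<Lambda>. of_bool (x = w) * (s w * (\<Sum>i\<in>UNIV. E (\<lambda>z. r y i z * jmp w i z))))"
    unfolding current_cov_def E_current[OF pol_pr[OF assms]] pd
  proof (intro arg_cong[of _ _ "(*) (\<omega> * T)"] sum.cong refl)
    fix w :: "'d site"
    show "s w * (\<Sum>i\<in>UNIV. E (\<lambda>z. of_bool (x = w) * r y i z * jmp w i z)) =
        of_bool (x = w) * (s w * (\<Sum>i\<in>UNIV. E (\<lambda>z. r y i z * jmp w i z)))"
      by (cases "x = w") simp_all
  qed
  thus ?thesis using x by (simp only: sum_of_bool_eq[OF finite_torus]) simp
qed

lemma poly_K_r: "w \<in> \<Lambda> \<Longrightarrow> poly (\<lambda>z. K (\<lambda>y. r y i z) w)"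
  by (intro pol_kop N1 pol_intros)

text \<open>The force is a derivative of the energy, and integrating it by parts differentiates
  \<open>jmp\<close>. This replaces the explicit covariance \<open>T\<close> times the inverse of
  \<open>K\<close>, which is never constructed.\<close>

lemma E_force_jmp_free:
  assumes w: "w \<in> \<Lambda>" "\<not> (\<nu> = 0 \<and> w = 0)"
  shows "E (\<lambda>z. K (\<lambda>y. r y i z) w * jmp x i z) = T * (of_bool (w = sp x) - of_bool (w = sm x))"
proof -
  interpret prob_space \<mu> by (rule prob_gibbs)
  have "E (\<lambda>z. pd (Pos w i) H z * jmp x i z) = T * E (pd (Pos w i) (jmp x i))"
    using w by (intro gibbs_by_parts poly_jmp) auto
  thus ?thesis by (simp add: pd_hamiltonian w pd_jmp prob_space eq_commute)
qed

text \<open>The pinned site is reached by subtraction: both sides sum to zero over the torus, the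
  left one because the total force vanishes for \<open>\<nu> = 0\<close>, and they agree at all
  other sites.\<close>

lemma E_force_jmp:
  assumes w: "w \<in> \<Lambda>" and x: "x \<in> \<Lambda>"
  shows "E (\<lambda>z. K (\<lambda>y. r y i z) w * jmp x i z) = T * (of_bool (w = sp x) - of_bool (w = sm x))"
proof (cases "\<nu> = 0 \<and> w = 0")
  case False
  thus ?thesis by (rule E_force_jmp_free[OF w])
next
  case True
  let ?e = "\<lambda>w. E (\<lambda>z. K (\<lambda>y. r y i z) w * jmp x i z)" and ?b = "\<lambda>w. T * (of_bool (w = sp x) - of_bool (w = sm x))"
  have "(\<Sum>w\<in>\<Lambda>. ?e w) = E (\<lambda>z. \<Sum>w\<in>\<Lambda>. K (\<lambda>y. r y i z) w * jmp x i z)"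
    by (intro E_sum[symmetric] pol_mult poly_K_r poly_jmp)
  also have "\<dots> = 0"
    by (simp only: sum_distrib_right[symmetric] sum_kop[OF N1]) (use True in simp)
  finally have 1: "?e 0 = - (\<Sum>w\<in>\<Lambda> - {0}. ?e w)"
    using sum.remove[OF finite_torus zero_in_torus[OF N1], where g = ?e] by simp
  have "(\<Sum>w\<in>\<Lambda>. ?b w) = 0"
  proof -
    have "(\<Sum>w\<in>\<Lambda>. of_bool (w = v)) = (1::real)" if "v \<in> \<Lambda>" for v
      using sum_of_bool_eq[OF finite_torus, of v "\<lambda>_. 1"] that by (simp add: eq_commute)
    thus ?thesis unfolding sum_distrib_left[symmetric] sum_subtractf by (simp add: tadd_in_torus[OF N1])
  qed
  hence 2: "?b 0 = - (\<Sum>w\<in>\<Lambda> - {0}. ?b w)"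
    using sum.remove[OF finite_torus zero_in_torus[OF N1], where g = ?b] by simp
  have "(\<Sum>w\<in>\<Lambda> - {0}. ?e w) = (\<Sum>w\<in>\<Lambda> - {0}. ?b w)"
    by (intro sum.cong refl E_force_jmp_free) auto
  thus ?thesis using 1 2 True by simp
qed

text \<open>After integration by parts the constant is the diagonal entry of \<open>K\<close>; here
  the neighbours of \<open>w\<close> must differ from \<open>w\<close>.\<close>

lemma E_force_square:
  assumes w: "w \<in> \<Lambda>" "\<not> (\<nu> = 0 \<and> w = 0)"
  shows "E (\<lambda>z. (K (\<lambda>y. r y i z) w)\<^sup>2) = T * (\<nu> + 2 * real CARD('d) * \<omega>)"
proof -
  interpret prob_space \<mu> by (rule prob_gibbs)
  have "pd (Pos w i) (\<lambda>z. K (\<lambda>y. r y i z) w) = (\<lambda>z. K (\<lambda>y. of_bool (y = w) - pinned \<nu> * of_bool (0 = w)) w)"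
    using pd_kop[OF N1 w(1), of \<nu> "\<lambda>y. r y i" "Pos w i" \<omega> \<nu>] by (simp add: pol_intros pd_dsp)
  also have "\<dots> = (\<lambda>z. \<nu> + 2 * real CARD('d) * \<omega>)"
  proof -
    have "pinned \<nu> * of_bool (0 = w) = 0" using w by (auto simp: pinned_def)
    thus ?thesis unfolding \<open>pinned \<nu> * of_bool (0 = w) = 0\<close>
      using tadd_evec_neq[OF N2 w(1)] by (simp add: kop_def mult_ac)
  qed
  finally have pd: "pd (Pos w i) (\<lambda>z. K (\<lambda>y. r y i z) w) = (\<lambda>z. \<nu> + 2 * real CARD('d) * \<omega>)" .
  have "E (\<lambda>z. pd (Pos w i) H z * K (\<lambda>y. r y i z) w) = T * E (pd (Pos w i) (\<lambda>z. K (\<lambda>y. r y i z) w))"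
    using w by (intro gibbs_by_parts poly_K_r) auto
  thus ?thesis by (simp add: pd pd_hamiltonian w prob_space power2_eq_square)
qed

text \<open>A bound of Cramer-Rao type: the covariance of \<open>jmp\<close> with the force at one
  neighbour of \<open>x\<close> is \<open>T\<close> up to sign and the force has second moment
  \<open>T * V\<close>, so Cauchy-Schwarz gives \<open>T / V\<close>, uniformly in
  \<open>N\<close>.\<close>

lemma E_jmp_square_ge:
  assumes x: "x \<in> \<Lambda>"
  shows "E (\<lambda>z. (jmp x i z)\<^sup>2) \<ge> T / (\<nu> + 2 * real CARD('d) * \<omega>)"
proof -
  define V where "V = \<nu> + 2 * real CARD('d) * \<omega>"
  have V: "V > 0" using pos by (simp add: V_def add_nonneg_pos)
  have ne: "sp x \<noteq> sm x" using tadd_evec_neq_minus[OF N] .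
  \<comment> \<open>The two neighbours are distinct, so at least one of them is not the pinned
    site.\<close>
  have "\<exists>w\<in>\<Lambda>. \<not> (\<nu> = 0 \<and> w = 0) \<and> (of_bool (w = sp x) - of_bool (w = sm x) :: real)\<^sup>2 = 1"
  proof (cases "sp x = 0")
    case True
    thus ?thesis using ne tadd_in_torus[OF N1] by (intro bexI[of _ "sm x"]) auto
  next
    case False
    thus ?thesis using ne tadd_in_torus[OF N1] by (intro bexI[of _ "sp x"]) auto
  qed
  then obtain w e where w: "w \<in> \<Lambda>" "\<not> (\<nu> = 0 \<and> w = 0)" and e: "e = of_bool (w = sp x) - of_bool (w = sm x)" "e\<^sup>2 = (1::real)"
    by blast
  let ?F = "\<lambda>z. K (\<lambda>y. r y i z) w"
  note p = poly_K_r[OF w(1), of i] poly_jmp[of x i]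
  \<comment> \<open>The coefficient \<open>e / V\<close> is that of the linear regression of
    \<open>jmp\<close> on the force.\<close>
  have "0 \<le> E (\<lambda>z. (jmp x i z - (e / V) * ?F z)\<^sup>2)" by simp
  also have "\<dots> = E (\<lambda>z. (jmp x i z)\<^sup>2 - ((2 * e / V) * (?F z * jmp x i z) - (e\<^sup>2 / V\<^sup>2) * (?F z)\<^sup>2))"
    by (intro Bochner_Integration.integral_cong refl) (simp add: power2_diff power_mult_distrib power_divide)
  also have "\<dots> = E (\<lambda>z. (jmp x i z)\<^sup>2) - ((2 * e / V) * E (\<lambda>z. ?F z * jmp x i z) - (e\<^sup>2 / V\<^sup>2) * E (\<lambda>z. (?F z)\<^sup>2))"
    by (subst E_diff, (intro pol_intros p)+, subst E_diff, (intro pol_intros p)+) simp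
  also have "\<dots> = E (\<lambda>z. (jmp x i z)\<^sup>2) - ((2 * e / V) * (T * e) - (e\<^sup>2 / V\<^sup>2) * (T * V))"
    unfolding E_force_jmp_free[OF w] E_force_square[OF w] e(1) V_def ..
  also have "(2 * e / V) * (T * e) - (e\<^sup>2 / V\<^sup>2) * (T * V) = e\<^sup>2 * (T / V)"
    using V by (simp add: power2_eq_square field_simps)
  finally show ?thesis unfolding e(2) V_def by simp
qed

text \<open>One factor \<open>T\<close> comes from integrating the momentum by parts, the other from
  the displacement, and the dimension from the sum over components.\<close>

lemma kop_current_cov:
  assumes x: "x \<in> \<Lambda>" and y: "y \<in> \<Lambda>"
  shows "K (current_cov x) y = \<omega> * (T\<^sup>2 * real CARD('d)) * s x * (of_bool (y = sp x) - of_bool (y = sm x))"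
proof -
  have t: "K (\<lambda>y. E (\<lambda>z. r y i z * jmp x i z)) y = T * (of_bool (y = sp x) - of_bool (y = sm x))" for i
  proof -
    have "K (\<lambda>y. E (\<lambda>z. r y i z * jmp x i z)) y = E (\<lambda>z. K (\<lambda>y. r y i z * jmp x i z) y)"
      by (intro E_kop[symmetric] y pol_intros poly_jmp)
    also have "\<dots> = E (\<lambda>z. K (\<lambda>y. r y i z) y * jmp x i z)"
    proof (intro Bochner_Integration.integral_cong refl)
      fix z
      show "K (\<lambda>y. r y i z * jmp x i z) y = K (\<lambda>y. r y i z) y * jmp x i z"
        using kop_cmult[of N \<omega> \<nu> "jmp x i z" "\<lambda>y. r y i z" y] by (simp add: mult.commute)
    qed
    finally show ?thesis by (simp add: E_force_jmp[OF y x])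
  qed
  have "K (current_cov x) y = K (\<lambda>y. \<omega> * T * s x * (\<Sum>i\<in>UNIV. E (\<lambda>z. r y i z * jmp x i z))) y"
    by (intro kop_cong N1 y current_cov_eq x)
  also have "\<dots> = \<omega> * T * s x * (\<Sum>i\<in>UNIV. K (\<lambda>y. E (\<lambda>z. r y i z * jmp x i z)) y)"
    unfolding kop_cmult by (simp add: kop_sum)
  finally show ?thesis unfolding t by (simp add: power2_eq_square)
qed

text \<open>The difference of the two covariances is a sum of second moments of \<open>jmp\<close>,
  to which the uniform lower bound applies.\<close>

lemma current_cov_jump_ge:
  assumes x: "x \<in> \<Lambda>" and m: "m x > 0"
  shows "current_cov x (sp x) - current_cov x (sm x) \<ge> s x * (\<omega> * T * (real CARD('d) * (T / (\<nu> + 2 * real CARD('d) * \<omega>))))"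
proof -
  have "E (\<lambda>z. r (sp x) i z * jmp x i z) - E (\<lambda>z. r (sm x) i z * jmp x i z) = E (\<lambda>z. (jmp x i z)\<^sup>2)" for i
  proof -
    have "E (\<lambda>z. r (sp x) i z * jmp x i z) - E (\<lambda>z. r (sm x) i z * jmp x i z) = E (\<lambda>z. r (sp x) i z * jmp x i z - r (sm x) i z * jmp x i z)"
      by (intro E_diff[symmetric] pol_intros poly_jmp tadd_in_torus N1)
    also have "(\<lambda>z. r (sp x) i z * jmp x i z - r (sm x) i z * jmp x i z) = (\<lambda>z. (jmp x i z)\<^sup>2)"
      by (simp add: fun_eq_iff jmp_def power2_eq_square algebra_simps)
    finally show ?thesis .
  qed
  hence "current_cov x (sp x) - current_cov x (sm x) = \<omega> * T * s x * (\<Sum>i\<in>UNIV. E (\<lambda>z. (jmp x i z)\<^sup>2))"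
    unfolding current_cov_eq[OF x tadd_in_torus[OF N1]] right_diff_distrib[symmetric] sum_subtractf[symmetric] by simp
  moreover have "real CARD('d) * (T / (\<nu> + 2 * real CARD('d) * \<omega>)) \<le> (\<Sum>i\<in>UNIV. E (\<lambda>z. (jmp x i z)\<^sup>2))"
    using sum_mono[of UNIV "\<lambda>_::'d. T / (\<nu> + 2 * real CARD('d) * \<omega>)" "\<lambda>i. E (\<lambda>z. (jmp x i z)\<^sup>2)"] E_jmp_square_ge[OF x] by simp
  hence "\<omega> * T * s x * (real CARD('d) * (T / (\<nu> + 2 * real CARD('d) * \<omega>))) \<le> \<omega> * T * s x * (\<Sum>i\<in>UNIV. E (\<lambda>z. (jmp x i z)\<^sup>2))"
    using pos m by (intro mult_left_mono) auto
  ultimately show ?thesis by (simp add: mult_ac)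
qed

end


section \<open>Stationary dynamics\<close>

lemma measurable_pin:
  assumes N: "N \<ge> 1"
  shows "pin N \<nu> \<in> phase N \<rightarrow>\<^sub>M phase N"
proof (cases "\<nu> = 0")
  case True
  have "(\<lambda>z. (fst z, \<lambda>x\<in>torus N. snd z x - snd z 0)) \<in> phase N \<rightarrow>\<^sub>M (\<Pi>\<^sub>M x\<in>torus N. borel) \<Otimes>\<^sub>M (\<Pi>\<^sub>M x\<in>torus N. borel)"
  proof (intro measurable_Pair measurable_restrict borel_measurable_diff measurable_coordinate(2) zero_in_torus N)
    show "fst \<in> phase N \<rightarrow>\<^sub>M (\<Pi>\<^sub>M x\<in>torus N. borel)" by (simp add: phase_def)
  qed
  thus ?thesis using True by (simp add: phase_def pin_def case_prod_beta')
next
  case False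
  thus ?thesis by (simp add: pin_def)
qed

text \<open>Polynomials depend only on the class modulo translations, so an arbitrary representative
  \<open>X 0\<close> has the moments of the pinned Gibbs law.\<close>

lemma (in chain) poly_pin: "poly f \<Longrightarrow> f (pin N \<nu> z) = f z"
proof (induction rule: pol.induct)
  case (pol_mom x i)
  show ?case by (cases z) (simp add: mom_def pin_def)
next
  case (pol_dsp x i)
  thus ?case using zero_in_torus[OF N1] by (cases z) (auto simp: dsp_def pin_def pinned_def)
qed auto

lemma prob_space_gibbs:
  fixes X :: "real \<Rightarrow> 'w \<Rightarrow> ('d::finite) conf"
  assumes N: "N \<ge> 1" and dyn: "stationary_dynamics N m \<omega> \<nu> \<gamma> \<beta> M X"
  shows "prob_space (gibbs N \<omega> \<nu> \<beta> :: 'd conf measure)"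
proof -
  have *: "prob_space M" "X 0 \<in> M \<rightarrow>\<^sub>M phase N" "distr M (phase N) (\<lambda>w. pin N \<nu> (X 0 w)) = gibbs N \<omega> \<nu> \<beta>"
    using dyn by (auto simp: stationary_dynamics_def)
  show ?thesis
    unfolding *(3)[symmetric]
    by (intro prob_space.prob_space_distr *(1) measurable_compose[OF *(2) measurable_pin[OF N]])
qed

text \<open>Paths are only constrained for nonnegative times, hence the clipping \<open>max 0 t\<close>.\<close>

lemma borel_measurable_joint:
  fixes \<phi> :: "real \<Rightarrow> 'w \<Rightarrow> real"
  assumes meas: "\<And>t. t \<ge> 0 \<Longrightarrow> \<phi> t \<in> borel_measurable M"
    and cont: "\<And>w. w \<in> space M \<Longrightarrow> continuous_on {0..} (\<lambda>t. \<phi> t w)"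
  shows "(\<lambda>(t, w). \<phi> (max 0 t) w) \<in> borel_measurable (lborel \<Otimes>\<^sub>M M)"
proof -
  \<comment> \<open>Times are rounded down to multiples of \<open>1 / (n + 1)\<close>: the
    approximants depend on countably many times, hence are jointly measurable, and converge by
    continuity of the paths.\<close>
  define a where "a n t = real (nat \<lfloor>real (Suc n) * max 0 t\<rfloor>) / real (Suc n)" for n and t :: real
  have a0: "a n t \<ge> 0" for n t by (simp add: a_def)
  have "(\<lambda>n. a n t) \<longlonglongrightarrow> max 0 t" for t
  proof -
    have b: "a n t \<le> max 0 t" "max 0 t - 1 / real (Suc n) \<le> a n t" for n
    proof -
      let ?x = "real (Suc n) * max 0 t"
      have x: "?x \<ge> 0" by simp
      have "real (nat \<lfloor>?x\<rfloor>) = of_int \<lfloor>?x\<rfloor>" using x by simp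
      hence "real (nat \<lfloor>?x\<rfloor>) \<le> ?x" "?x - 1 \<le> real (nat \<lfloor>?x\<rfloor>)" by linarith+
      hence "real (nat \<lfloor>?x\<rfloor>) / real (Suc n) \<le> ?x / real (Suc n)" "(?x - 1) / real (Suc n) \<le> real (nat \<lfloor>?x\<rfloor>) / real (Suc n)"
        by (intro divide_right_mono; simp)+
      thus "a n t \<le> max 0 t" "max 0 t - 1 / real (Suc n) \<le> a n t"
        unfolding a_def diff_divide_distrib by simp_all
    qed
    have "(\<lambda>n. max 0 t - 1 / real (Suc n)) \<longlonglongrightarrow> max 0 t - 0"
      by (intro tendsto_intros LIMSEQ_Suc lim_1_over_n)
    hence lim: "(\<lambda>n. max 0 t - 1 / real (Suc n)) \<longlonglongrightarrow> max 0 t" by (simp only: diff_zero)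
    show ?thesis
      by (rule tendsto_sandwich[OF always_eventually[OF allI[OF b(2)]] always_eventually[OF allI[OF b(1)]] lim tendsto_const])
  qed note a = this
  show ?thesis
  proof (rule borel_measurable_LIMSEQ_real[where u = "\<lambda>n (t, w). \<phi> (a n t) w"])
    fix tw assume "tw \<in> space ((lborel :: real measure) \<Otimes>\<^sub>M M)"
    then obtain t w where tw: "tw = (t, w)" "w \<in> space M" by (auto simp: space_pair_measure)
    have "(\<lambda>n. \<phi> (a n t) w) \<longlonglongrightarrow> \<phi> (max 0 t) w"
      by (rule continuous_on_tendsto_compose[OF cont[OF tw(2)] a]) (use a0 in auto)
    thus "(\<lambda>n. (\<lambda>(t, w). \<phi> (a n t) w) tw) \<longlonglongrightarrow> (\<lambda>(t, w). \<phi> (max 0 t) w) tw" by (simp add: tw)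
  next
    fix n
    have "(\<lambda>tw. \<phi> (real (nat \<lfloor>real (Suc n) * max 0 (fst tw)\<rfloor>) / real (Suc n)) (snd tw)) \<in> borel_measurable (lborel \<Otimes>\<^sub>M M)"
    proof (rule measurable_compose_countable[where f = "\<lambda>i tw. \<phi> (real i / real (Suc n)) (snd tw)"
          and g = "\<lambda>tw. nat \<lfloor>real (Suc n) * max 0 (fst tw)\<rfloor>"])
      fix i :: nat
      show "(\<lambda>tw. \<phi> (real i / real (Suc n)) (snd tw)) \<in> borel_measurable ((lborel :: real measure) \<Otimes>\<^sub>M M)"
        by (intro measurable_compose[OF measurable_snd meas]) simp
    qed measurable
    thus "(\<lambda>(t, w). \<phi> (a n t) w) \<in> borel_measurable (lborel \<Otimes>\<^sub>M M)"
      by (simp add: a_def case_prod_beta)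
  qed
qed

text \<open>Meant for observables truncated by the cutoff, which are bounded, so
  \<open>B * Y\<close> on the time interval is an integrable majorant. The same application of
  Fubini supplies measurability of the correlation in time.\<close>

lemma
  fixes \<phi> :: "real \<Rightarrow> 'w \<Rightarrow> real" and Y :: "'w \<Rightarrow> real"
  assumes M: "prob_space M"
    and meas: "\<And>t. t \<ge> 0 \<Longrightarrow> \<phi> t \<in> borel_measurable M"
    and cont: "\<And>w. w \<in> space M \<Longrightarrow> continuous_on {0..} (\<lambda>t. \<phi> t w)"
    and bound: "\<And>t w. t \<ge> 0 \<Longrightarrow> w \<in> space M \<Longrightarrow> \<bar>\<phi> t w\<bar> \<le> B"
    and Y: "integrable M Y"
  shows Fubini_time: "(\<integral>w. Y w * (LBINT u:{0..t}. \<phi> u w) \<partial>M) = (LBINT u:{0..t}. \<integral>w. Y w * \<phi> u w \<partial>M)"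
    and measurable_time: "(\<lambda>u. indicator {0..t} u * (\<integral>w. Y w * \<phi> u w \<partial>M)) \<in> borel_measurable lborel"
    and integrable_time: "integrable M (\<lambda>w. Y w * (LBINT u:{0..t}. \<phi> u w))"
proof -
  interpret prob_space M by (rule M)
  interpret pair_sigma_finite "lborel :: real measure" M ..
  let ?F = "\<lambda>(u, w). indicator {0..t} u * (Y w * \<phi> (max 0 u) w)"
  have j[measurable]: "(\<lambda>tw. \<phi> (max 0 (fst tw)) (snd tw)) \<in> borel_measurable (lborel \<Otimes>\<^sub>M M)"
    using borel_measurable_joint[OF meas cont] by (simp add: case_prod_beta)
  have [measurable]: "Y \<in> borel_measurable M" using Y by auto
  have mF[measurable]: "?F \<in> borel_measurable (lborel \<Otimes>\<^sub>M M)"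
    unfolding case_prod_beta by measurable
  have iY: "integrable M (\<lambda>w. Y w * \<phi> (max 0 u) w)" for u
  proof (rule Bochner_Integration.integrable_bound)
    show "integrable M (\<lambda>w. B * Y w)" using Y by simp
    show "AE w in M. norm (Y w * \<phi> (max 0 u) w) \<le> norm (B * Y w)"
    proof (intro AE_I2)
      fix w assume "w \<in> space M"
      hence "\<bar>\<phi> (max 0 u) w\<bar> \<le> \<bar>B\<bar>" using bound[of "max 0 u" w] by simp
      hence "\<bar>Y w\<bar> * \<bar>\<phi> (max 0 u) w\<bar> \<le> \<bar>Y w\<bar> * \<bar>B\<bar>" by (rule mult_left_mono) simp
      thus "norm (Y w * \<phi> (max 0 u) w) \<le> norm (B * Y w)" by (simp add: abs_mult mult.commute)
    qed
    show "(\<lambda>w. Y w * \<phi> (max 0 u) w) \<in> borel_measurable M" using meas[of "max 0 u"] by simp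
  qed
  have intF: "integrable (lborel \<Otimes>\<^sub>M M) ?F"
  proof (rule Bochner_Integration.integrable_bound)
    have "integrable (lborel \<Otimes>\<^sub>M M) (\<lambda>(u, w). indicator {0..t} u *\<^sub>R (B * Y w))"
    proof (rule Fubini_integrable)
      have "(\<integral>w. norm (indicator {0..t} u *\<^sub>R (B * Y w)) \<partial>M) = indicator {0..t} u *\<^sub>R (\<integral>w. \<bar>B * Y w\<bar> \<partial>M)" for u
        by (auto split: split_indicator)
      moreover have "integrable lborel (\<lambda>u. indicator {0..t} u *\<^sub>R (\<integral>w. \<bar>B * Y w\<bar> \<partial>M))"
        by (intro integrable_real_indicator integrable_scaleR_left) (auto simp: emeasure_lborel_Icc_eq)
      ultimately show "integrable lborel (\<lambda>u. \<integral>w. norm ((\<lambda>(u, w). indicator {0..t} u *\<^sub>R (B * Y w)) (u, w)) \<partial>M)" by simp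
    qed (use Y in auto)
    thus "integrable (lborel \<Otimes>\<^sub>M M) (\<lambda>(u, w). indicator {0..t} u *\<^sub>R (B * Y w))" .
    show "AE uw in lborel \<Otimes>\<^sub>M M. norm (?F uw) \<le> norm ((\<lambda>(u, w). indicator {0..t} u *\<^sub>R (B * Y w)) uw)"
    proof (intro AE_I2)
      fix uw assume "uw \<in> space ((lborel :: real measure) \<Otimes>\<^sub>M M)"
      then obtain u w where uw: "uw = (u, w)" "w \<in> space M" by (auto simp: space_pair_measure)
      have "\<bar>\<phi> (max 0 u) w\<bar> \<le> \<bar>B\<bar>" using bound[of "max 0 u" w] uw by simp
      hence "\<bar>Y w\<bar> * \<bar>\<phi> (max 0 u) w\<bar> \<le> \<bar>Y w\<bar> * \<bar>B\<bar>" by (rule mult_left_mono) simp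
      thus "norm (?F uw) \<le> norm ((\<lambda>(u, w). indicator {0..t} u *\<^sub>R (B * Y w)) uw)"
        by (auto simp: uw abs_mult mult.commute split: split_indicator)
    qed
  qed simp
  have u: "(\<integral>w. ?F (u, w) \<partial>M) = indicator {0..t} u * (\<integral>w. Y w * \<phi> u w \<partial>M)" for u
    by (cases "u \<in> {0..t}") auto
  have w: "(\<integral>u. ?F (u, w) \<partial>lborel) = Y w * (LBINT u:{0..t}. \<phi> u w)" for w
  proof -
    have "(\<integral>u. ?F (u, w) \<partial>lborel) = (\<integral>u. Y w * (indicator {0..t} u *\<^sub>R \<phi> u w) \<partial>lborel)"
      by (intro Bochner_Integration.integral_cong refl) (auto split: split_indicator)
    thus ?thesis by (simp add: set_lebesgue_integral_def)
  qed
  show "(\<integral>w. Y w * (LBINT u:{0..t}. \<phi> u w) \<partial>M) = (LBINT u:{0..t}. \<integral>w. Y w * \<phi> u w \<partial>M)"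
    using Fubini_integral[of "\<lambda>u w. ?F (u, w)"] intF unfolding u w set_lebesgue_integral_def by simp
  show "(\<lambda>u. indicator {0..t} u * (\<integral>w. Y w * \<phi> u w \<partial>M)) \<in> borel_measurable lborel"
    using integrable_fst'[OF intF] unfolding u by auto
  show "integrable M (\<lambda>w. Y w * (LBINT u:{0..t}. \<phi> u w))"
    using integrable_snd[OF intF] unfolding case_prod_beta using w by simp
qed

text \<open>Once the cutoff level exceeds both energies, the cutoff is injective on them.\<close>

lemma cutoff_eq_imp_eq:
  assumes "\<And>k. cutoff 3 (real (Suc k)) a = cutoff 3 (real (Suc k)) b" "a \<ge> 0" "b \<ge> 0"
  shows "a = b"
proof -
  obtain k where k: "max a b < real k" using reals_Archimedean2 by blast
  hence k': "1 - a / real (Suc k) > 0" "1 - b / real (Suc k) > 0" by (auto simp: field_simps)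
  from assms(1)[of k] have "(1 - a / real (Suc k)) ^ 3 = (1 - b / real (Suc k)) ^ 3"
    using k' unfolding cutoff_def by (simp add: max_def)
  hence "1 - a / real (Suc k) = 1 - b / real (Suc k)"
    using k' by (subst (asm) power_eq_iff_eq_base) auto
  thus ?thesis by simp
qed

locale stationary_chain = gibbs_chain N m \<omega> \<nu> \<gamma> \<beta> k for N and m :: "('d::finite) site \<Rightarrow> real" and \<omega> \<nu> \<gamma> \<beta> and k :: 'd +
  fixes M :: "'w measure" and X :: "real \<Rightarrow> 'w \<Rightarrow> 'd conf"
  assumes dyn: "stationary_dynamics N m \<omega> \<nu> \<gamma> \<beta> M X"
begin

abbreviation "L \<equiv> gen_L N m \<omega> \<nu> \<gamma> :: ('d conf \<Rightarrow> real) \<Rightarrow> _"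

lemma prob_M: "prob_space M"
  and measurable_X: "t \<ge> 0 \<Longrightarrow> X t \<in> M \<rightarrow>\<^sub>M phase N"
  and continuous_X: "w \<in> space M \<Longrightarrow> continuous_on {0..} (\<lambda>t. X t w)"
  and law_X: "distr M (phase N) (\<lambda>w. pin N \<nu> (X 0 w)) = \<mu>"
  and martingale_X: "test_fun N \<nu> f \<Longrightarrow> is_martingale M (natural_filtration M (phase N) X)
        (\<lambda>t w. f (X t w) - f (X 0 w) - (LBINT u:{0..t}. L f (X u w)))"
  using dyn by (auto simp: stationary_dynamics_def)

sublocale M: prob_space M by (rule prob_M)

lemma measurable_poly_X: "poly f \<Longrightarrow> t \<ge> 0 \<Longrightarrow> (\<lambda>w. f (X t w)) \<in> borel_measurable M"
  by (intro measurable_compose[OF measurable_X] measurable_pol N1)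

lemma continuous_poly_X: "poly f \<Longrightarrow> w \<in> space M \<Longrightarrow> continuous_on {0..} (\<lambda>t. f (X t w))"
  by (rule continuous_on_compose2[OF continuous_on_pol[of N \<nu> f UNIV] continuous_X]) auto

lemma
  assumes f: "poly f"
  shows integral_X0: "(\<integral>w. f (X 0 w) \<partial>M) = E f"
    and integrable_X0: "integrable M (\<lambda>w. f (X 0 w))"
proof -
  have m: "(\<lambda>w. pin N \<nu> (X 0 w)) \<in> M \<rightarrow>\<^sub>M phase N"
    by (intro measurable_compose[OF measurable_X measurable_pin] N1) simp
  have mf: "f \<in> borel_measurable (phase N)" by (rule measurable_pol[OF N1 f])
  show "(\<integral>w. f (X 0 w) \<partial>M) = E f"
    using integral_distr[OF m mf] by (simp add: law_X poly_pin[OF f])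
  show "integrable M (\<lambda>w. f (X 0 w))"
    using integrable_distr_eq[OF m mf] integrable_gibbs[OF f] by (simp add: law_X poly_pin[OF f])
qed

text \<open>The martingale is 0 at time 0, so its conditional expectation given the initial
  sigma-algebra vanishes, and \<open>Y (X 0 w)\<close> may be pulled through the
  conditioning.\<close>

lemma martingale_orthogonal:
  assumes f: "test_fun N \<nu> f" and Y: "Y \<in> borel_measurable (phase N)" and t: "t \<ge> 0"
    and int: "integrable M (\<lambda>w. Y (X 0 w) * (f (X t w) - f (X 0 w) - (LBINT u:{0..t}. L f (X u w))))"
  shows "(\<integral>w. Y (X 0 w) * (f (X t w) - f (X 0 w) - (LBINT u:{0..t}. L f (X u w))) \<partial>M) = 0"
proof -
  let ?F = "natural_filtration M (phase N) X 0"
  let ?Z = "\<lambda>t w. f (X t w) - f (X 0 w) - (LBINT u:{0..t}. L f (X u w))"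
  have gen: "{X u -` B \<inter> space M |u B. 0 \<le> u \<and> u \<le> 0 \<and> B \<in> sets (phase N)} \<subseteq> sets M"
    using measurable_sets[OF measurable_X] by auto
  have sub: "subalgebra M ?F"
    using sets.sigma_sets_subset[OF gen] sets.space_closed
    by (auto simp: subalgebra_def natural_filtration_def space_measure_of_conv sets_measure_of_conv)
  interpret finite_measure_subalgebra M ?F
    by standard (rule sub)
  have X0: "X 0 \<in> ?F \<rightarrow>\<^sub>M phase N"
  proof (rule measurableI)
    fix w assume "w \<in> space ?F"
    thus "X 0 w \<in> space (phase N)"
      using measurable_space[OF measurable_X[of 0]] by (simp add: natural_filtration_def space_measure_of_conv)
  next
    fix B :: "'d conf set" assume B: "B \<in> sets (phase N)"
    have "X 0 -` B \<inter> space M \<in> sets ?F"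
      unfolding natural_filtration_def using gen B sets.space_closed[of M]
      by (subst sets_measure_of) (auto intro!: sigma_sets.Basic)
    thus "X 0 -` B \<inter> space ?F \<in> sets ?F" by (simp add: natural_filtration_def space_measure_of_conv)
  qed
  have Y0: "(\<lambda>w. Y (X 0 w)) \<in> borel_measurable ?F" by (rule measurable_compose[OF X0 Y])
  note mart = martingale_X[OF f, unfolded is_martingale_def]
  have mZ: "?Z t \<in> borel_measurable M" using mart t by auto
  have "(LBINT u:{0..0}. g u) = 0" for g :: "real \<Rightarrow> real"
    unfolding set_lebesgue_integral_def
    by (intro integral_eq_zero_AE eventually_mono[OF AE_lborel_singleton[of 0]]) auto
  hence Z0: "?Z 0 w = 0" for w by simp
  have ce: "AE w in M. real_cond_exp M ?F (?Z t) w = 0"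
    using conjunct2[OF mart, rule_format, of 0 t] t unfolding Z0 by simp
  have "(\<integral>w. Y (X 0 w) * ?Z t w \<partial>M) = (\<integral>w. Y (X 0 w) * real_cond_exp M ?F (?Z t) w \<partial>M)"
    by (rule real_cond_exp_intg(2)[OF int Y0 mZ, symmetric])
  also have "\<dots> = 0" by (rule integral_eq_zero_AE) (use ce in auto)
  finally show ?thesis .
qed

lemma gen_L_const: "L (\<lambda>_. a) = (\<lambda>_. 0)"
  by (simp add: gen_L_def gen_A_def gen_S_def pd_const rot_const fun_eq_iff)

text \<open>Write \<open>a\<close> and \<open>b\<close> for the cutoff of the energy at times
  \<open>t\<close> and 0. Both the cutoff and its square are test functions with vanishing image
  under \<open>L\<close>, so \<open>b * (a - b)\<close> and \<open>a^2 - b^2\<close> have mean zero.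
  Hence so has \<open>(a - b)^2\<close>.\<close>

lemma energy_conserved:
  assumes t: "t \<ge> 0"
  shows "AE w in M. H (X t w) = H (X 0 w)"
proof -
  have mH: "(\<lambda>w. H (X u w)) \<in> borel_measurable M" if "u \<ge> 0" for u
    using measurable_poly_X[OF poly_hamiltonian that] .
  have mc: "cutoff n R \<in> borel_measurable borel" for n R
    by (intro borel_measurable_continuous_onI continuous_on_cutoff)
  have bc: "\<bar>cutoff n R (H z)\<bar> \<le> 1" if "R > 0" for n R z
    using cutoff_nonneg[of n R "H z"] cutoff_le_1[OF that hamiltonian_nonneg, of n z] by simp
  have int: "integrable M (\<lambda>w. g w)" if "g \<in> borel_measurable M" "\<And>w. \<bar>g w\<bar> \<le> 2" for g :: "'w \<Rightarrow> real"
    using that by (intro M.integrable_const_bound[of _ 2]) auto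
  have orth: "(\<integral>w. cutoff j R (H (X 0 w)) * (cutoff (Suc (Suc (Suc n))) R (H (X t w)) - cutoff (Suc (Suc (Suc n))) R (H (X 0 w))) \<partial>M) = 0"
    if R: "R > 0" for n j R
  proof -
    let ?f = "\<lambda>z. 1 * cutoff (Suc (Suc (Suc n))) R (H z)"
    have "L ?f = (\<lambda>_. 0)"
      using gen_L_pol_cutoff[OF pol_const[of N \<nu> 1], of n R] by (simp add: gen_L_const fun_eq_iff)
    hence Z: "(LBINT u:{0..t}. L ?f (X u w)) = 0" for w by (simp add: set_lebesgue_integral_def)
    have "(\<integral>w. cutoff j R (H (X 0 w)) * (?f (X t w) - ?f (X 0 w) - (LBINT u:{0..t}. L ?f (X u w))) \<partial>M) = 0"
    proof (rule martingale_orthogonal[where Y = "\<lambda>z. cutoff j R (H z)"])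
      show "test_fun N \<nu> ?f" by (rule test_fun_pol_cutoff[OF pol_const R])
      show "(\<lambda>z. cutoff j R (H z)) \<in> borel_measurable (phase N)"
        by (intro measurable_compose[OF measurable_pol[OF N1 poly_hamiltonian] mc])
      show "integrable M (\<lambda>w. cutoff j R (H (X 0 w)) * (?f (X t w) - ?f (X 0 w) - (LBINT u:{0..t}. L ?f (X u w))))"
        unfolding Z
      proof (rule int)
        show "(\<lambda>w. cutoff j R (H (X 0 w)) * (?f (X t w) - ?f (X 0 w) - 0)) \<in> borel_measurable M"
          using measurable_compose[OF mH mc] t by auto
        fix w
        have "\<bar>cutoff j R (H (X 0 w))\<bar> * \<bar>?f (X t w) - ?f (X 0 w) - 0\<bar> \<le> 1 * 2"
          using bc[OF R, of j "X 0 w"] bc[OF R, of "Suc (Suc (Suc n))" "X 0 w"] bc[OF R, of "Suc (Suc (Suc n))" "X t w"]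
          by (intro mult_mono) auto
        thus "\<bar>cutoff j R (H (X 0 w)) * (?f (X t w) - ?f (X 0 w) - 0)\<bar> \<le> 2" by (simp add: abs_mult)
      qed
    qed (rule t)
    thus ?thesis unfolding Z by simp
  qed
  have eq: "AE w in M. cutoff 3 R (H (X t w)) = cutoff 3 R (H (X 0 w))" if R: "R > 0" for R
  proof -
    let ?a = "\<lambda>w. cutoff 3 R (H (X t w))" and ?b = "\<lambda>w. cutoff 3 R (H (X 0 w))"
    let ?a6 = "\<lambda>w. cutoff 6 R (H (X t w))" and ?b6 = "\<lambda>w. cutoff 6 R (H (X 0 w))"
    \<comment> \<open>The square of the cutoff is again a cutoff, and thus itself an admissible test
      function.\<close>
    have six: "cutoff 6 R h = (cutoff 3 R h)\<^sup>2" for h by (simp add: cutoff_def power_mult[symmetric])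
    have c0: "cutoff 0 R h = 1" for h by (simp add: cutoff_def)
    have "(\<integral>w. ?b w * (?a w - ?b w) \<partial>M) = 0" using orth[OF R, of 3 0] by (simp add: numeral_3_eq_3)
    moreover have "(\<integral>w. ?a6 w - ?b6 w \<partial>M) = 0" using orth[OF R, of 0 3] by (simp add: c0 numeral_eq_Suc)
    moreover have m: "?a \<in> borel_measurable M" "?b \<in> borel_measurable M" "?a6 \<in> borel_measurable M" "?b6 \<in> borel_measurable M"
      using measurable_compose[OF mH mc] t by auto
    moreover have i1: "integrable M (\<lambda>w. ?b w * (?a w - ?b w))"
    proof (rule int)
      fix w
      have "\<bar>?b w\<bar> * \<bar>?a w - ?b w\<bar> \<le> 1 * 2"
        using bc[OF R, of 3 "X 0 w"] bc[OF R, of 3 "X t w"] by (intro mult_mono) auto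
      thus "\<bar>?b w * (?a w - ?b w)\<bar> \<le> 2" by (simp add: abs_mult)
    qed (use m in measurable)
    moreover have i2: "integrable M (\<lambda>w. ?a6 w - ?b6 w)"
    proof (rule int)
      show "\<bar>?a6 w - ?b6 w\<bar> \<le> 2" for w using bc[OF R, of 6 "X 0 w"] bc[OF R, of 6 "X t w"] by simp
    qed (use m in measurable)
    ultimately have "(\<integral>w. (?a6 w - ?b6 w) - 2 * (?b w * (?a w - ?b w)) \<partial>M) = 0"
      by (subst Bochner_Integration.integral_diff) auto
    also have "(\<lambda>w. (?a6 w - ?b6 w) - 2 * (?b w * (?a w - ?b w))) = (\<lambda>w. (?a w - ?b w)\<^sup>2)"
      unfolding six by (simp add: fun_eq_iff power2_eq_square algebra_simps)
    finally have z: "(\<integral>w. (?a w - ?b w)\<^sup>2 \<partial>M) = 0" .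
    have "integrable M (\<lambda>w. (?a6 w - ?b6 w) - 2 * (?b w * (?a w - ?b w)))" using i1 i2 by auto
    hence "integrable M (\<lambda>w. (?a w - ?b w)\<^sup>2)"
      unfolding six by (simp add: power2_eq_square algebra_simps)
    with z have "AE w in M. (?a w - ?b w)\<^sup>2 = 0"
      by (subst (asm) integral_nonneg_eq_0_iff_AE) auto
    thus ?thesis by eventually_elim simp
  qed
  \<comment> \<open>Countably many levels suffice, so the exceptional null sets can be united before
    the energies are compared.\<close>
  have "AE w in M. \<forall>j. cutoff 3 (real (Suc j)) (H (X t w)) = cutoff 3 (real (Suc j)) (H (X 0 w))"
    unfolding AE_all_countable using eq by simp
  thus ?thesis by eventually_elim (rule cutoff_eq_imp_eq, auto intro: hamiltonian_nonneg)
qed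

text \<open>By conservation of energy the majorant is a polynomial of the initial state, the same
  for all times; its integrability is that of the Gibbs measure.\<close>

lemma poly_product_bound:
  assumes f: "poly f" and g: "poly g"
  obtains h where "poly h" "\<And>z. h z \<ge> 0" "\<And>t. t \<ge> 0 \<Longrightarrow> AE w in M. \<bar>g (X 0 w) * f (X t w)\<bar> \<le> h (X 0 w)"
proof -
  obtain C a D b where *: "C \<ge> 0" "\<And>z. \<bar>f z\<bar> \<le> C * (1 + H z) ^ a" "D \<ge> 0" "\<And>z. \<bar>g z\<bar> \<le> D * (1 + H z) ^ b"
    using poly_bound[OF f] poly_bound[OF g] by blast
  define h where "h z = (D * (1 + H z) ^ b) * (C * (1 + H z) ^ a)" for z
  have "AE w in M. \<bar>g (X 0 w) * f (X t w)\<bar> \<le> h (X 0 w)" if "t \<ge> 0" for t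
    using energy_conserved[OF that]
  proof eventually_elim
    case (elim w)
    have "\<bar>g (X 0 w)\<bar> * \<bar>f (X t w)\<bar> \<le> (D * (1 + H (X 0 w)) ^ b) * (C * (1 + H (X t w)) ^ a)"
      using * hamiltonian_nonneg[of "X 0 w"] by (intro mult_mono) auto
    thus ?case unfolding h_def elim abs_mult .
  qed
  moreover have "poly h" unfolding h_def[abs_def] by (intro pol_intros poly_hamiltonian)
  moreover have "h z \<ge> 0" for z unfolding h_def using * hamiltonian_nonneg[of z] by simp
  ultimately show ?thesis using that by blast
qed

section \<open>Correlations with the initial current and Dynkin's formula\<close>

definition "corr f t = (\<integral>w. J (X 0 w) * f (X t w) \<partial>M)"

lemma integrable_corr:
  assumes f: "poly f" and t: "t \<ge> 0"
  shows "integrable M (\<lambda>w. J (X 0 w) * f (X t w))"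
proof -
  obtain h where h: "poly h" "\<And>z. h z \<ge> 0" "\<And>t. t \<ge> 0 \<Longrightarrow> AE w in M. \<bar>J (X 0 w) * f (X t w)\<bar> \<le> h (X 0 w)"
    using poly_product_bound[OF f poly_current] by blast
  show ?thesis
  proof (rule Bochner_Integration.integrable_bound[OF integrable_X0[OF h(1)]])
    show "(\<lambda>w. J (X 0 w) * f (X t w)) \<in> borel_measurable M"
      using measurable_poly_X[OF f t] measurable_poly_X[OF poly_current, of 0] by simp
    show "AE w in M. norm (J (X 0 w) * f (X t w)) \<le> norm (h (X 0 w))"
      using h(3)[OF t] by eventually_elim (use h(2) in auto)
  qed
qed

lemma corr_bound:
  assumes f: "poly f"
  shows "\<exists>B. \<forall>t\<ge>0. \<bar>corr f t\<bar> \<le> B"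
proof -
  obtain h where h: "poly h" "\<And>z. h z \<ge> 0" "\<And>t. t \<ge> 0 \<Longrightarrow> AE w in M. \<bar>J (X 0 w) * f (X t w)\<bar> \<le> h (X 0 w)"
    using poly_product_bound[OF f poly_current] by blast
  have "\<bar>corr f t\<bar> \<le> (\<integral>w. h (X 0 w) \<partial>M)" if t: "t \<ge> 0" for t
  proof -
    have "\<bar>corr f t\<bar> \<le> (\<integral>w. \<bar>J (X 0 w) * f (X t w)\<bar> \<partial>M)" unfolding corr_def by (rule integral_abs_bound)
    also have "\<dots> \<le> (\<integral>w. h (X 0 w) \<partial>M)"
      by (intro integral_mono_AE integrable_abs integrable_corr f t integrable_X0 h)
    finally show ?thesis .
  qed
  thus ?thesis by blast
qed

lemma corr_0: "poly f \<Longrightarrow> corr f 0 = E (\<lambda>z. f z * J z)"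
  using integral_X0[of "\<lambda>z. J z * f z"] poly_current unfolding corr_def by (simp add: pol_mult mult.commute)

lemma corr_add: "poly f \<Longrightarrow> poly g \<Longrightarrow> t \<ge> 0 \<Longrightarrow> corr (\<lambda>z. f z + g z) t = corr f t + corr g t"
  unfolding corr_def distrib_left by (intro Bochner_Integration.integral_add integrable_corr)

lemma corr_cmult: "corr (\<lambda>z. a * f z) t = a * corr f t"
  unfolding corr_def by (subst integral_mult_right_zero[symmetric]) (simp add: mult_ac)

text \<open>Dynkin's formula: the cutoff commutes with the generator, and by conservation of energy it can be removed
  by dominated convergence.\<close>

lemma dynkin:
  assumes f: "poly f" and t: "t \<ge> 0"
  shows "corr f t = corr f 0 + (LBINT u:{0..t}. corr (L f) u)"
    and "(\<lambda>u. indicator {0..t} u * corr (L f) u) \<in> borel_measurable lborel"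
proof -
  let ?c = "\<lambda>n z. cutoff 3 (real (Suc n)) (H z)"
  note Lf = poly_gen_L[OF f]
  \<comment> \<open>The correlation truncated at energy level \<open>n + 1\<close>; the limit
    \<open>n\<close> to infinity is taken on both sides of the truncated identity
    \<open>eq\<close>.\<close>
  define A where "A n g u = (\<integral>w. J (X 0 w) * (g (X u w) * ?c n (X u w)) \<partial>M)" for n g u
  have c01: "0 \<le> ?c n z" "?c n z \<le> 1" for n z
    using cutoff_nonneg cutoff_le_1[OF _ hamiltonian_nonneg] by auto
  have mc: "(\<lambda>w. ?c n (X u w)) \<in> borel_measurable M" if "u \<ge> 0" for n u
    by (intro measurable_compose[OF measurable_poly_X[OF poly_hamiltonian that]] borel_measurable_continuous_onI continuous_on_cutoff)
  have mJ: "(\<lambda>w. J (X 0 w)) \<in> borel_measurable M" by (rule measurable_poly_X[OF poly_current]) simp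
  have dom: "\<bar>J (X 0 w) * (g (X u w) * ?c n (X u w))\<bar> \<le> \<bar>J (X 0 w) * g (X u w)\<bar>" for n g u w
  proof -
    have "\<bar>J (X 0 w) * g (X u w)\<bar> * ?c n (X u w) \<le> \<bar>J (X 0 w) * g (X u w)\<bar> * 1"
      using c01 by (intro mult_left_mono) auto
    thus ?thesis using c01[of n "X u w"] by (simp add: abs_mult mult_ac)
  qed
  have intA: "integrable M (\<lambda>w. J (X 0 w) * (g (X u w) * ?c n (X u w)))" if g: "poly g" and u: "u \<ge> 0" for n g u
    by (rule Bochner_Integration.integrable_bound[OF integrable_corr[OF g u]])
       (use mJ mc[OF u] measurable_poly_X[OF g u] dom in auto)
  have limA: "(\<lambda>n. A n g u) \<longlonglongrightarrow> corr g u" if g: "poly g" and u: "u \<ge> 0" for g u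
    unfolding A_def corr_def
  proof (rule integral_dominated_convergence[where w = "\<lambda>w. \<bar>J (X 0 w) * g (X u w)\<bar>"])
    show "AE w in M. (\<lambda>n. J (X 0 w) * (g (X u w) * ?c n (X u w))) \<longlonglongrightarrow> J (X 0 w) * g (X u w)"
    proof (intro AE_I2)
      fix w
      have "(\<lambda>n. J (X 0 w) * (g (X u w) * ?c n (X u w))) \<longlonglongrightarrow> J (X 0 w) * (g (X u w) * 1)"
        by (intro tendsto_intros cutoff_tendsto)
      thus "(\<lambda>n. J (X 0 w) * (g (X u w) * ?c n (X u w))) \<longlonglongrightarrow> J (X 0 w) * g (X u w)" by simp
    qed
  qed (use integrable_corr[OF g u] intA[OF g u] dom in auto)
  obtain C a where C: "C \<ge> 0" "\<And>z. \<bar>L f z\<bar> \<le> C * (1 + H z) ^ a" using poly_bound[OF Lf] by blast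
  \<comment> \<open>The cutoff vanishes above its level, and below it the energy bound on the
    polynomial \<open>L f\<close> is a constant.\<close>
  have Lb: "\<bar>L f z * ?c n z\<bar> \<le> C * (1 + real (Suc n)) ^ a" for n z
  proof (cases "H z < real (Suc n)")
    case True
    have "\<bar>L f z\<bar> * \<bar>?c n z\<bar> \<le> \<bar>L f z\<bar> * 1" using c01[of n z] by (intro mult_left_mono) auto
    also have "\<dots> \<le> C * (1 + H z) ^ a" using C by simp
    also have "\<dots> \<le> C * (1 + real (Suc n)) ^ a"
      using True hamiltonian_nonneg[of z] C by (intro mult_left_mono power_mono) auto
    finally show ?thesis by (simp add: abs_mult)
  next
    case False
    hence "?c n z = 0" using cutoff_eq_0[of "real (Suc n)" "H z" 2] by (simp add: numeral_3_eq_3 numeral_2_eq_2)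
    thus ?thesis using C by simp
  qed
  have fub: "(\<integral>w. J (X 0 w) * (LBINT u:{0..t}. L f (X u w) * ?c n (X u w)) \<partial>M) = (LBINT u:{0..t}. A n (L f) u)"
    "(\<lambda>u. indicator {0..t} u * A n (L f) u) \<in> borel_measurable lborel"
    "integrable M (\<lambda>w. J (X 0 w) * (LBINT u:{0..t}. L f (X u w) * ?c n (X u w)))" for n
  proof -
    have me: "(\<lambda>w. L f (X u w) * ?c n (X u w)) \<in> borel_measurable M" if "u \<ge> 0" for u
      using measurable_poly_X[OF Lf that] mc[OF that] by simp
    have co: "continuous_on {0..} (\<lambda>u. L f (X u w) * ?c n (X u w))" if "w \<in> space M" for w
      by (intro continuous_on_mult continuous_poly_X[OF Lf that]
          continuous_on_compose2[OF continuous_on_cutoff[of UNIV] continuous_poly_X[OF poly_hamiltonian that]]) auto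
    have iJ: "integrable M (\<lambda>w. J (X 0 w))" by (rule integrable_X0[OF poly_current])
    note * = prob_M me co Lb iJ
    show "(\<integral>w. J (X 0 w) * (LBINT u:{0..t}. L f (X u w) * ?c n (X u w)) \<partial>M) = (LBINT u:{0..t}. A n (L f) u)"
      unfolding A_def by (rule Fubini_time[OF *])
    show "(\<lambda>u. indicator {0..t} u * A n (L f) u) \<in> borel_measurable lborel"
      unfolding A_def by (rule measurable_time[OF *])
    show "integrable M (\<lambda>w. J (X 0 w) * (LBINT u:{0..t}. L f (X u w) * ?c n (X u w)))"
      by (rule integrable_time[OF *])
  qed
  have eq: "A n f t = A n f 0 + (LBINT u:{0..t}. A n (L f) u)" for n
  proof -
    have Lc: "L (\<lambda>z. f z * ?c n z) = (\<lambda>z. L f z * ?c n z)"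
      using gen_L_pol_cutoff[OF f, of 0 "real (Suc n)"] by (simp add: fun_eq_iff numeral_3_eq_3)
    have tf: "test_fun N \<nu> (\<lambda>z. f z * ?c n z)"
      using test_fun_pol_cutoff[OF f, of "real (Suc n)" 0] by (simp add: numeral_3_eq_3)
    let ?Z = "\<lambda>w. (f (X t w) * ?c n (X t w)) - (f (X 0 w) * ?c n (X 0 w)) - (LBINT u:{0..t}. L f (X u w) * ?c n (X u w))"
    have i: "integrable M (\<lambda>w. J (X 0 w) * (f (X t w) * ?c n (X t w)) - J (X 0 w) * (f (X 0 w) * ?c n (X 0 w)))"
      by (intro Bochner_Integration.integrable_diff intA f t order_refl)
    have e: "J (X 0 w) * ?Z w = J (X 0 w) * (f (X t w) * ?c n (X t w)) - J (X 0 w) * (f (X 0 w) * ?c n (X 0 w)) -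
        J (X 0 w) * (LBINT u:{0..t}. L f (X u w) * ?c n (X u w))" for w
      by (simp only: right_diff_distrib)
    have "(\<integral>w. J (X 0 w) * ?Z w \<partial>M) = 0"
    proof (rule martingale_orthogonal[OF tf measurable_pol[OF N1 poly_current] t, unfolded Lc])
      show "integrable M (\<lambda>w. J (X 0 w) * ?Z w)"
        unfolding e by (rule Bochner_Integration.integrable_diff[OF i fub(3)])
    qed
    also have "(\<integral>w. J (X 0 w) * ?Z w \<partial>M) = (\<integral>w. (J (X 0 w) * (f (X t w) * ?c n (X t w)) - J (X 0 w) * (f (X 0 w) * ?c n (X 0 w))) - J (X 0 w) * (LBINT u:{0..t}. L f (X u w) * ?c n (X u w)) \<partial>M)"
      by (simp only: e)
    also have "\<dots> = (\<integral>w. J (X 0 w) * (f (X t w) * ?c n (X t w)) - J (X 0 w) * (f (X 0 w) * ?c n (X 0 w)) \<partial>M) - (\<integral>w. J (X 0 w) * (LBINT u:{0..t}. L f (X u w) * ?c n (X u w)) \<partial>M)"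
      by (rule Bochner_Integration.integral_diff[OF i fub(3)])
    also have "(\<integral>w. J (X 0 w) * (f (X t w) * ?c n (X t w)) - J (X 0 w) * (f (X 0 w) * ?c n (X 0 w)) \<partial>M) = A n f t - A n f 0"
      unfolding A_def by (rule Bochner_Integration.integral_diff[OF intA[OF f t] intA[OF f order_refl]])
    also have "(\<integral>w. J (X 0 w) * (LBINT u:{0..t}. L f (X u w) * ?c n (X u w)) \<partial>M) = (LBINT u:{0..t}. A n (L f) u)"
      by (rule fub(1))
    finally show ?thesis by simp
  qed
  \<comment> \<open>This bound does not depend on the cutoff level; it is the majorant for the
    passage to the limit inside the time integral.\<close>
  obtain B where B: "\<And>u n. u \<ge> 0 \<Longrightarrow> \<bar>A n (L f) u\<bar> \<le> B"
  proof -
    obtain h where h: "poly h" "\<And>z. h z \<ge> 0" "\<And>t. t \<ge> 0 \<Longrightarrow> AE w in M. \<bar>J (X 0 w) * L f (X t w)\<bar> \<le> h (X 0 w)"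
      using poly_product_bound[OF Lf poly_current] by blast
    have "\<bar>A n (L f) u\<bar> \<le> (\<integral>w. h (X 0 w) \<partial>M)" if u: "u \<ge> 0" for u n
    proof -
      have "\<bar>A n (L f) u\<bar> \<le> (\<integral>w. \<bar>J (X 0 w) * (L f (X u w) * ?c n (X u w))\<bar> \<partial>M)" unfolding A_def by (rule integral_abs_bound)
      also have "\<dots> \<le> (\<integral>w. h (X 0 w) \<partial>M)"
      proof (intro integral_mono_AE integrable_abs intA Lf u integrable_X0 h(1))
        show "AE w in M. \<bar>J (X 0 w) * (L f (X u w) * ?c n (X u w))\<bar> \<le> h (X 0 w)"
          using h(3)[OF u] by eventually_elim (use dom[of _ "L f" u n] order_trans in blast)
      qed
      finally show ?thesis .
    qed
    thus ?thesis using that by blast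
  qed
  have lim': "(\<lambda>n. indicator {0..t} u * A n (L f) u) \<longlonglongrightarrow> indicator {0..t} u * corr (L f) u" for u
    using limA[OF Lf, of u] by (cases "u \<in> {0..t}") (auto intro!: tendsto_intros)
  show meas: "(\<lambda>u. indicator {0..t} u * corr (L f) u) \<in> borel_measurable lborel"
    by (rule borel_measurable_LIMSEQ_real[OF lim' fub(2)])
  have "(\<lambda>n. LBINT u:{0..t}. A n (L f) u) \<longlonglongrightarrow> (LBINT u:{0..t}. corr (L f) u)"
    unfolding set_lebesgue_integral_def real_scaleR_def
  proof (rule integral_dominated_convergence[where w = "\<lambda>u. indicator {0..t} u *\<^sub>R B"])
    show "integrable lborel (\<lambda>u. indicator {0..t} u *\<^sub>R B)"
      by (intro integrable_scaleR_left integrable_real_indicator) (auto simp: emeasure_lborel_Icc_eq)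
    show "AE u in lborel. norm (indicator {0..t} u * A n (L f) u) \<le> indicator {0..t} u *\<^sub>R B" for n
      using B by (intro AE_I2) (auto split: split_indicator)
  qed (use meas fub(2) lim' in auto)
  hence "(\<lambda>n. A n f 0 + (LBINT u:{0..t}. A n (L f) u)) \<longlonglongrightarrow> corr f 0 + (LBINT u:{0..t}. corr (L f) u)"
    by (intro tendsto_add limA[OF f]) auto
  moreover have "(\<lambda>n. A n f t) \<longlonglongrightarrow> corr f t" by (rule limA[OF f t])
  ultimately show "corr f t = corr f 0 + (LBINT u:{0..t}. corr (L f) u)"
    unfolding eq[symmetric] by (rule LIMSEQ_unique[symmetric])
qed

end


section \<open>Laplace transforms of the correlations and the resolvent equations\<close>

context stationary_chain
begin

text \<open>By Dynkin's formula the correlation is Lipschitz, because that of \<open>L f\<close> is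
  bounded.\<close>

lemma continuous_on_corr:
  assumes f: "poly f"
  shows "continuous_on {0..} (corr f)"
proof -
  obtain B where B: "\<And>u. u \<ge> 0 \<Longrightarrow> \<bar>corr (L f) u\<bar> \<le> B" using corr_bound[OF poly_gen_L[OF f]] by blast
  have int: "set_integrable lborel {0..t} (corr (L f))" if t: "t \<ge> 0" for t
    unfolding set_integrable_def
  proof (rule Bochner_Integration.integrable_bound)
    show "integrable lborel (\<lambda>u. indicator {0..t} u *\<^sub>R B)"
      by (intro integrable_scaleR_left integrable_real_indicator) (auto simp: emeasure_lborel_Icc_eq)
    show "(\<lambda>u. indicator {0..t} u *\<^sub>R corr (L f) u) \<in> borel_measurable lborel"
      using dynkin(2)[OF f t] by simp
    show "AE u in lborel. norm (indicator {0..t} u *\<^sub>R corr (L f) u) \<le> norm (indicator {0..t} u *\<^sub>R B)"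
      by (intro AE_I2) (auto split: split_indicator intro: order_trans[OF B abs_ge_self])
  qed
  have step: "\<bar>corr f v - corr f u\<bar> \<le> B * (v - u)" if uv: "0 \<le> u" "u \<le> v" for u v
  proof -
    have v: "0 \<le> v" using uv by simp
    have sub: "set_integrable lborel {0..v} (corr (L f))" by (rule int[OF v])
    have i: "set_integrable lborel {u<..v} (corr (L f))"
      by (rule set_integrable_subset[OF sub]) (use uv in auto)
    have disj: "{0..u} \<inter> {u<..v} = {}" by auto
    have "{0..v} = {0..u} \<union> {u<..v}" using uv by auto
    hence "(LBINT w:{0..v}. corr (L f) w) = (LBINT w:{0..u}. corr (L f) w) + (LBINT w:{u<..v}. corr (L f) w)"
      using set_integral_Un[OF disj int[OF uv(1)] i] by simp
    hence "\<bar>corr f v - corr f u\<bar> = \<bar>LBINT w:{u<..v}. corr (L f) w\<bar>"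
      using dynkin(1)[OF f v] dynkin(1)[OF f uv(1)] by simp
    also have "\<dots> \<le> (\<integral>w. norm (indicator {u<..v} w *\<^sub>R corr (L f) w) \<partial>lborel)"
      unfolding set_lebesgue_integral_def by (subst real_norm_def[symmetric]) (rule integral_norm_bound)
    also have "\<dots> \<le> (\<integral>w. indicator {u<..v} w *\<^sub>R B \<partial>lborel)"
    proof (rule integral_mono)
      show "integrable lborel (\<lambda>w. norm (indicator {u<..v} w *\<^sub>R corr (L f) w))"
        using i by (simp add: set_integrable_def)
      show "integrable lborel (\<lambda>w. indicator {u<..v} w *\<^sub>R B)"
        using uv by (intro integrable_scaleR_left integrable_real_indicator) auto
      show "norm (indicator {u<..v} w *\<^sub>R corr (L f) w) \<le> indicator {u<..v} w *\<^sub>R B" for w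
        using B[of w] uv by (auto split: split_indicator)
    qed
    also have "\<dots> = B * (v - u)" using uv by simp
    finally show ?thesis .
  qed
  have "B-lipschitz_on {0..} (corr f)"
  proof (rule lipschitz_onI)
    fix u v :: real assume "u \<in> {0..}" "v \<in> {0..}"
    thus "dist (corr f u) (corr f v) \<le> B * dist u v"
      using step[of u v] step[of v u] by (cases "u \<le> v") (auto simp: dist_real_def)
  next
    show "0 \<le> B" using B[of 0] by simp
  qed
  thus ?thesis by (rule lipschitz_on_continuous_on)
qed

text \<open>Since \<open>L f\<close> is again a polynomial, its correlation is continuous, and the
  fundamental theorem of calculus differentiates Dynkin's formula.\<close>

lemma has_derivative_corr:
  assumes f: "poly f" and t: "t > 0"
  shows "(corr f has_real_derivative corr (L f) t) (at t)"
proof -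
  have cont: "continuous_on {0..t + 1} (corr (L f))"
    by (rule continuous_on_subset[OF continuous_on_corr[OF poly_gen_L[OF f]]]) auto
  have "((\<lambda>v. integral {0..v} (corr (L f))) has_real_derivative corr (L f) t) (at t within {0..t + 1})"
    by (rule integral_has_real_derivative[OF cont]) (use t in auto)
  hence "((\<lambda>v. corr f 0 + integral {0..v} (corr (L f))) has_real_derivative corr (L f) t) (at t within {0..t + 1})"
    by (auto intro!: derivative_eq_intros)
  moreover have "corr f 0 + integral {0..v} (corr (L f)) = corr f v" if "v \<in> {0..t + 1}" for v
  proof -
    have "set_integrable lborel {0..v} (corr (L f))"
      by (rule borel_integrable_atLeastAtMost') (rule continuous_on_subset[OF cont], use that in auto)
    thus ?thesis using dynkin(1)[OF f, of v] that by (simp add: set_borel_integral_eq_integral(2))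
  qed
  ultimately have "(corr f has_real_derivative corr (L f) t) (at t within {0..t + 1})"
    using t by (subst has_field_derivative_cong_eventually[of _ "\<lambda>v. corr f 0 + integral {0..v} (corr (L f))"])
      (auto simp: eventually_at_filter)
  thus ?thesis using at_within_interior[of t "{0..t + 1}"] t by simp
qed

definition "lap l f = (LBINT t:{0..}. exp (- l * t) * corr f t)"

lemma set_integrable_exp:
  assumes "l > 0"
  shows "set_integrable lborel {0<..} (\<lambda>t::real. exp (- l * t))"
proof -
  have "set_integrable lborel (einterval (ereal 0) \<infinity>) (\<lambda>t. exp (- l * t))"
  proof (rule interval_integral_FTC_nonneg)
    show "DERIV (\<lambda>t. - exp (- l * t) / l) t :> exp (- l * t)" for t
      using assms by (auto intro!: derivative_eq_intros)
    show "(((\<lambda>t. - exp (- l * t) / l) \<circ> real_of_ereal) \<longlongrightarrow> - exp (- l * 0) / l) (at_right (ereal 0))"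
      unfolding ereal_tendsto_simps using assms by (intro tendsto_intros) auto
    have "((\<lambda>t. - exp (- l * t) / l) \<longlongrightarrow> 0) at_top"
      using assms by real_asymp
    thus "(((\<lambda>t. - exp (- l * t) / l) \<circ> real_of_ereal) \<longlongrightarrow> 0) (at_left \<infinity>)"
      unfolding ereal_tendsto_simps .
  qed (auto intro!: continuous_intros)
  also have "einterval (ereal 0) \<infinity> = {0<..}" by (auto simp: einterval_def)
  finally show ?thesis .
qed

text \<open>The open half-line is the domain on which the improper fundamental theorem of calculus
  is stated; the endpoint is a null set.\<close>

lemma
  assumes l: "l > 0" and f: "poly f"
  shows integrable_lap: "set_integrable lborel {0<..} (\<lambda>t. exp (- l * t) * corr f t)"
    and lap_eq: "lap l f = (LBINT t:{0<..}. exp (- l * t) * corr f t)"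
proof -
  obtain B where B: "\<And>u. u \<ge> 0 \<Longrightarrow> \<bar>corr f u\<bar> \<le> B" using corr_bound[OF f] by blast
  have m: "(\<lambda>t. indicator A t *\<^sub>R (exp (- l * t) * corr f t)) \<in> borel_measurable borel"
    if "A \<subseteq> {0..}" "A \<in> sets borel" for A
    using that by (intro borel_measurable_continuous_on_indicator continuous_intros continuous_on_subset[OF continuous_on_corr[OF f]]) auto
  have sub: "{0<..} \<subseteq> {0::real..}" by auto
  have i: "integrable lborel (\<lambda>t. B * (indicator {0<..} t *\<^sub>R exp (- l * t)))"
    using set_integrable_exp[OF l] unfolding set_integrable_def by (rule integrable_mult_right)
  show "set_integrable lborel {0<..} (\<lambda>t. exp (- l * t) * corr f t)" unfolding set_integrable_def
  proof (rule Bochner_Integration.integrable_bound[OF i])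
    show "AE t in lborel. norm (indicator {0<..} t *\<^sub>R (exp (- l * t) * corr f t)) \<le> norm (B * (indicator {0<..} t *\<^sub>R exp (- l * t)))"
    proof (intro AE_I2)
      fix t :: real
      show "norm (indicator {0<..} t *\<^sub>R (exp (- l * t) * corr f t)) \<le> norm (B * (indicator {0<..} t *\<^sub>R exp (- l * t)))"
        using order_trans[OF B[of t] abs_ge_self] by (auto simp: abs_mult mult.commute split: split_indicator)
    qed
    show "(\<lambda>t. indicator {0<..} t *\<^sub>R (exp (- l * t) * corr f t)) \<in> borel_measurable lborel"
      using m[OF sub] by simp
  qed
  show "lap l f = (LBINT t:{0<..}. exp (- l * t) * corr f t)"
    unfolding lap_def set_lebesgue_integral_def
  proof (rule integral_cong_AE)
    show "AE t in lborel. indicator {0..} t *\<^sub>R (exp (- l * t) * corr f t) = indicator {0<..} t *\<^sub>R (exp (- l * t) * corr f t)"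
      by (rule eventually_mono[OF AE_lborel_singleton[of 0]]) (auto split: split_indicator)
  qed (use m[of "{0..}"] m[OF sub] in simp_all)
qed

text \<open>Integration by parts on the half-line. The boundary term at infinity vanishes because
  the correlation is bounded, and the one at 0 is the initial covariance.\<close>

lemma lap_generator:
  assumes l: "l > 0" and f: "poly f"
  shows "l * lap l f = corr f 0 + lap l (L f)"
proof -
  note Lf = poly_gen_L[OF f]
  obtain B where B: "\<And>u. u \<ge> 0 \<Longrightarrow> \<bar>corr f u\<bar> \<le> B" using corr_bound[OF f] by blast
  let ?F = "\<lambda>t. - (exp (- l * t) * corr f t)"
  let ?f = "\<lambda>t. l * (exp (- l * t) * corr f t) - exp (- l * t) * corr (L f) t"
  have i1: "set_integrable lborel {0<..} (\<lambda>t. l * (exp (- l * t) * corr f t))"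
    by (intro set_integrable_mult_right integrable_lap l f)
  have int: "set_integrable lborel {0<..} ?f"
    by (rule set_integral_diff(1)[OF i1 integrable_lap[OF l Lf]])
  have e: "einterval (ereal 0) \<infinity> = {0<..}" by (auto simp: einterval_def)
  have "(LBINT t=ereal 0..\<infinity>. ?f t) = 0 - (- corr f 0)"
  proof (rule interval_integral_FTC_integrable)
    fix t assume "ereal 0 < ereal t" hence t: "t > 0" by simp
    have "(?F has_real_derivative ?f t) (at t)"
      using has_derivative_corr[OF f t] by (auto intro!: derivative_eq_intros)
    thus "(?F has_vector_derivative ?f t) (at t)" by (simp add: has_real_derivative_iff_has_vector_derivative)
    have "continuous_on {0<..} ?f"
      by (intro continuous_intros continuous_on_subset[OF continuous_on_corr[OF f]] continuous_on_subset[OF continuous_on_corr[OF Lf]]) auto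
    thus "isCont ?f t" using t by (simp add: continuous_on_eq_continuous_at)
  next
    show "set_integrable lborel (einterval (ereal 0) \<infinity>) ?f" unfolding e by (rule int)
    have "continuous_on {0..} ?F"
      by (intro continuous_intros continuous_on_corr f)
    hence "(?F \<longlongrightarrow> ?F 0) (at 0 within {0..})"
      unfolding continuous_on_def by (rule bspec) simp
    hence "(?F \<longlongrightarrow> ?F 0) (at_right 0)" by (rule tendsto_within_subset) auto
    thus "((?F \<circ> real_of_ereal) \<longlongrightarrow> - corr f 0) (at_right (ereal 0))"
      unfolding ereal_tendsto_simps by simp
    have "(?F \<longlongrightarrow> 0) at_top"
    proof (rule Lim_null_comparison)
      show "\<forall>\<^sub>F t in at_top. norm (?F t) \<le> B * exp (- l * t)"
        using eventually_ge_at_top[of 0] by eventually_elim (use B in \<open>simp add: abs_mult mult.commute mult_right_mono\<close>)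
      show "((\<lambda>t. B * exp (- l * t)) \<longlongrightarrow> 0) at_top" using l by real_asymp
    qed
    thus "((?F \<circ> real_of_ereal) \<longlongrightarrow> 0) (at_left \<infinity>)"
      unfolding ereal_tendsto_simps .
  qed simp
  hence "corr f 0 = (LBINT t:{0<..}. ?f t)"
    by (simp add: interval_integral_to_infinity_eq)
  also have "\<dots> = l * (LBINT t:{0<..}. exp (- l * t) * corr f t) - (LBINT t:{0<..}. exp (- l * t) * corr (L f) t)"
    by (simp only: set_integral_diff(2)[OF i1 integrable_lap[OF l Lf]] set_integral_mult_right)
  finally show ?thesis by (simp add: lap_eq l f Lf)
qed

lemma lap_add: "l > 0 \<Longrightarrow> poly f \<Longrightarrow> poly g \<Longrightarrow> lap l (\<lambda>z. f z + g z) = lap l f + lap l g"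
proof -
  assume a: "l > 0" "poly f" "poly g"
  have "lap l (\<lambda>z. f z + g z) = (LBINT t:{0<..}. exp (- l * t) * corr f t + exp (- l * t) * corr g t)"
    unfolding lap_eq[OF a(1) pol_add[OF a(2,3)]]
    by (intro set_lebesgue_integral_cong) (auto simp: corr_add a distrib_left)
  also have "\<dots> = lap l f + lap l g"
    unfolding lap_eq[OF a(1,2)] lap_eq[OF a(1,3)] by (intro set_integral_add integrable_lap a)
  finally show ?thesis .
qed

lemma lap_cmult: "lap l (\<lambda>z. a * f z) = a * lap l f"
  unfolding lap_def corr_cmult by (simp add: mult.left_commute)

lemma lap_diff: "l > 0 \<Longrightarrow> poly f \<Longrightarrow> poly g \<Longrightarrow> lap l (\<lambda>z. f z - g z) = lap l f - lap l g"
  using lap_add[of l f "\<lambda>z. (-1) * g z"] lap_cmult[of l "-1" g] pol_minus[of N \<nu> g] by simp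

lemma lap_sum: "l > 0 \<Longrightarrow> finite I \<Longrightarrow> (\<And>i. i \<in> I \<Longrightarrow> poly (f i)) \<Longrightarrow> lap l (\<lambda>z. \<Sum>i\<in>I. f i z) = (\<Sum>i\<in>I. lap l (f i))"
proof (induction I rule: infinite_finite_induct)
  case empty
  show ?case using lap_cmult[of l 0 "\<lambda>_. 0"] by simp
next
  case (insert i I)
  thus ?case using lap_add[of l "f i" "\<lambda>z. \<Sum>i\<in>I. f i z"] by (simp add: pol_sum)
qed simp

lemma lap_kop:
  assumes l: "l > 0" and x: "x \<in> \<Lambda>" and f: "\<And>y. y \<in> \<Lambda> \<Longrightarrow> poly (f y)"
  shows "lap l (\<lambda>z. K (\<lambda>y. f y z) x) = K (\<lambda>y. lap l (f y)) x"
proof -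
  note fx = f[OF x] and fp = f[OF tadd_in_torus[OF N1]]
  have p: "poly (\<lambda>z. f (tadd N x (evec j)) z + f (tadd N x (- evec j)) z - 2 * f x z)" for j
    by (intro pol_intros fx fp)
  have t: "lap l (\<lambda>z. f (tadd N x (evec j)) z + f (tadd N x (- evec j)) z - 2 * f x z) =
      lap l (f (tadd N x (evec j))) + lap l (f (tadd N x (- evec j))) - 2 * lap l (f x)" for j
    by (subst lap_diff[OF l], (intro pol_intros fx fp)+, subst lap_add[OF l], (intro fp)+) (simp add: lap_cmult)
  have "lap l (\<lambda>z. K (\<lambda>y. f y z) x) = lap l (\<lambda>z. \<nu> * f x z) - lap l (\<lambda>z. \<omega> * (\<Sum>j\<in>UNIV. f (tadd N x (evec j)) z + f (tadd N x (- evec j)) z - 2 * f x z))"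
    unfolding kop_def by (intro lap_diff l pol_intros fx fp)
  also have "\<dots> = \<nu> * lap l (f x) - \<omega> * (\<Sum>j\<in>UNIV. lap l (\<lambda>z. f (tadd N x (evec j)) z + f (tadd N x (- evec j)) z - 2 * f x z))"
    unfolding lap_cmult by (subst lap_sum[OF l]) (auto intro: p)
  finally show ?thesis unfolding t by (simp add: kop_def)
qed

lemma lap_noise:
  assumes l: "l > 0" and x: "x \<in> \<Lambda>" and y: "y \<in> \<Lambda>"
  shows "lap l (\<lambda>z. noise N (\<lambda>x y. pp x y z) x y) = noise N (\<lambda>x y. lap l (pp x y)) x y"
proof -
  let ?d = "real CARD('d)"
  let ?n = "(1 / ?d\<^sup>2) * (\<Sum>k\<in>UNIV. of_bool (tadd N x (evec k) = y) + of_bool (tadd N y (evec k) = x))"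
  let ?q = "\<lambda>k z. pp (tadd N x (evec k)) (tadd N x (evec k)) z + pp (tadd N x (- evec k)) (tadd N x (- evec k)) z"
  have p: "poly (pp x y)" "\<And>v w. poly (pp (tadd N x v) (tadd N x w))"
    by (intro pol_pp x y tadd_in_torus N1)+
  have q: "poly (?q k)" for k by (intro pol_intros p)
  have q': "lap l (?q k) = lap l (pp (tadd N x (evec k)) (tadd N x (evec k))) + lap l (pp (tadd N x (- evec k)) (tadd N x (- evec k)))" for k
    by (intro lap_add l p)
  have "lap l (\<lambda>z. noise N (\<lambda>x y. pp x y z) x y) =
     lap l (\<lambda>z. - 2 * pp x y z - ?n * pp x y z) + lap l (\<lambda>z. of_bool (x = y) * ((1 / ?d) * (\<Sum>k\<in>UNIV. ?q k z)))"
    unfolding noise_def by (intro lap_add l pol_intros p)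
  also have "lap l (\<lambda>z. - 2 * pp x y z - ?n * pp x y z) = - 2 * lap l (pp x y) - ?n * lap l (pp x y)"
    by (subst lap_diff[OF l], (intro pol_mult pol_const p)+) (simp only: lap_cmult)
  also have "lap l (\<lambda>z. of_bool (x = y) * ((1 / ?d) * (\<Sum>k\<in>UNIV. ?q k z))) = of_bool (x = y) * ((1 / ?d) * (\<Sum>k\<in>UNIV. lap l (?q k)))"
    unfolding lap_cmult by (subst lap_sum[OF l]) (auto intro: q)
  finally show ?thesis unfolding q' noise_def .
qed

text \<open>The resolvent identity for the quadratic observables, combined with their images under
  \<open>L\<close>. The initial covariances vanish for \<open>pp\<close> and \<open>rr\<close> and
  give the source for \<open>pr\<close>.\<close>

lemma moment_equations_lap:
  assumes l: "l > 0"
  shows "moment_equations N \<omega> \<nu> \<gamma> l (pinned \<nu>) (\<lambda>x. s x) (\<lambda>x y. lap l (pp x y)) (\<lambda>x y. lap l (pr \<nu> x y)) (\<lambda>x y. lap l (rr \<nu> x y)) current_cov"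
proof
  show "lap l (pp x y) = lap l (pp y x)" for x y
    by (simp add: pp_def[abs_def] mult.commute)
  show "lap l (rr \<nu> x y) = lap l (rr \<nu> y x)" for x y
    by (simp add: rr_def[abs_def] mult.commute)
  fix x y :: "'d site" assume x: "x \<in> \<Lambda>" and y: "y \<in> \<Lambda>"
  note 0 = zero_in_torus[OF N1]
  note [intro] = pol_pp pol_pr pol_rr
  show "l * lap l (pp x y) = - s x * K (\<lambda>w. lap l (pr \<nu> y w)) x - s y * K (\<lambda>w. lap l (pr \<nu> x w)) y + \<gamma> * noise N (\<lambda>x y. lap l (pp x y)) x y"
  proof -
    have pK: "poly (\<lambda>z. - s x * K (\<lambda>w. pr \<nu> y w z) x)" "poly (\<lambda>z. s y * K (\<lambda>w. pr \<nu> x w z) y)"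
      using x y by (intro pol_mult pol_const pol_kop N1; blast)+
    have pn: "poly (\<lambda>z. \<gamma> * noise N (\<lambda>x y. pp x y z) x y)"
      unfolding noise_def using x y tadd_in_torus[OF N1] by (intro pol_intros pol_pp) auto
    have "lap l (L (pp x y)) = lap l (\<lambda>z. - s x * K (\<lambda>w. pr \<nu> y w z) x - s y * K (\<lambda>w. pr \<nu> x w z) y + \<gamma> * noise N (\<lambda>x y. pp x y z) x y)"
      by (rule arg_cong[of _ _ "lap l"]) (simp only: fun_eq_iff gen_L_pp[OF N2 x y] simp_thms)
    also have "\<dots> = - s x * lap l (\<lambda>z. K (\<lambda>w. pr \<nu> y w z) x) - s y * lap l (\<lambda>z. K (\<lambda>w. pr \<nu> x w z) y) + \<gamma> * lap l (\<lambda>z. noise N (\<lambda>x y. pp x y z) x y)"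
      by (simp only: lap_add[OF l pol_diff[OF pK] pn] lap_diff[OF l pK] lap_cmult)
    also have "lap l (\<lambda>z. K (\<lambda>w. pr \<nu> y w z) x) = K (\<lambda>w. lap l (pr \<nu> y w)) x" using y by (intro lap_kop l x) blast
    also have "lap l (\<lambda>z. K (\<lambda>w. pr \<nu> x w z) y) = K (\<lambda>w. lap l (pr \<nu> x w)) y" using x by (intro lap_kop l y) blast
    also note lap_noise[OF l x y]
    finally show ?thesis
      using lap_generator[OF l pol_pp[OF x y]] corr_0[OF pol_pp[OF x y]] E_pp_current[OF x y] by simp
  qed
  show "l * lap l (pr \<nu> x y) = current_cov x y + s y * lap l (pp x y) - pinned \<nu> * s 0 * lap l (pp x 0) - s x * K (\<lambda>w. lap l (rr \<nu> w y)) x - \<gamma> * lap l (pr \<nu> x y)"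
  proof -
    have p: "poly (\<lambda>z. s y * pp x y z)" "poly (\<lambda>z. pinned \<nu> * s 0 * pp x 0 z)" "poly (\<lambda>z. \<gamma> * pr \<nu> x y z)"
      using x y 0 by (intro pol_mult pol_const; blast)+
    have pK: "poly (\<lambda>z. s x * K (\<lambda>w. rr \<nu> w y z) x)"
      using x y by (intro pol_mult pol_const pol_kop N1; blast)
    have "lap l (L (pr \<nu> x y)) = lap l (\<lambda>z. s y * pp x y z - pinned \<nu> * s 0 * pp x 0 z - s x * K (\<lambda>w. rr \<nu> w y z) x - \<gamma> * pr \<nu> x y z)"
      by (rule arg_cong[of _ _ "lap l"]) (simp only: fun_eq_iff gen_L_pr[OF N2 x y] simp_thms)
    also have "\<dots> = s y * lap l (pp x y) - pinned \<nu> * s 0 * lap l (pp x 0) - s x * lap l (\<lambda>z. K (\<lambda>w. rr \<nu> w y z) x) - \<gamma> * lap l (pr \<nu> x y)"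
      by (simp only: lap_diff[OF l pol_diff[OF pol_diff[OF p(1,2)] pK] p(3)] lap_diff[OF l pol_diff[OF p(1,2)] pK] lap_diff[OF l p(1,2)] lap_cmult)
    also have "lap l (\<lambda>z. K (\<lambda>w. rr \<nu> w y z) x) = K (\<lambda>w. lap l (rr \<nu> w y)) x" using y by (intro lap_kop l x) blast
    finally show ?thesis
      using lap_generator[OF l pol_pr[OF x y]] corr_0[OF pol_pr[OF x y]] by (simp add: current_cov_def)
  qed
  show "l * lap l (rr \<nu> x y) = s x * lap l (pr \<nu> x y) - pinned \<nu> * s 0 * lap l (pr \<nu> 0 y) + s y * lap l (pr \<nu> y x) - pinned \<nu> * s 0 * lap l (pr \<nu> 0 x)"
  proof -
    have p: "poly (\<lambda>z. s x * pr \<nu> x y z)" "poly (\<lambda>z. pinned \<nu> * s 0 * pr \<nu> 0 y z)" "poly (\<lambda>z. s y * pr \<nu> y x z)" "poly (\<lambda>z. pinned \<nu> * s 0 * pr \<nu> 0 x z)"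
      using x y 0 by (intro pol_mult pol_const; blast)+
    have "lap l (L (rr \<nu> x y)) = lap l (\<lambda>z. s x * pr \<nu> x y z - pinned \<nu> * s 0 * pr \<nu> 0 y z + s y * pr \<nu> y x z - pinned \<nu> * s 0 * pr \<nu> 0 x z)"
      by (rule arg_cong[of _ _ "lap l"]) (simp only: fun_eq_iff gen_L_rr[OF N2 x y] simp_thms)
    also have "\<dots> = s x * lap l (pr \<nu> x y) - pinned \<nu> * s 0 * lap l (pr \<nu> 0 y) + s y * lap l (pr \<nu> y x) - pinned \<nu> * s 0 * lap l (pr \<nu> 0 x)"
      by (simp only: lap_diff[OF l pol_add[OF pol_diff[OF p(1,2)] p(3)] p(4)] lap_add[OF l pol_diff[OF p(1,2)] p(3)] lap_diff[OF l p(1,2)] lap_cmult)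
    finally show ?thesis
      using lap_generator[OF l pol_rr[OF x y]] corr_0[OF pol_rr[OF x y]] E_rr_current[OF x y] by simp
  qed
qed (use N pos l pinned_mult in auto)

lemma lap_current:
  assumes l: "l > 0"
  shows "lap l J = \<omega> * (\<Sum>x\<in>\<Lambda>. s x * (lap l (pr \<nu> x (sp x)) - lap l (pr \<nu> x (sm x))))"
proof -
  have p: "poly (pr \<nu> x (tadd N x v))" if "x \<in> \<Lambda>" for x v
    by (rule pol_pr[OF that tadd_in_torus[OF N1]])
  have "lap l J = \<omega> * (\<Sum>x\<in>\<Lambda>. lap l (\<lambda>z. s x * (pr \<nu> x (sp x) z - pr \<nu> x (sm x) z)))"
    unfolding current_pr lap_cmult[of l \<omega>]
    by (subst lap_sum[OF l finite_torus pol_mult[OF pol_const pol_diff[OF p p]]]) simp_all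
  also have "\<dots> = \<omega> * (\<Sum>x\<in>\<Lambda>. s x * (lap l (pr \<nu> x (sp x)) - lap l (pr \<nu> x (sm x))))"
    unfolding lap_cmult by (intro arg_cong[of _ _ "(*) \<omega>"] sum.cong refl) (simp add: lap_diff[OF l p p])
  finally show ?thesis .
qed

lemma green_kubo_lap: "green_kubo N m \<omega> k M X l = lap l J / real N ^ CARD('d)"
proof -
  have "current_correlation N m \<omega> k M X t = corr J t" for t
    by (simp add: current_correlation_def corr_def mult.commute)
  thus ?thesis by (simp add: green_kubo_def lap_def)
qed

text \<open>Neither constant involves \<open>N\<close> or \<open>l\<close>: the volume cancels
  against the normalisation, and \<open>l \<le> 1\<close> is absorbed into
  \<open>1 + \<gamma>\<close>.\<close>

lemma green_kubo_bounds:
  assumes m: "0 < m_lo" "\<And>x. x \<in> \<Lambda> \<Longrightarrow> m_lo \<le> m x \<and> m x \<le> m_hi" and l: "0 < l" "l \<le> 1"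
  defines "d \<equiv> real CARD('d)"
  defines "\<kappa> \<equiv> \<omega> * T * (d * (T / (\<nu> + 2 * d * \<omega>)))"
  shows "green_kubo N m \<omega> k M X l \<le> 2 * \<omega> * (T\<^sup>2 * d) / (\<gamma> * m_lo)"
    and "green_kubo N m \<omega> k M X l \<ge> \<kappa>\<^sup>2 / ((T\<^sup>2 * d) * (4 * (1 + \<gamma>)\<^sup>2 * m_hi / (\<gamma> * \<omega>) + 2 * (m_hi / m_lo) / \<gamma>))"
proof -
  interpret e: moment_equations N \<omega> \<nu> \<gamma> l "pinned \<nu>" "\<lambda>x. s x" "\<lambda>x y. lap l (pp x y)" "\<lambda>x y. lap l (pr \<nu> x y)" "\<lambda>x y. lap l (rr \<nu> x y)" current_cov
    by (rule moment_equations_lap[OF l(1)])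
  have d: "d > 0" by (simp add: d_def)
  have n: "real (card \<Lambda>) = real N ^ CARD('d)" "real N ^ CARD('d) > 0" using N by (auto simp: card_torus)
  have J: "lap l J = \<omega> * (\<Sum>x\<in>\<Lambda>. s x * e.jump k x)" by (simp add: lap_current[OF l(1)] e.jump_def)
  have T2: "T\<^sup>2 * d > 0" using pos d by simp
  have \<kappa>: "\<kappa> > 0" unfolding \<kappa>_def using pos d by (intro mult_pos_pos divide_pos_pos add_nonneg_pos) auto
  have cK: "K (current_cov x) y = \<omega> * (T\<^sup>2 * d) * s x * (of_bool (y = sp x) - of_bool (y = sm x))"
    if "x \<in> \<Lambda>" "y \<in> \<Lambda>" for x y unfolding d_def by (rule kop_current_cov[OF that])
  have cg: "current_cov x (sp x) - current_cov x (sm x) \<ge> s x * \<kappa>" if "x \<in> \<Lambda>" for x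
    unfolding \<kappa>_def d_def by (rule current_cov_jump_ge[OF that]) (use m(1) m(2)[OF that] in linarith)
  note b = e.current_bounds[where k = k and T = "T\<^sup>2 * d" and \<kappa> = \<kappa> and m = m and m_lo = m_lo and m_hi = m_hi, OF m refl T2 \<kappa> l(2) cK cg]
  show "green_kubo N m \<omega> k M X l \<le> 2 * \<omega> * (T\<^sup>2 * d) / (\<gamma> * m_lo)"
    unfolding green_kubo_lap J pos_divide_le_eq[OF n(2)] using b(1) unfolding n(1) .
  show "green_kubo N m \<omega> k M X l \<ge> \<kappa>\<^sup>2 / ((T\<^sup>2 * d) * (4 * (1 + \<gamma>)\<^sup>2 * m_hi / (\<gamma> * \<omega>) + 2 * (m_hi / m_lo) / \<gamma>))"
    unfolding green_kubo_lap J pos_le_divide_eq[OF n(2)] using b(2) unfolding n(1) .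
qed

end

section \<open>Passage from the uniform bounds to the iterated limits\<close>

theorem theorem2:
  fixes \<omega> \<nu> \<gamma> \<beta> m_lo m_hi :: real
    and m :: "nat \<Rightarrow> ('d::finite) site \<Rightarrow> real"
    and e1 :: 'd
    and M :: "nat \<Rightarrow> 'w measure"
    and X :: "nat \<Rightarrow> real \<Rightarrow> 'w \<Rightarrow> 'd conf"
  assumes "\<omega> > 0" and "\<nu> \<ge> 0" and "\<gamma> > 0" and "\<beta> > 0"
    and "0 < m_lo" and "m_lo \<le> m_hi"
    and masses: "\<And>N x. N \<ge> 1 \<Longrightarrow> x \<in> torus N \<Longrightarrow> m_lo \<le> m N x \<and> m N x \<le> m_hi"
    and dynamics: "\<And>N. N \<ge> 1 \<Longrightarrow> stationary_dynamics N (m N) \<omega> \<nu> \<gamma> \<beta> (M N) (X N)"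
  shows "\<exists>C::real. C > 0 \<and>
    ereal (1 / C) \<le> Liminf (at_right 0) (\<lambda>l.
      liminf (\<lambda>N. ereal (green_kubo N (m N) \<omega> e1 (M N) (X N) l))) \<and>
    Liminf (at_right 0) (\<lambda>l.
      liminf (\<lambda>N. ereal (green_kubo N (m N) \<omega> e1 (M N) (X N) l)))
      \<le> Limsup (at_right 0) (\<lambda>l.
      limsup (\<lambda>N. ereal (green_kubo N (m N) \<omega> e1 (M N) (X N) l))) \<and>
    Limsup (at_right 0) (\<lambda>l.
      limsup (\<lambda>N. ereal (green_kubo N (m N) \<omega> e1 (M N) (X N) l))) \<le> ereal C"
proof -
  define d where "d = real CARD('d)"
  define T where "T = 1 / \<beta>"
  define \<kappa> where "\<kappa> = \<omega> * T * (d * (T / (\<nu> + 2 * d * \<omega>)))"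
  define U where "U = 2 * \<omega> * (T\<^sup>2 * d) / (\<gamma> * m_lo)"
  define W where "W = \<kappa>\<^sup>2 / ((T\<^sup>2 * d) * (4 * (1 + \<gamma>)\<^sup>2 * m_hi / (\<gamma> * \<omega>) + 2 * (m_hi / m_lo) / \<gamma>))"
  have d: "d > 0" and T: "T > 0" using assms(4) by (auto simp: d_def T_def)
  have \<kappa>: "\<kappa> > 0" unfolding \<kappa>_def using assms(1,2) d T by (intro mult_pos_pos divide_pos_pos add_nonneg_pos) auto
  have W: "W > 0" unfolding W_def using \<kappa> d T assms
    by (intro divide_pos_pos mult_pos_pos add_pos_pos zero_less_power) auto
  \<comment> \<open>One constant serves both bounds: \<open>C \<ge> U\<close> for the upper one, and
    \<open>C \<ge> 1 / W\<close> is equivalent to \<open>1 / C \<le> W\<close> for the lower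
    one.\<close>
  define C where "C = max U (1 / W)"
  have C: "C > 0" "U \<le> C" "1 / C \<le> W"
  proof -
    show C: "C > 0" "U \<le> C" using W by (auto simp: C_def less_max_iff_disj)
    have "1 / W \<le> C" by (simp add: C_def)
    thus "1 / C \<le> W" using W C(1) by (simp add: field_simps)
  qed
  let ?G = "\<lambda>l N. green_kubo N (m N) \<omega> e1 (M N) (X N) l"
  have bound: "1 / C \<le> ?G l N \<and> ?G l N \<le> C" if N: "N \<ge> 3" and l: "0 < l" "l \<le> 1" for N l
  proof -
    have N1: "N \<ge> 1" using N by simp
    interpret chain N "m N" \<omega> \<nu> \<gamma> \<beta> by standard (use N assms in auto)
    interpret gibbs_chain N "m N" \<omega> \<nu> \<gamma> \<beta> e1
      by (rule gibbs_chain.intro[OF chain_axioms gibbs_chain_axioms.intro[OF prob_space_gibbs[OF N1 dynamics[OF N1]]]])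
    interpret stationary_chain N "m N" \<omega> \<nu> \<gamma> \<beta> e1 "M N" "X N"
      by standard (rule dynamics[OF N1])
    show ?thesis
      using green_kubo_bounds[OF assms(5) masses[OF N1] l] C(2,3)
      unfolding U_def W_def \<kappa>_def d_def T_def by linarith
  qed
  have small: "\<forall>\<^sub>F l in at_right 0. l \<in> {0<..<1::real}"
    by (rule eventually_at_right_real) simp
  have nontriv: "at_right (0::real) \<noteq> bot" by simp
  have lower: "ereal (1 / C) \<le> liminf (\<lambda>N. ereal (?G l N))" if "l \<in> {0<..<1}" for l
    using that bound by (intro Liminf_bounded eventually_mono[OF eventually_ge_at_top[of 3]]) auto
  have upper: "limsup (\<lambda>N. ereal (?G l N)) \<le> ereal C" if "l \<in> {0<..<1}" for l
    using that bound by (intro Limsup_bounded eventually_mono[OF eventually_ge_at_top[of 3]]) auto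
  have "ereal (1 / C) \<le> Liminf (at_right 0) (\<lambda>l. liminf (\<lambda>N. ereal (?G l N)))"
    by (intro Liminf_bounded eventually_mono[OF small] lower)
  moreover have "Limsup (at_right 0) (\<lambda>l. limsup (\<lambda>N. ereal (?G l N))) \<le> ereal C"
    by (intro Limsup_bounded eventually_mono[OF small] upper)
  moreover have "Liminf (at_right 0) (\<lambda>l. liminf (\<lambda>N. ereal (?G l N))) \<le> Limsup (at_right 0) (\<lambda>l. limsup (\<lambda>N. ereal (?G l N)))"
  proof -
    have "Liminf (at_right 0) (\<lambda>l. liminf (\<lambda>N. ereal (?G l N))) \<le> Limsup (at_right 0) (\<lambda>l. liminf (\<lambda>N. ereal (?G l N)))"
      by (rule Liminf_le_Limsup[OF nontriv])
    also have "\<dots> \<le> Limsup (at_right 0) (\<lambda>l. limsup (\<lambda>N. ereal (?G l N)))"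
      by (intro Limsup_mono always_eventually allI Liminf_le_Limsup) simp
    finally show ?thesis .
  qed
  ultimately show ?thesis using C(1) by blast
qed

end
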